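(* Let $\delta\geq 6$ and $n\geq 3\delta$ be integers, and let $k$ be an integer with $1\leq k\leq \frac{\delta}{4}$. Let $G$ be a (simple) graph of order $n$ with minimum degree $\delta$. If $\lambda_1(G)\geq \lambda_1(G_{n,\delta,k})$, then either $G= G_{n,\delta,k}$ (up to isomorphism), or $G$ contains $k$ spanning rigid subgraphs and $\left\lfloor\frac{\delta-4k}{2}\right\rfloor$ spanning trees which are pairwise edge-disjoint.
   Context: All graphs are finite and simple. For a graph $G$, $\lambda_1(G)$ denotes the spectral radius, i.e. the largest eigenvalue of the adjacency matrix of $G$. For integers $k\geq 1$, $\delta\geq 4k$, $n\geq 3\delta$, the graph $G_{n,\delta,k}$ is obtained from $K_1\vee(K_\delta\cup K_{n-1-\delta})$ (the join of a single vertex with the disjoint union of complete graphs $K_\delta$ and $K_{n-1-\delta}$) by joining one fixed vertex of $K_\delta$ to $k-1$ vertices of $K_{n-1-\delta}$. A graph is rigid (in $\mathbb{R}^2$) if some (equivalently every) generic bar-and-joint framework of it in $\mathbb{R}^2$ is rigid; combinatorially (Laman), a graph $H$ on $m\ge 2$ vertices is rigid iff it has a spanning subgraph with exactly $2m-3$ edges in which every vertex subset $X$ with $|X|\geq 2$ induces at most $2|X|-3$ edges. A spanning rigid subgraph of $G$ is a spanning subgraph of $G$ that is rigid. *)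

theory Defs
  imports
    "HOL-Analysis.Analysis"
    "HOL-Library.Poly_Mapping"
    "HOL-Library.Disjoint_Sets"
    "Jordan_Normal_Form.Spectral_Radius"
begin

section \<open>Finite simple graphs\<close>

record 'a sgraph =
  verts :: "'a set"
  edges :: "'a set set"

definition simple_graph :: "'a sgraph \<Rightarrow> bool" where
  "simple_graph G \<longleftrightarrow>
     finite (verts G) \<and> (\<forall>e\<in>edges G. e \<subseteq> verts G \<and> card e = 2)"

definition degree :: "'a sgraph \<Rightarrow> 'a \<Rightarrow> nat" where
  "degree G v = card {e \<in> edges G. v \<in> e}"

definition min_degree :: "'a sgraph \<Rightarrow> nat" where
  "min_degree G = Min (degree G ` verts G)"

definition graph_iso :: "'a sgraph \<Rightarrow> 'b sgraph \<Rightarrow> bool" where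
  "graph_iso G H \<longleftrightarrow>
     (\<exists>f. bij_betw f (verts G) (verts H) \<and>
          (\<forall>u\<in>verts G. \<forall>v\<in>verts G. {u, v} \<in> edges G \<longleftrightarrow> {f u, f v} \<in> edges H))"

definition spanning_subgraph :: "'a sgraph \<Rightarrow> 'a sgraph \<Rightarrow> bool" where
  "spanning_subgraph H G \<longleftrightarrow> verts H = verts G \<and> edges H \<subseteq> edges G"

definition connected_graph :: "'a sgraph \<Rightarrow> bool" where
  "connected_graph G \<longleftrightarrow> verts G \<noteq> {} \<and>
     (\<forall>u\<in>verts G. \<forall>v\<in>verts G. (u, v) \<in> {(x, y). {x, y} \<in> edges G}\<^sup>*)"

definition is_cycle :: "'a sgraph \<Rightarrow> 'a list \<Rightarrow> bool" where
  "is_cycle G vs \<longleftrightarrow> length vs \<ge> 3 \<and> distinct vs \<and> set vs \<subseteq> verts G \<and>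
     (\<forall>i<length vs. {vs ! i, vs ! (Suc i mod length vs)} \<in> edges G)"

definition is_tree :: "'a sgraph \<Rightarrow> bool" where
  "is_tree G \<longleftrightarrow> connected_graph G \<and> (\<nexists>vs. is_cycle G vs)"

section \<open>The spectral radius of a graph\<close>

definition adj_matrix :: "'a sgraph \<Rightarrow> 'a list \<Rightarrow> real mat" where
  "adj_matrix G vs =
     Matrix.mat (length vs) (length vs) (\<lambda>(i, j). if {vs ! i, vs ! j} \<in> edges G then 1 else 0)"

text \<open>The spectrum does not depend on the enumeration of the vertices that is chosen here;
  see \<open>eigenvalue_adj_matrix_iff\<close> below.\<close>

definition lambda1 :: "'a sgraph \<Rightarrow> real" where
  "lambda1 G = Max (spectrum (adj_matrix G (SOME vs. distinct vs \<and> set vs = verts G)))"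

lemma eigenvalue_adj_matrix_iff:
  assumes "distinct vs"
  shows "eigenvalue (adj_matrix G vs) k \<longleftrightarrow>
    (\<exists>x. (\<exists>v\<in>set vs. x v \<noteq> 0) \<and>
         (\<forall>v\<in>set vs. (\<Sum>u\<in>set vs. (if {v, u} \<in> edges G then 1 else 0) * x u) = k * x v))"
    (is "?L \<longleftrightarrow> ?R")
proof -
  let ?n = "length vs"
  let ?a = "\<lambda>v u. if {v, u} \<in> edges G then 1 else (0::real)"
  have bij: "bij_betw (\<lambda>i. vs ! i) {0..<?n} (set vs)"
    using bij_betw_nth[OF assms, of "{0..<?n}" "set vs"] by (simp add: atLeast0LessThan)
  have sum_vs: "(\<Sum>u\<in>set vs. f u) = (\<Sum>j = 0..<?n. f (vs ! j))" for f :: "'a \<Rightarrow> real"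
    by (rule sum.reindex_bij_betw[OF bij, symmetric])
  have all_vs: "(\<forall>v\<in>set vs. P v) \<longleftrightarrow> (\<forall>i<?n. P (vs ! i))" for P
    by (simp add: all_set_conv_all_nth)
  have dim: "dim_row (adj_matrix G vs) = ?n"
    by (simp add: adj_matrix_def)
  have key: "eigenvector (adj_matrix G vs) w k \<longleftrightarrow>
      dim_vec w = ?n \<and> (\<exists>i<?n. vec_index w i \<noteq> 0) \<and>
      (\<forall>i<?n. (\<Sum>j = 0..<?n. ?a (vs ! i) (vs ! j) * vec_index w j) = k * vec_index w i)" for w
  proof (cases "dim_vec w = ?n")
    case True
    have nz: "w \<noteq> 0\<^sub>v ?n \<longleftrightarrow> (\<exists>i<?n. vec_index w i \<noteq> 0)"
      using True by (auto intro!: eq_vecI)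
    have entry: "vec_index (adj_matrix G vs *\<^sub>v w) i =
        (\<Sum>j = 0..<?n. ?a (vs ! i) (vs ! j) * vec_index w j)" if "i < ?n" for i
      using that True by (simp add: adj_matrix_def scalar_prod_def cong: if_cong)
    have "adj_matrix G vs *\<^sub>v w = k \<cdot>\<^sub>v w \<longleftrightarrow>
        (\<forall>i<?n. vec_index (adj_matrix G vs *\<^sub>v w) i = k * vec_index w i)"
    proof
      assume "\<forall>i<?n. vec_index (adj_matrix G vs *\<^sub>v w) i = k * vec_index w i"
      then show "adj_matrix G vs *\<^sub>v w = k \<cdot>\<^sub>v w"
        by (intro eq_vecI) (simp_all add: True adj_matrix_def del: index_mult_mat_vec)
    qed (simp add: True)
    also have "\<dots> \<longleftrightarrow> (\<forall>i<?n.
        (\<Sum>j = 0..<?n. ?a (vs ! i) (vs ! j) * vec_index w j) = k * vec_index w i)"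
      by (intro all_cong arg_cong[where f = "\<lambda>y. y = _"] entry)
    finally have eq: "adj_matrix G vs *\<^sub>v w = k \<cdot>\<^sub>v w \<longleftrightarrow> \<dots>" .
    show ?thesis
      unfolding eigenvector_def dim nz eq carrier_vec_def mem_Collect_eq by (rule refl)
  next
    case False
    then show ?thesis
      unfolding eigenvector_def dim carrier_vec_def mem_Collect_eq by blast
  qed
  show ?thesis
  proof
    assume ?L
    then obtain w where "eigenvector (adj_matrix G vs) w k"
      by (auto simp: eigenvalue_def)
    note w = this[unfolded key]
    define x where "x = (\<lambda>v. vec_index w (inv_into {0..<?n} (\<lambda>i. vs ! i) v))"
    have x: "x (vs ! i) = vec_index w i" if "i < ?n" for i
      using that bij by (simp add: x_def bij_betw_def inv_into_f_f)
    obtain i where i: "i < ?n" "vec_index w i \<noteq> 0"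
      using w by blast
    have "\<exists>v\<in>set vs. x v \<noteq> 0"
      using i x[OF i(1)] nth_mem[OF i(1)] by (intro bexI[of _ "vs ! i"]) simp_all
    moreover have "\<forall>v\<in>set vs. (\<Sum>u\<in>set vs. ?a v u * x u) = k * x v"
      unfolding all_vs sum_vs
    proof (intro allI impI)
      fix i assume i: "i < ?n"
      have "(\<Sum>j = 0..<?n. ?a (vs ! i) (vs ! j) * x (vs ! j)) =
          (\<Sum>j = 0..<?n. ?a (vs ! i) (vs ! j) * vec_index w j)"
        by (intro sum.cong refl arg_cong2[where f = "(*)"] x) simp
      also have "\<dots> = k * vec_index w i"
        using w i by blast
      finally show "(\<Sum>j = 0..<?n. ?a (vs ! i) (vs ! j) * x (vs ! j)) = k * x (vs ! i)"
        unfolding x[OF i] .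
    qed
    ultimately show ?R by blast
  next
    assume ?R
    then obtain x where x: "\<exists>v\<in>set vs. x v \<noteq> 0"
      "\<forall>v\<in>set vs. (\<Sum>u\<in>set vs. ?a v u * x u) = k * x v" by blast
    let ?w = "Matrix.vec ?n (\<lambda>i. x (vs ! i))"
    have w: "vec_index ?w i = x (vs ! i)" if "i < ?n" for i
      using that by simp
    obtain i where i: "i < ?n" "x (vs ! i) \<noteq> 0"
      using x(1) by (metis in_set_conv_nth)
    have "eigenvector (adj_matrix G vs) ?w k"
      unfolding key
    proof (intro conjI allI impI)
      show "\<exists>i<?n. vec_index ?w i \<noteq> 0"
        using i w by auto
    next
      fix i assume i: "i < ?n"
      have "(\<Sum>j = 0..<?n. ?a (vs ! i) (vs ! j) * vec_index ?w j) =
          (\<Sum>j = 0..<?n. ?a (vs ! i) (vs ! j) * x (vs ! j))"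
        by (intro sum.cong refl arg_cong2[where f = "(*)"] w) simp
      also have "\<dots> = k * x (vs ! i)"
        using x(2)[unfolded all_vs sum_vs] i by blast
      finally show "(\<Sum>j = 0..<?n. ?a (vs ! i) (vs ! j) * vec_index ?w j) =
          k * vec_index ?w i"
        unfolding w[OF i] .
    qed simp
    then show ?L by (auto simp: eigenvalue_def)
  qed
qed

section \<open>The extremal graph\<close>

definition complete_graph :: "'a set \<Rightarrow> 'a sgraph" where
  "complete_graph S = \<lparr>verts = S, edges = {e. e \<subseteq> S \<and> card e = 2}\<rparr>"

text \<open>Both operations are meant for graphs on disjoint vertex sets.\<close>

definition graph_union :: "'a sgraph \<Rightarrow> 'a sgraph \<Rightarrow> 'a sgraph" where
  "graph_union G H = \<lparr>verts = verts G \<union> verts H, edges = edges G \<union> edges H\<rparr>"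

definition graph_join :: "'a sgraph \<Rightarrow> 'a sgraph \<Rightarrow> 'a sgraph" where
  "graph_join G H =
     \<lparr>verts = verts G \<union> verts H,
      edges = edges G \<union> edges H \<union> {{u, v} |u v. u \<in> verts G \<and> v \<in> verts H}\<rparr>"

definition add_edges :: "'a sgraph \<Rightarrow> 'a set set \<Rightarrow> 'a sgraph" where
  "add_edges G F = \<lparr>verts = verts G, edges = edges G \<union> F\<rparr>"

text \<open>The single vertex is \<open>0\<close>, the complete graph on \<open>\<delta>\<close> vertices lives on \<open>{1..\<delta>}\<close> and the
  other one on \<open>{\<delta>+1..<n}\<close>; vertex \<open>1\<close> is joined to the \<open>k - 1\<close> vertices in \<open>{\<delta>+1..<\<delta>+k}\<close>.\<close>

definition extremal_graph :: "nat \<Rightarrow> nat \<Rightarrow> nat \<Rightarrow> nat sgraph" where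
  "extremal_graph n \<delta> k =
     add_edges
       (graph_join (complete_graph {0})
          (graph_union (complete_graph {1..\<delta>}) (complete_graph {\<delta>+1..<n})))
       {{1, w} |w. w \<in> {\<delta>+1..<\<delta>+k}}"

section \<open>Generic rigidity in the plane\<close>

definition mpoly_eval :: "(('i \<Rightarrow>\<^sub>0 nat) \<Rightarrow>\<^sub>0 rat) \<Rightarrow> ('i \<Rightarrow> real) \<Rightarrow> real" where
  "mpoly_eval P x =
     (\<Sum>m\<in>Poly_Mapping.keys P. of_rat (Poly_Mapping.lookup P m) *
        (\<Prod>i\<in>Poly_Mapping.keys m. x i ^ Poly_Mapping.lookup m i))"

definition alg_indep_over_rat :: "'i set \<Rightarrow> ('i \<Rightarrow> real) \<Rightarrow> bool" where
  "alg_indep_over_rat I x \<longleftrightarrow>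
     (\<forall>P. (\<forall>m\<in>Poly_Mapping.keys P. Poly_Mapping.keys m \<subseteq> I) \<and> mpoly_eval P x = 0 \<longrightarrow> P = 0)"

text \<open>A framework is a graph \<open>G\<close> with a placement \<open>p\<close> of its vertices; values of \<open>p\<close> outside
  \<open>verts G\<close> play no role.\<close>

definition generic_placement :: "'a sgraph \<Rightarrow> ('a \<Rightarrow> real ^ 2) \<Rightarrow> bool" where
  "generic_placement G p \<longleftrightarrow>
     alg_indep_over_rat (verts G \<times> (UNIV :: 2 set)) (\<lambda>(v, i). vec_nth (p v) i)"

definition equivalent_placements ::
    "'a sgraph \<Rightarrow> ('a \<Rightarrow> real ^ 2) \<Rightarrow> ('a \<Rightarrow> real ^ 2) \<Rightarrow> bool" where
  "equivalent_placements G p q \<longleftrightarrow>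
     (\<forall>u v. {u, v} \<in> edges G \<longrightarrow> dist (p u) (p v) = dist (q u) (q v))"

definition congruent_placements ::
    "'a sgraph \<Rightarrow> ('a \<Rightarrow> real ^ 2) \<Rightarrow> ('a \<Rightarrow> real ^ 2) \<Rightarrow> bool" where
  "congruent_placements G p q \<longleftrightarrow>
     (\<forall>u\<in>verts G. \<forall>v\<in>verts G. dist (p u) (p v) = dist (q u) (q v))"

definition rigid_framework :: "'a sgraph \<Rightarrow> ('a \<Rightarrow> real ^ 2) \<Rightarrow> bool" where
  "rigid_framework G p \<longleftrightarrow>
     (\<exists>\<epsilon>>0. \<forall>q. (\<forall>v\<in>verts G. dist (p v) (q v) < \<epsilon>) \<and> equivalent_placements G p q
                \<longrightarrow> congruent_placements G p q)"

definition rigid :: "'a sgraph \<Rightarrow> bool" where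
  "rigid G \<longleftrightarrow> (\<exists>p. generic_placement G p \<and> rigid_framework G p)"

end

theory Submission
  imports Defs "HOL-Library.Function_Algebras"
begin

text \<open>The rows of the rigidity matrix at a placement and the rows of the incidence matrix define
  linear rank functions on the edge set, and a packing exists as soon as every edge set \<open>F\<close> satisfies
  the matroid union condition: the number of edges outside \<open>F\<close> is at least \<open>k\<close> times the defect of the
  rigidity rank of \<open>F\<close> plus \<open>l\<close> times the defect of its graphic rank. At a placement of locally maximal
  rank, the rigidity rank of \<open>F\<close> is at least the sum of \<open>2 |X| - 3\<close> over some cover of \<open>F\<close> by vertex
  sets \<open>X\<close> (Lovasz and Yemini), so the condition becomes an edge count. A spectral radius above
  \<open>n - \<delta> - 1\<close> forces at most \<open>\<delta> (n - \<delta>) - (\<delta> + 1) / 2\<close> non-edges. With the minimum degree this makes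
  the count succeed, except for two sets covering all vertices and sharing a single one, with \<open>\<delta>\<close>
  further vertices in one of them. There at least \<open>k\<close> edges must cross, and comparing Perron
  vectors shows that otherwise the graph is the extremal one. Finally, if the rigidity matrix has full
  rank at one placement, then it has full rank nearby, in particular at some generic placement; and
  the difference of two nearby placements with equal edge lengths is an infinitesimal motion of their
  midpoint.\<close>

text \<open>The packing condition collapses to one inequality. For an edge, the row at any placement
  is a complex multiple of the row at an injective real placement. Comparing dimensions, the graphic
  defect \<open>n - 1 - rG F\<close> of a nonempty \<open>F\<close> is at most half of the rigidity
  defect \<open>a = 2 * n - 3 - rR F\<close>. So \<open>k\<close> times \<open>a\<close> plus
  \<open>l\<close> times the graphic defect is at most \<open>(4 * k + 2 * l) * a / 4\<close>, and
  the number of trees is the largest \<open>l\<close> with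
  \<open>4 * k + 2 * l \<le> \<delta>\<close>: it suffices that \<open>\<delta> * a / 4\<close>
  edges lie outside \<open>F\<close>. In the exceptional configuration \<open>a \<le> 1\<close> and
  the graphic defect is zero, so \<open>k\<close> edges suffice there, one more than the
  \<open>k - 1\<close> crossing edges of the extremal graph. No combinatorial characterisation of
  rigidity enters: the cover is read off from the dependencies of the rows, which is possible
  because at a placement of locally maximal rank a dependency can be differentiated.\<close>

section \<open>Packing spanning sets\<close>

text \<open>A matroid rank function up to normalisation: the empty set may have positive rank, so
  that contraction is just \<open>r (insert e F)\<close> without subtracting
  \<open>r {e}\<close>.\<close>

definition rank_fun :: "'e set \<Rightarrow> ('e set \<Rightarrow> nat) \<Rightarrow> bool" where
  "rank_fun E r \<longleftrightarrow>
     (\<forall>F F'. F \<subseteq> F' \<and> F' \<subseteq> E \<longrightarrow> r F \<le> r F') \<and>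
     (\<forall>e F. insert e F \<subseteq> E \<longrightarrow> r (insert e F) \<le> Suc (r F)) \<and>
     (\<forall>F F'. F \<subseteq> E \<and> F' \<subseteq> E \<longrightarrow> r (F \<union> F') + r (F \<inter> F') \<le> r F + r F')"

lemma rank_funD:
  assumes "rank_fun E r"
  shows "F \<subseteq> F' \<Longrightarrow> F' \<subseteq> E \<Longrightarrow> r F \<le> r F'"
    and "insert e F \<subseteq> E \<Longrightarrow> r (insert e F) \<le> Suc (r F)"
    and "F \<subseteq> E \<Longrightarrow> F' \<subseteq> E \<Longrightarrow> r (F \<union> F') + r (F \<inter> F') \<le> r F + r F'"
  using assms unfolding rank_fun_def by metis+

lemma rank_fun_contract:
  assumes "rank_fun (insert e E) r"
  shows "rank_fun E (\<lambda>F. r (insert e F))"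
proof -
  have "r (insert e (F \<union> F')) + r (insert e (F \<inter> F')) \<le> r (insert e F) + r (insert e F')"
    if "F \<subseteq> E" "F' \<subseteq> E" for F F'
  proof -
    have "insert e F \<union> insert e F' = insert e (F \<union> F')" "insert e F \<inter> insert e F' = insert e (F \<inter> F')"
      by auto
    moreover have "insert e F \<subseteq> insert e E" "insert e F' \<subseteq> insert e E"
      using that by auto
    ultimately show ?thesis
      using rank_funD(3)[OF assms, of "insert e F" "insert e F'"] by simp
  qed
  moreover have "r (insert e (insert x F)) \<le> Suc (r (insert e F))" if "insert x F \<subseteq> E" for x F
    using rank_funD(2)[OF assms, of x "insert e F"] that by (simp add: insert_commute insert_mono subset_insertI2)
  moreover have "r (insert e F) \<le> r (insert e F')" if "F \<subseteq> F'" "F' \<subseteq> E" for F F'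
    using that by (intro rank_funD(1)[OF assms]) auto
  ultimately show ?thesis
    unfolding rank_fun_def by blast
qed

lemma rank_fun_delete: "rank_fun E r \<Longrightarrow> E' \<subseteq> E \<Longrightarrow> rank_fun E' r"
  unfolding rank_fun_def by (meson order_trans)

text \<open>Assign an element \<open>e\<close> to some index \<open>j\<close>, contracting \<open>e\<close> in \<open>r j\<close> and deleting it from
  the others. If this fails for every \<open>j\<close>, there are tight sets \<open>F j\<close> avoiding \<open>e\<close> that span \<open>e\<close>
  with respect to \<open>r j\<close>; their union is tight too, and adding \<open>e\<close> to it violates the condition.\<close>

lemma disjoint_spanning_sets:
  fixes r :: "'i \<Rightarrow> 'e set \<Rightarrow> nat"
  assumes "finite E" "finite I"
    and "\<And>i. i \<in> I \<Longrightarrow> rank_fun E (r i)"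
    and "\<And>i F. i \<in> I \<Longrightarrow> F \<subseteq> E \<Longrightarrow> r i F \<le> R i"
    and "\<And>F. F \<subseteq> E \<Longrightarrow> (\<Sum>i\<in>I. R i) \<le> card (E - F) + (\<Sum>i\<in>I. r i F)"
  shows "\<exists>P. (\<forall>i\<in>I. P i \<subseteq> E \<and> r i (P i) = R i) \<and> disjoint_family_on P I"
  using assms(1,3-)
proof (induction E arbitrary: r rule: finite_induct)
  case empty
  have "(\<Sum>i\<in>I. r i {}) = (\<Sum>i\<in>I. R i)"
    using empty(3)[of "{}"] sum_mono[of I "\<lambda>i. r i {}" R] empty(2) by force
  then have "\<forall>i\<in>I. r i {} = R i"
    using sum_mono_inv[of "\<lambda>i. r i {}" I R] empty(2) assms(2) by blast
  then show ?case
    by (intro exI[of _ "\<lambda>_. {}"]) (auto simp: disjoint_family_on_def)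
next
  case (insert e E)
  show ?case
  proof (cases "I = {}")
    case False
    let ?E = "insert e E"
    note rf = insert.prems(1) and le = insert.prems(2) and cond = insert.prems(3)
    define r' where "r' j i = (if i = j then (\<lambda>F. r j (insert e F)) else r i)" for j i
    have sum_r': "(\<Sum>i\<in>I. r' j i F) = r j (insert e F) + (\<Sum>i\<in>I-{j}. r i F)" if "j \<in> I" for j F
    proof -
      have "(\<Sum>i\<in>I. r' j i F) = r' j j F + (\<Sum>i\<in>I-{j}. r' j i F)"
        using that assms(2) by (simp add: sum.remove)
      also have "(\<Sum>i\<in>I-{j}. r' j i F) = (\<Sum>i\<in>I-{j}. r i F)"
        by (rule sum.cong) (auto simp: r'_def)
      finally show ?thesis by (simp add: r'_def)
    qed
    have card_E: "card (?E - F) = Suc (card (E - F))" if "F \<subseteq> E" for F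
    proof -
      have "?E - F = insert e (E - F)" using that insert.hyps by auto
      then show ?thesis using insert.hyps by simp
    qed
    have "\<exists>j\<in>I. \<forall>F\<subseteq>E. (\<Sum>i\<in>I. R i) \<le> card (E - F) + (\<Sum>i\<in>I. r' j i F)"
    proof (rule ccontr)
      assume "\<not> ?thesis"
      then have "\<forall>j\<in>I. \<exists>F\<subseteq>E. card (E - F) + (\<Sum>i\<in>I. r' j i F) < (\<Sum>i\<in>I. R i)"
        by (simp add: not_le)
      then obtain T where T: "\<And>j. j \<in> I \<Longrightarrow> T j \<subseteq> E"
        "\<And>j. j \<in> I \<Longrightarrow> card (E - T j) + (\<Sum>i\<in>I. r' j i (T j)) < (\<Sum>i\<in>I. R i)"
        by metis
      \<comment> \<open>\<open>f\<close> is submodular and at least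
        \<open>(\<Sum>i\<in>I. R i)\<close> on all subsets of \<open>?E\<close>, so the sets
        attaining this bound are closed under union.\<close>
      define f where "f F = card (?E - F) + (\<Sum>i\<in>I. r i F)" for F
      have f_ge: "(\<Sum>i\<in>I. R i) \<le> f F" if "F \<subseteq> ?E" for F
        using cond[OF that] by (simp add: f_def)
      have tight: "f (T j) = (\<Sum>i\<in>I. R i)" "r j (insert e (T j)) = r j (T j)" if "j \<in> I" for j
      proof -
        have "(\<Sum>i\<in>I. r i (T j)) = r j (T j) + (\<Sum>i\<in>I-{j}. r i (T j))"
          using that assms(2) by (simp add: sum.remove)
        moreover have "r j (T j) \<le> r j (insert e (T j))"
          using T(1)[OF that] by (intro rank_funD(1)[OF rf[OF that]]) auto
        moreover have "(\<Sum>i\<in>I. R i) \<le> f (T j)"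
          using T(1)[OF that] by (intro f_ge) auto
        ultimately show "f (T j) = (\<Sum>i\<in>I. R i)" "r j (insert e (T j)) = r j (T j)"
          using T(2)[OF that] card_E[OF T(1)[OF that]] sum_r'[OF that, of "T j"]
          by (simp_all add: f_def)
      qed
      have f_union: "f (F \<union> F') = (\<Sum>i\<in>I. R i)"
        if "F \<subseteq> E" "F' \<subseteq> E" "f F = (\<Sum>i\<in>I. R i)" "f F' = (\<Sum>i\<in>I. R i)" for F F'
      proof -
        have "card (?E - (F \<union> F')) + card (?E - (F \<inter> F')) = card (?E - F) + card (?E - F')"
          using card_Un_Int[of "?E - F" "?E - F'"] insert.hyps
          by (simp add: Diff_Un Diff_Int add.commute)
        moreover have "(\<Sum>i\<in>I. r i (F \<union> F')) + (\<Sum>i\<in>I. r i (F \<inter> F')) \<le> (\<Sum>i\<in>I. r i F) + (\<Sum>i\<in>I. r i F')"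
          unfolding sum.distrib[symmetric]
          using that by (intro sum_mono rank_funD(3)[OF rf]) auto
        ultimately have "f (F \<union> F') + f (F \<inter> F') \<le> f F + f F'"
          by (simp add: f_def)
        moreover have "(\<Sum>i\<in>I. R i) \<le> f (F \<inter> F')" "(\<Sum>i\<in>I. R i) \<le> f (F \<union> F')"
          using that by (auto intro!: f_ge)
        ultimately show ?thesis using that by simp
      qed
      have Un: "f (\<Union>j\<in>J. T j) = (\<Sum>i\<in>I. R i)" if "finite J" "J \<noteq> {}" "J \<subseteq> I" for J
        using that
      proof (induction J rule: finite_ne_induct)
        case (singleton x)
        then show ?case using tight by simp
      next
        case (insert x J)
        have "f (T x \<union> (\<Union>j\<in>J. T j)) = (\<Sum>i\<in>I. R i)"
          using insert T(1) tight by (intro f_union) auto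
        then show ?case by simp
      qed
      define U where "U = (\<Union>j\<in>I. T j)"
      have U: "U \<subseteq> E" "f U = (\<Sum>i\<in>I. R i)"
        using T(1) Un[of I] assms(2) False by (auto simp: U_def)
      \<comment> \<open>By submodularity a superset of \<open>T j\<close> spans \<open>e\<close> in
        \<open>r j\<close> as well; hence adding \<open>e\<close> to \<open>U\<close> removes one
        element from the complement without raising any rank.\<close>
      have rU: "r j (insert e U) \<le> r j U" if j: "j \<in> I" for j
      proof -
        have TU: "T j \<subseteq> U" using j by (auto simp: U_def)
        have "r j (insert e (T j) \<union> U) + r j (insert e (T j) \<inter> U) \<le> r j (insert e (T j)) + r j U"
          using j T(1)[OF j] U by (intro rank_funD(3)[OF rf[OF j]]) auto
        moreover have "insert e (T j) \<union> U = insert e U" "insert e (T j) \<inter> U = T j"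
          using TU U(1) insert.hyps by auto
        ultimately show ?thesis using tight(2)[OF j] by simp
      qed
      have "f (insert e U) < f U"
      proof -
        have "?E - insert e U = E - U" using insert.hyps by auto
        then show ?thesis
          unfolding f_def using card_E[OF U(1)] sum_mono[OF rU] by (simp add: less_Suc_eq_le)
      qed
      then show False using U f_ge[of "insert e U"] by auto
    qed
    then obtain j where j: "j \<in> I" "\<And>F. F \<subseteq> E \<Longrightarrow> (\<Sum>i\<in>I. R i) \<le> card (E - F) + (\<Sum>i\<in>I. r' j i F)"
      by blast
    have "\<exists>P. (\<forall>i\<in>I. P i \<subseteq> E \<and> r' j i (P i) = R i) \<and> disjoint_family_on P I"
    proof (rule insert.IH)
      fix i assume i: "i \<in> I"
      show "rank_fun E (r' j i)"
        using rank_fun_contract[OF rf] rank_fun_delete[OF rf] i j(1) by (auto simp: r'_def)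
      show "r' j i F \<le> R i" if "F \<subseteq> E" for F
        using le[OF i, of F] le[OF j(1), of "insert e F"] that by (auto simp: r'_def)
    qed (fact j(2))
    then obtain P where P: "\<And>i. i \<in> I \<Longrightarrow> P i \<subseteq> E" "\<And>i. i \<in> I \<Longrightarrow> r' j i (P i) = R i"
      "disjoint_family_on P I" by blast
    have "disjoint_family_on (P(j := insert e (P j))) I"
      using P(1,3) insert.hyps j(1) unfolding disjoint_family_on_def by (auto 4 4)
    moreover have "\<forall>i\<in>I. (P(j := insert e (P j))) i \<subseteq> ?E \<and> r i ((P(j := insert e (P j))) i) = R i"
    proof
      fix i assume i: "i \<in> I"
      show "(P(j := insert e (P j))) i \<subseteq> ?E \<and> r i ((P(j := insert e (P j))) i) = R i"
        using P(1)[OF i] P(2)[OF i] by (cases "i = j") (auto simp: r'_def)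
    qed
    ultimately show ?thesis by blast
  next
    case True
    then show ?thesis by (intro exI[of _ "\<lambda>_. {}"]) (simp add: disjoint_family_on_def)
  qed
qed

section \<open>Linear ranks\<close>

text \<open>Rows are functions on an arbitrary vertex type, a space of possibly infinite dimension;
  the facts on \<open>dim\<close> below are therefore stated for finite sets.\<close>

instantiation "fun" :: (type, real_vector) real_vector
begin

definition scaleR_fun :: "real \<Rightarrow> ('a \<Rightarrow> 'b) \<Rightarrow> 'a \<Rightarrow> 'b" where
  "scaleR_fun c f = (\<lambda>x. c *\<^sub>R f x)"

instance
proof
  fix a b :: real and x y :: "'a \<Rightarrow> 'b"
  show "a *\<^sub>R (x + y) = a *\<^sub>R x + a *\<^sub>R y"
    by (rule ext) (simp add: scaleR_fun_def scaleR_right_distrib)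
  show "(a + b) *\<^sub>R x = a *\<^sub>R x + b *\<^sub>R x"
    by (rule ext) (simp add: scaleR_fun_def scaleR_left_distrib)
  show "a *\<^sub>R b *\<^sub>R x = (a * b) *\<^sub>R x"
    by (rule ext) (simp add: scaleR_fun_def)
  show "1 *\<^sub>R x = x"
    by (rule ext) (simp add: scaleR_fun_def)
qed

end

lemma scaleR_fun_apply [simp]: "(c *\<^sub>R f) x = c *\<^sub>R f x"
  by (simp add: scaleR_fun_def)

lemma sum_fun_apply: "(\<Sum>i\<in>I. f i) x = (\<Sum>i\<in>I. f i x)"
  by (induction I rule: infinite_finite_induct) simp_all

lemma dim_insert_finite:
  fixes S :: "'v::real_vector set"
  assumes "finite S"
  shows "dim (insert x S) = (if x \<in> span S then dim S else Suc (dim S))"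
proof (cases "x \<in> span S")
  case True
  then show ?thesis
    by (metis dim_span span_redundant)
next
  case False
  obtain B where B: "B \<subseteq> S" "independent B" "S \<subseteq> span B" "card B = dim S"
    by (rule basis_exists)
  have span: "span B = span S"
    using B by (metis span_mono span_span subset_antisym span_minimal subspace_span)
  have "independent (insert x B)"
    using B False span by (simp add: independent_insert)
  moreover have "span (insert x B) = span (insert x S)"
    by (simp add: span span_insert)
  ultimately have "dim (insert x S) = card (insert x B)"
    using dim_eq_card by metis
  moreover have "x \<notin> B" "finite B"
    using False span span_base B assms finite_subset by blast+
  ultimately show ?thesis using False B by simp
qed

lemma dim_finite_mono:
  fixes S T :: "'v::real_vector set"
  assumes "S \<subseteq> span T" "finite T"
  shows "dim S \<le> dim T"
proof -
  obtain B where "B \<subseteq> T" "independent B" "T \<subseteq> span B" "card B = dim T"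
    by (rule basis_exists)
  moreover from this have "span T = span B"
    by (metis span_mono span_span subset_antisym span_minimal subspace_span)
  ultimately show ?thesis
    using assms dim_le_card[of S B] by (metis finite_subset)
qed

abbreviation rk :: "('e \<Rightarrow> 'v::real_vector) \<Rightarrow> 'e set \<Rightarrow> nat" where
  "rk \<rho> F \<equiv> dim (\<rho> ` F)"

lemma rk_insert:
  "finite F \<Longrightarrow> rk \<rho> (insert e F) = (if \<rho> e \<in> span (\<rho> ` F) then rk \<rho> F else Suc (rk \<rho> F))"
  by (simp add: dim_insert_finite)

lemma rank_fun_rk:
  assumes "finite E"
  shows "rank_fun E (rk \<rho>)"
proof -
  have sub: "rk \<rho> (F \<union> F') + rk \<rho> (F \<inter> F') \<le> rk \<rho> F + rk \<rho> F'"
    if "F \<subseteq> E" "F' \<subseteq> E" for F F'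
  proof -
    have fin: "finite F" "finite F'" using that assms finite_subset by blast+
    \<comment> \<open>Grow \<open>D\<close> inside \<open>F'\<close>: an element that raises the
      rank over the larger set \<open>F \<union> D\<close> also raises it over the smaller
      one.\<close>
    have "rk \<rho> (F \<union> D) + rk \<rho> (F \<inter> F') \<le> rk \<rho> F + rk \<rho> ((F \<inter> F') \<union> D)" if "D \<subseteq> F'" for D
      using finite_subset[OF that fin(2)]
    proof (induction D rule: finite_induct)
      case (insert x D)
      have "span (\<rho> ` ((F \<inter> F') \<union> D)) \<subseteq> span (\<rho> ` (F \<union> D))"
        by (intro span_mono) auto
      then have "rk \<rho> (insert x (F \<union> D)) + rk \<rho> (F \<inter> F' \<union> D) \<le> rk \<rho> (insert x (F \<inter> F' \<union> D)) + rk \<rho> (F \<union> D)"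
        using fin insert.hyps by (auto simp: rk_insert simp del: image_insert)
      then show ?case using insert.IH by simp
    qed simp
    from this[of F'] show ?thesis by (simp add: Un_absorb1)
  qed
  have ins: "rk \<rho> (insert e F) \<le> Suc (rk \<rho> F)" if "insert e F \<subseteq> E" for e F
  proof -
    have "finite F" using that assms by (meson finite_subset insert_subset)
    then show ?thesis by (simp add: rk_insert del: image_insert)
  qed
  have "rk \<rho> F \<le> rk \<rho> F'" if "F \<subseteq> F'" "F' \<subseteq> E" for F F'
  proof (rule dim_finite_mono)
    show "\<rho> ` F \<subseteq> span (\<rho> ` F')"
      using that by (meson image_mono span_superset subset_trans)
    show "finite (\<rho> ` F')" using finite_subset[OF that(2) assms] by simp
  qed
  with sub ins show ?thesis unfolding rank_fun_def by blast
qed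

text \<open>Independence of a family: unlike for its image as a set, a repeated vector counts as a
  dependency.\<close>

definition lin_indep :: "('i \<Rightarrow> 'v::real_vector) \<Rightarrow> 'i set \<Rightarrow> bool" where
  "lin_indep x I \<longleftrightarrow> (\<forall>c. (\<Sum>i\<in>I. c i *\<^sub>R x i) = 0 \<longrightarrow> (\<forall>i\<in>I. c i = 0))"

lemma lin_indep_iff:
  assumes "finite I"
  shows "lin_indep x I \<longleftrightarrow> inj_on x I \<and> independent (x ` I)"
proof
  assume li: "lin_indep x I"
  have inj: "inj_on x I"
  proof (rule inj_onI, rule ccontr)
    fix i j assume ij: "i \<in> I" "j \<in> I" "x i = x j" "i \<noteq> j"
    let ?c = "\<lambda>k. (if k = i then 1 else 0) - (if k = j then 1 else (0::real))"
    have "(\<Sum>k\<in>I. ?c k *\<^sub>R x k) = (\<Sum>k\<in>I. if k = i then x k else 0) - (\<Sum>k\<in>I. if k = j then x k else 0)"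
      unfolding sum_subtractf[symmetric] by (rule sum.cong) (auto simp: scaleR_diff_left)
    also have "\<dots> = 0" using ij assms by simp
    finally have "?c i = 0" using li[unfolded lin_indep_def, rule_format, of ?c i] ij(1) by blast
    then show False using ij(4) by simp
  qed
  moreover have "independent (x ` I)"
  proof
    assume "dependent (x ` I)"
    then obtain u where u: "\<exists>v\<in>x ` I. u v \<noteq> 0" "(\<Sum>v\<in>x ` I. u v *\<^sub>R v) = 0"
      using dependent_finite[of "x ` I"] assms by auto
    have "(\<Sum>i\<in>I. u (x i) *\<^sub>R x i) = 0"
      using u(2) inj by (simp add: sum.reindex)
    then show False using li u(1) unfolding lin_indep_def by fastforce
  qed
  ultimately show "inj_on x I \<and> independent (x ` I)" by blast
next
  assume *: "inj_on x I \<and> independent (x ` I)"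
  show "lin_indep x I" unfolding lin_indep_def
  proof (intro allI impI ballI)
    fix c i assume c: "(\<Sum>i\<in>I. c i *\<^sub>R x i) = 0" and i: "i \<in> I"
    let ?u = "\<lambda>v. c (the_inv_into I x v)"
    have "(\<Sum>v\<in>x ` I. ?u v *\<^sub>R v) = (\<Sum>i\<in>I. c i *\<^sub>R x i)"
      using * by (simp add: sum.reindex the_inv_into_f_f)
    then have "?u (x i) = 0"
      using independentD[of "x ` I" "x ` I" ?u "x i"] * c i assms by simp
    then show "c i = 0" using * i by (simp add: the_inv_into_f_f)
  qed
qed

lemma lin_indep_card_le_dim:
  assumes "finite I" "lin_indep x I" "x ` I \<subseteq> span S" "finite S"
  shows "card I \<le> dim S"
proof -
  have "card I = dim (x ` I)"
    using assms(1,2) by (simp add: lin_indep_iff card_image dim_eq_card_independent)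
  then show ?thesis using dim_finite_mono[OF assms(3,4)] by simp
qed

lemma ex_lin_indep:
  assumes "finite F"
  obtains I where "I \<subseteq> F" "lin_indep \<rho> I" "card I = rk \<rho> F"
proof -
  obtain B where B: "B \<subseteq> \<rho> ` F" "independent B" "\<rho> ` F \<subseteq> span B" "card B = rk \<rho> F"
    by (rule basis_exists)
  then obtain I where I: "I \<subseteq> F" "inj_on \<rho> I" "B = \<rho> ` I"
    by (auto simp: subset_image_inj)
  with B show thesis
    using that[of I] assms by (auto simp: lin_indep_iff finite_subset card_image)
qed

text \<open>Coordinates with respect to the family, extended to the whole space. In the perturbation
  arguments they take the place of minors.\<close>

lemma dual_functionals:
  assumes "finite I" "lin_indep x I"
  shows "\<exists>\<phi> :: 'i \<Rightarrow> 'v::real_vector \<Rightarrow> real. \<forall>i\<in>I. linear (\<phi> i) \<and> (\<forall>j\<in>I. \<phi> i (x j) = (if i = j then 1 else 0))"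
proof -
  have inj: "inj_on x I" "independent (x ` I)"
    using assms by (auto simp: lin_indep_iff)
  have "\<exists>g. linear g \<and> (\<forall>j\<in>I. g (x j) = (if i = j then 1 else (0::real)))" if "i \<in> I" for i
    using linear_independent_extend[OF inj(2), of "\<lambda>v. if v = x i then 1 else (0::real)"] inj(1) that
    by (auto simp: inj_on_def) metis
  then show ?thesis by metis
qed

lemma separating_functional:
  fixes y :: "'v::real_vector"
  assumes "y \<notin> span S"
  obtains \<phi> :: "'v \<Rightarrow> real" where "linear \<phi>" "\<phi> y = 1" "\<And>x. x \<in> span S \<Longrightarrow> \<phi> x = 0"
proof -
  obtain B where B: "B \<subseteq> S" "independent B" "S \<subseteq> span B"
    using maximal_independent_subset by blast
  have span: "span S \<subseteq> span B"
    using B(3) by (simp add: span_minimal)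
  have y: "y \<notin> span B"
    using assms span_mono[OF B(1)] by blast
  then have "independent (insert y B)"
    using B(2) by (simp add: independent_insert)
  then obtain \<phi> :: "'v \<Rightarrow> real" where \<phi>: "linear \<phi>" "\<forall>x\<in>insert y B. \<phi> x = (if x = y then 1 else 0)"
    using linear_independent_extend[of "insert y B" "\<lambda>x. if x = y then 1 else 0"] by auto
  have "\<phi> x = 0" if "x \<in> B" for x
    using \<phi>(2) that y span_base by force
  then have "\<phi> x = 0" if "x \<in> span S" for x
    using linear_eq_0_on_span[OF \<phi>(1)] that span by blast
  with \<phi> show thesis using that by auto
qed

text \<open>The matrix of the values \<open>\<phi> i (x' j)\<close> differs from the identity by
  entries below \<open>1 / card I\<close>. It is diagonally dominant, so a dependency is refuted at
  its coefficient of largest absolute value.\<close>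

lemma lin_indep_perturb:
  fixes x x' :: "'i \<Rightarrow> 'v::real_vector" and \<phi> :: "'i \<Rightarrow> 'v \<Rightarrow> real"
  assumes "finite I"
    and \<phi>: "\<And>i. i \<in> I \<Longrightarrow> linear (\<phi> i)"
      "\<And>i j. i \<in> I \<Longrightarrow> j \<in> I \<Longrightarrow> \<phi> i (x j) = (if i = j then 1 else 0)"
    and small: "\<And>i j. i \<in> I \<Longrightarrow> j \<in> I \<Longrightarrow> real (card I) * \<bar>\<phi> i (x' j - x j)\<bar> < 1"
  shows "lin_indep x' I"
  unfolding lin_indep_def
proof (intro allI impI)
  fix c assume c: "(\<Sum>i\<in>I. c i *\<^sub>R x' i) = 0"
  show "\<forall>i\<in>I. c i = 0"
  proof (rule ccontr)
    assume "\<not> ?thesis"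
    then obtain i0 where i0: "i0 \<in> I" "c i0 \<noteq> 0" by blast
    have "Max ((\<lambda>i. \<bar>c i\<bar>) ` I) \<in> (\<lambda>i. \<bar>c i\<bar>) ` I"
      using assms(1) i0(1) by (intro Max_in) auto
    then obtain i where i1: "i \<in> I" "Max ((\<lambda>i. \<bar>c i\<bar>) ` I) = \<bar>c i\<bar>" by blast
    have "\<bar>c j\<bar> \<le> \<bar>c i\<bar>" if "j \<in> I" for j
      unfolding i1(2)[symmetric] using assms(1) that by (intro Max_ge) auto
    note i = i1(1) this
    have "0 = \<phi> i (\<Sum>j\<in>I. c j *\<^sub>R x' j)"
      using \<phi>(1)[OF i(1)] c by (simp add: linear_0)
    also have "\<dots> = (\<Sum>j\<in>I. c j * \<phi> i (x' j))"
      using \<phi>(1)[OF i(1)] by (simp add: linear_sum linear_cmul)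
    also have "\<dots> = (\<Sum>j\<in>I. c j * \<phi> i (x j) + c j * \<phi> i (x' j - x j))"
      using \<phi>(1)[OF i(1)] by (simp add: linear_diff algebra_simps)
    also have "\<dots> = c i + (\<Sum>j\<in>I. c j * \<phi> i (x' j - x j))"
    proof -
      have "(\<Sum>j\<in>I. c j * \<phi> i (x j)) = (\<Sum>j\<in>I. if i = j then c j else 0)"
        using \<phi>(2)[OF i(1)] by (intro sum.cong) auto
      then show ?thesis using i(1) assms(1) by (simp add: sum.distrib)
    qed
    finally have eq: "c i = - (\<Sum>j\<in>I. c j * \<phi> i (x' j - x j))" by simp
    have ci: "\<bar>c i\<bar> > 0" using i(2)[OF i0(1)] i0(2) by simp
    have cI: "real (card I) > 0" using i0(1) assms(1) card_gt_0_iff by force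
    have "\<bar>c i\<bar> \<le> (\<Sum>j\<in>I. \<bar>c j\<bar> * \<bar>\<phi> i (x' j - x j)\<bar>)"
      unfolding eq abs_minus_cancel by (rule order_trans[OF sum_abs]) (simp add: abs_mult eq[symmetric])
    also have "\<dots> < (\<Sum>j\<in>I. \<bar>c i\<bar> * (1 / real (card I)))"
    proof (rule sum_strict_mono)
      fix j assume j: "j \<in> I"
      have "\<bar>\<phi> i (x' j - x j)\<bar> < 1 / real (card I)"
        using small[OF i(1) j] cI by (simp add: field_simps)
      then have "\<bar>c i\<bar> * \<bar>\<phi> i (x' j - x j)\<bar> < \<bar>c i\<bar> * (1 / real (card I))"
        using ci by (intro mult_strict_left_mono) auto
      moreover have "\<bar>c j\<bar> * \<bar>\<phi> i (x' j - x j)\<bar> \<le> \<bar>c i\<bar> * \<bar>\<phi> i (x' j - x j)\<bar>"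
        using i(2)[OF j] by (intro mult_right_mono) auto
      ultimately show "\<bar>c j\<bar> * \<bar>\<phi> i (x' j - x j)\<bar> < \<bar>c i\<bar> * (1 / real (card I))" by linarith
    qed (use assms(1) i0 in auto)
    also have "\<dots> = \<bar>c i\<bar>" using cI by simp
    finally show False by simp
  qed
qed

section \<open>Rigidity matrices\<close>

definition edge_set :: "'a set \<Rightarrow> 'a set set" where
  "edge_set V = {e. e \<subseteq> V \<and> card e = 2}"

text \<open>The plane is identified with the complex numbers. The row of the edge \<open>{u, v}\<close> has the entry
  \<open>p u - p v\<close> at \<open>u\<close> and \<open>p v - p u\<close> at \<open>v\<close>. For an injective real placement, it is a nonzero
  multiple of the corresponding row of the incidence matrix of an orientation.\<close>

definition erow :: "('a \<Rightarrow> complex) \<Rightarrow> 'a set \<Rightarrow> 'a \<Rightarrow> complex" where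
  "erow p e = (\<lambda>v. if v \<in> e then \<Sum>u\<in>e. p v - p u else 0)"

text \<open>A quarter turn of every vector. Applied to a placement it is the velocity field of its
  rotation about the origin, the trivial motion against which rows are tested.\<close>

definition rot :: "('a \<Rightarrow> complex) \<Rightarrow> 'a \<Rightarrow> complex" where
  "rot x = (\<lambda>v. \<i> * x v)"

definition ip :: "'a set \<Rightarrow> ('a \<Rightarrow> complex) \<Rightarrow> ('a \<Rightarrow> complex) \<Rightarrow> real" where
  "ip V x y = (\<Sum>v\<in>V. inner (x v) (y v))"

lemma edge_setE:
  assumes "e \<in> edge_set V"
  obtains u v where "e = {u, v}" "u \<noteq> v" "u \<in> V" "v \<in> V"
  using assms by (auto simp: edge_set_def card_2_iff)

lemma finite_edge_set: "finite V \<Longrightarrow> finite (edge_set V)"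
  unfolding edge_set_def by simp

lemma erow_pair: "u \<noteq> v \<Longrightarrow> erow p {u, v} = (\<lambda>w. if w = u then p u - p v else if w = v then p v - p u else 0)"
  by (rule ext) (auto simp: erow_def)

lemma erow_add: "erow (p + q) e = erow p e + erow q e"
  by (rule ext) (simp add: erow_def sum.distrib[symmetric] algebra_simps)

lemma erow_scaleR: "erow (c *\<^sub>R p) e = c *\<^sub>R erow p e"
  by (rule ext) (simp add: erow_def scaleR_right.sum scaleR_diff_right)

lemma erow_rot: "erow (rot p) e = rot (erow p e)"
  by (rule ext) (simp add: erow_def rot_def sum_distrib_left right_diff_distrib)

lemma linear_erow: "linear (\<lambda>p. erow p e)"
  by (rule linearI) (simp_all add: erow_add erow_scaleR)

lemma linear_rot: "linear rot"
  by (rule linearI) (auto simp: rot_def fun_eq_iff algebra_simps)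

lemma linear_ip: "linear (\<lambda>x. ip V x y)"
  by (rule linearI) (simp_all add: ip_def inner_add_left sum.distrib sum_distrib_left)

lemma ip_erow:
  assumes "finite V" "u \<in> V" "v \<in> V" "u \<noteq> v"
  shows "ip V (erow p {u, v}) x = inner (p u - p v) (x u - x v)"
proof -
  have "ip V (erow p {u, v}) x = (\<Sum>w\<in>{u, v}. inner (erow p {u, v} w) (x w))"
    unfolding ip_def using assms by (intro sum.mono_neutral_right) (auto simp: erow_pair)
  also have "\<dots> = inner (p u - p v) (x u - x v)"
    using assms by (simp add: erow_pair inner_diff_right inner_diff_left)
  finally show ?thesis .
qed

text \<open>In the complex plane one difference is a complex multiple of any other nonzero one. So
  the rows of an edge at all placements lie in the real plane spanned by one nonzero row and its
  quarter turn.\<close>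

lemma erow_eq_multiple:
  assumes "u \<noteq> v" and pq: "p u - p v = c * (q u - q v)"
  shows "erow p {u, v} = Re c *\<^sub>R erow q {u, v} + Im c *\<^sub>R rot (erow q {u, v})"
proof
  fix w
  have c: "complex_of_real (Re c) + \<i> * complex_of_real (Im c) = c"
    using complex_eq[of c] by simp
  have "p v - p u = c * (q v - q u)"
    using pq by (metis minus_diff_eq mult_minus_right)
  then have "erow p {u, v} w = c * erow q {u, v} w"
    using pq assms(1) by (simp add: erow_pair)
  also have "\<dots> = (Re c *\<^sub>R erow q {u, v} + Im c *\<^sub>R rot (erow q {u, v})) w"
    by (subst c[symmetric]) (simp add: rot_def scaleR_conv_of_real algebra_simps)
  finally show "erow p {u, v} w = \<dots>" .
qed

lemma dim_empty: "dim ({} :: 'v::real_vector set) = 0"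
  using dim_eq_card_independent[OF independent_empty] by simp

section \<open>Rigidity rank and graphic rank\<close>

definition real_placement :: "('a \<Rightarrow> real) \<Rightarrow> 'a \<Rightarrow> complex" where
  "real_placement f = (\<lambda>v. complex_of_real (f v))"

text \<open>A vector is orthogonal to its quarter turn, so rotating is an infinitesimal motion. The
  second identity is the polarisation of the first, and the third is the invariance of the inner
  product under rotation.\<close>

lemma ip_erow_rot:
  assumes "finite V" "e \<in> edge_set V"
  shows "ip V (erow p e) (rot p) = 0"
    and "ip V (erow q e) (rot p) = - ip V (erow p e) (rot q)"
    and "ip V (erow (rot p) e) (rot p) = ip V (erow p e) p"
proof -
  obtain u v where e: "e = {u, v}" "u \<noteq> v" "u \<in> V" "v \<in> V"
    using assms(2) by (rule edge_setE)
  show "ip V (erow p e) (rot p) = 0" "ip V (erow q e) (rot p) = - ip V (erow p e) (rot q)"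
    "ip V (erow (rot p) e) (rot p) = ip V (erow p e) p"
    unfolding e(1) using assms(1) e by (simp_all add: ip_erow rot_def inner_complex_def algebra_simps)
qed

lemma ip_erow_self_nonzero:
  assumes "finite V" "u \<in> V" "v \<in> V" "p u \<noteq> p v"
  shows "ip V (erow p {u, v}) p \<noteq> 0"
  using assms by (subst ip_erow) auto

lemma erow_in_span_rot:
  assumes "inj_on f V" "e \<in> edge_set V" "F = real_placement f"
  shows "erow p e \<in> span {erow F e, rot (erow F e)}"
proof -
  obtain u v where e: "e = {u, v}" "u \<noteq> v" "u \<in> V" "v \<in> V"
    using assms(2) by (rule edge_setE)
  have "F u - F v \<noteq> 0"
    using assms e by (auto simp: inj_on_def real_placement_def)
  then have "p u - p v = ((p u - p v) / (F u - F v)) * (F u - F v)" by simp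
  from erow_eq_multiple[of u v p _ F, OF e(2) this] show ?thesis
    unfolding e(1)
    by (metis span_add span_scale span_base insertI1 insertI2)
qed

text \<open>A basis \<open>B\<close> of the real rows together with its quarter turns spans the rows
  of every placement. Among them is the row of \<open>rot p\<close>, which pairs nontrivially with
  the motion \<open>rot p\<close>, whereas all rows at \<open>p\<close> pair to zero with it; this
  accounts for the additional dimension.\<close>

lemma two_mult_graphic_rank_ge:
  assumes fin: "finite V" and F: "F \<subseteq> edge_set V" and inj: "inj_on f V"
    and e0: "{u, v} \<in> F" "p u \<noteq> p v"
  shows "Suc (rk (erow p) F) \<le> 2 * rk (erow (real_placement f)) F"
proof -
  let ?g = "erow (real_placement f)"
  have finF: "finite F" using finite_subset[OF F finite_edge_set[OF fin]] .
  obtain B where B: "B \<subseteq> ?g ` F" "independent B" "?g ` F \<subseteq> span B" "card B = rk ?g F"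
    by (rule basis_exists)
  have finB: "finite B" using B(1) finF finite_subset by blast
  define W where "W = B \<union> rot ` B"
  have gW: "?g e \<in> span W" "rot (?g e) \<in> span W" if "e \<in> F" for e
  proof -
    have gB: "?g e \<in> span B" using B(3) that by auto
    then show "?g e \<in> span W" using span_mono[of B W] by (auto simp: W_def)
    have "rot (?g e) \<in> span (rot ` B)"
      using gB linear_span_image[OF linear_rot, of B] by auto
    then show "rot (?g e) \<in> span W" using span_mono[of "rot ` B" W] by (auto simp: W_def)
  qed
  have qW: "erow q e \<in> span W" if "e \<in> F" for q e
  proof -
    have "span {?g e, rot (?g e)} \<subseteq> span W"
      using gW[OF that] by (intro span_minimal) auto
    then show ?thesis using erow_in_span_rot[OF inj _ refl, of e q] that F by auto
  qed
  let ?y = "erow (rot p) {u, v}"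
  have uv: "u \<in> V" "v \<in> V" using e0(1) F by (auto simp: edge_set_def)
  have "?y \<notin> span (erow p ` F)"
  proof
    assume "?y \<in> span (erow p ` F)"
    then have "ip V ?y (rot p) = 0"
      by (rule linear_eq_0_on_span[OF linear_ip, rotated]) (use ip_erow_rot(1)[OF fin] F in auto)
    moreover have "ip V ?y (rot p) = ip V (erow p {u, v}) p"
      using ip_erow_rot(3)[OF fin] F e0(1) by blast
    ultimately show False using ip_erow_self_nonzero[OF fin uv e0(2)] by simp
  qed
  then have "Suc (rk (erow p) F) = dim (insert ?y (erow p ` F))"
    using finF by (simp add: dim_insert_finite)
  also have "\<dots> \<le> card W"
    using qW e0(1) finB by (intro dim_le_card) (auto simp: W_def)
  also have "\<dots> \<le> 2 * card B"
    unfolding W_def using card_Un_le[of B "rot ` B"] card_image_le[OF finB, of rot] by linarith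
  finally show ?thesis using B(4) by simp
qed

text \<open>The coordinatewise real and imaginary parts separate the real rows from their quarter
  turns, so the two copies of the row space are independent and their dimensions add.\<close>

lemma two_mult_graphic_rank_le:
  assumes finS: "finite S" and finF: "finite F"
    and S: "\<And>e. e \<in> F \<Longrightarrow> erow (real_placement f) e \<in> span S"
      "\<And>e. e \<in> F \<Longrightarrow> rot (erow (real_placement f) e) \<in> span S"
  shows "2 * rk (erow (real_placement f)) F \<le> dim S"
proof -
  let ?g = "erow (real_placement f)"
  let ?re = "\<lambda>x v. complex_of_real (Re (x v))" and ?im = "\<lambda>x v. complex_of_real (Im (x v))"
  have lin: "linear ?re" "linear ?im"
    by (rule linearI; auto simp: fun_eq_iff scaleR_conv_of_real)+
  have real: "Im (?g e v) = 0" for e v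
    by (simp add: erow_def real_placement_def)
  have g: "?re (?g e) = ?g e" "?im (?g e) = 0" "?re (rot (?g e)) = 0" "?im (rot (?g e)) = ?g e" for e
    using real[of e] by (auto simp: fun_eq_iff complex_eq_iff rot_def)
  have "2 * rk ?g F \<le> dim (?g ` F \<union> rot ` ?g ` F)"
    using finF
  proof (induction F rule: finite_induct)
    case (insert e F)
    let ?S = "?g ` F \<union> rot ` ?g ` F"
    have fS: "finite ?S" using insert by simp
    show ?case
    proof (cases "?g e \<in> span (?g ` F)")
      case True
      have "dim ?S \<le> dim (?g ` insert e F \<union> rot ` ?g ` insert e F)"
        using insert.hyps by (intro dim_finite_mono) (auto intro: span_base)
      then show ?thesis using insert True by (simp add: rk_insert del: image_insert)
    next
      case False
      \<comment> \<open>\<open>0\<close> is inserted because each of the two projections maps one of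
        the two copies to \<open>0\<close>.\<close>
      have sub0: "span (insert 0 (?g ` F)) = span (?g ` F)"
        by (simp add: span_insert_0)
      have n1: "?g e \<notin> span ?S"
      proof
        assume "?g e \<in> span ?S"
        then have "?re (?g e) \<in> ?re ` span ?S" by blast
        also have "?re ` span ?S = span (?re ` ?S)" by (rule linear_span_image[OF lin(1), symmetric])
        also have "\<dots> \<subseteq> span (insert 0 (?g ` F))"
          by (intro span_mono) (auto simp: g simp del: of_real_0)
        finally show False using False sub0 g(1) by simp
      qed
      have n2: "rot (?g e) \<notin> span (insert (?g e) ?S)"
      proof
        assume "rot (?g e) \<in> span (insert (?g e) ?S)"
        then have "?im (rot (?g e)) \<in> ?im ` span (insert (?g e) ?S)" by blast
        also have "?im ` span (insert (?g e) ?S) = span (?im ` insert (?g e) ?S)"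
          by (rule linear_span_image[OF lin(2), symmetric])
        also have "\<dots> \<subseteq> span (insert 0 (?g ` F))"
          by (intro span_mono) (auto simp: g)
        finally show False using False sub0 g(4) by simp
      qed
      have "?g ` insert e F \<union> rot ` ?g ` insert e F = insert (rot (?g e)) (insert (?g e) ?S)" by auto
      then show ?thesis using insert n1 n2 fS False
        by (simp add: rk_insert dim_insert_finite del: image_insert)
    qed
  qed (simp add: dim_empty)
  also have "\<dots> \<le> dim S"
    using finS S by (intro dim_finite_mono) auto
  finally show ?thesis .
qed

text \<open>The entries of a row sum to zero, so a unit vector lies outside the row space; it and
  the rows all lie in the span of the \<open>card V\<close> unit vectors.\<close>

lemma graphic_rank_less:
  assumes "finite V" "V \<noteq> {}" "F \<subseteq> edge_set V"
  shows "rk (erow (real_placement f)) F < card V"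
proof -
  let ?g = "erow (real_placement f)"
  have finF: "finite F" using finite_subset[OF assms(3) finite_edge_set[OF assms(1)]] .
  obtain v0 where v0: "v0 \<in> V" using assms(2) by blast
  let ?d = "\<lambda>v w. if w = v then 1 else (0::complex)"
  let ?h = "\<lambda>x. ip V x (\<lambda>_. 1)"
  have "?d v0 \<notin> span (?g ` F)"
  proof
    assume "?d v0 \<in> span (?g ` F)"
    then have "?h (?d v0) = 0"
    proof (rule linear_eq_0_on_span[OF linear_ip, rotated])
      fix x assume "x \<in> ?g ` F"
      then obtain e where e: "e \<in> F" "x = ?g e" by blast
      obtain u v where uv: "e = {u, v}" "u \<noteq> v" "u \<in> V" "v \<in> V"
        using assms(3) e by (blast elim: edge_setE)
      then show "?h x = 0" using e assms(1) by (simp add: ip_erow)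
    qed
    moreover have "?h (?d v0) = 1"
    proof -
      have "?h (?d v0) = (\<Sum>v\<in>V. if v = v0 then 1 else 0)"
        unfolding ip_def by (rule sum.cong) auto
      then show ?thesis using assms(1) v0 by simp
    qed
    ultimately show False by simp
  qed
  then have "Suc (rk ?g F) = dim (insert (?d v0) (?g ` F))"
    using finF by (simp add: dim_insert_finite)
  also have "\<dots> \<le> card (?d ` V)"
  proof (rule dim_le_card)
    have "?g e \<in> span (?d ` V)" if eF: "e \<in> F" for e
    proof -
      obtain u v where uv: "e = {u, v}" "u \<noteq> v" "u \<in> V" "v \<in> V"
        using assms(3) eF by (blast elim: edge_setE)
      have "?g e = (f u - f v) *\<^sub>R ?d u + (f v - f u) *\<^sub>R ?d v"
        using uv(2) by (auto simp: uv(1) erow_pair real_placement_def fun_eq_iff scaleR_conv_of_real)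
      also have "\<dots> \<in> span (?d ` V)"
        using uv by (intro span_add span_scale span_base) auto
      finally show ?thesis .
    qed
    then show "insert (?d v0) (?g ` F) \<subseteq> span (?d ` V)"
      using v0 by (auto intro: span_base)
  qed (use assms(1) in simp)
  also have "\<dots> \<le> card V" using assms(1) by (rule card_image_le)
  finally show ?thesis by simp
qed

text \<open>Kruskal's argument: an edge inside a class keeps the partition. An edge between two
  classes merges them, and its row is new because the indicator of one class annihilates all earlier
  rows but not this one.\<close>

lemma graphic_rank_partition:
  assumes "finite V" "F \<subseteq> edge_set V" "inj_on f V"
  shows "\<exists>\<C>. partition_on V \<C> \<and> F \<subseteq> (\<Union>C\<in>\<C>. edge_set C) \<and>
    card V \<le> rk (erow (real_placement f)) F + card \<C>"
proof -
  let ?g = "erow (real_placement f)"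
  have "finite F" using finite_subset[OF assms(2) finite_edge_set[OF assms(1)]] .
  then show ?thesis using assms(2)
  proof (induction F rule: finite_induct)
    case empty
    have "partition_on V ((\<lambda>v. {v}) ` V)"
      by (auto simp: partition_on_def disjoint_def)
    moreover have "card ((\<lambda>v. {v}) ` V) = card V" by (rule card_image) simp
    ultimately show ?case by (intro exI[of _ "(\<lambda>v. {v}) ` V"]) simp
  next
    case (insert e F)
    then obtain \<C> where \<C>: "partition_on V \<C>" "F \<subseteq> (\<Union>C\<in>\<C>. edge_set C)"
      "card V \<le> rk ?g F + card \<C>" by auto
    have fin\<C>: "finite \<C>" using \<C>(1) assms(1) by (simp add: finite_elements)
    have "e \<in> edge_set V" using insert.prems by simp
    then obtain u v where uv: "e = {u, v}" "u \<noteq> v" "u \<in> V" "v \<in> V"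
      by (rule edge_setE)
    obtain A B where AB: "A \<in> \<C>" "B \<in> \<C>" "u \<in> A" "v \<in> B"
      using \<C>(1) uv by (auto simp: partition_on_def)
    have disj: "C = D" if "C \<in> \<C>" "D \<in> \<C>" "x \<in> C" "x \<in> D" for C D x
      using \<C>(1) that by (auto simp: partition_on_def disjoint_def)
    show ?case
    proof (cases "A = B")
      case True
      have "e \<in> edge_set A" using uv AB True by (auto simp: edge_set_def)
      moreover have "rk ?g F \<le> rk ?g (insert e F)"
        using insert.hyps by (simp add: rk_insert del: image_insert)
      ultimately show ?thesis using \<C> AB by (intro exI[of _ \<C>]) auto
    next
      case False
      define \<D> where "\<D> = insert (A \<union> B) (\<C> - {A, B})"
      have AB_notin: "A \<union> B \<notin> \<C> - {A, B}"
        using disj[of "A \<union> B" A u] AB by auto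
      have "partition_on V \<D>"
        unfolding partition_on_def
      proof (intro conjI)
        show "\<Union> \<D> = V" using \<C>(1) AB by (auto simp: \<D>_def partition_on_def)
        show "disjoint \<D>"
          unfolding disjoint_def \<D>_def using disj AB by blast
        show "{} \<notin> \<D>" using \<C>(1) AB by (auto simp: \<D>_def partition_on_def)
      qed
      moreover have "insert e F \<subseteq> (\<Union>C\<in>\<D>. edge_set C)"
      proof -
        have "e \<in> edge_set (A \<union> B)" using uv AB by (auto simp: edge_set_def)
        moreover have "edge_set A \<subseteq> edge_set (A \<union> B)" "edge_set B \<subseteq> edge_set (A \<union> B)"
          by (auto simp: edge_set_def)
        ultimately show ?thesis using \<C>(2) unfolding \<D>_def by blast
      qed
      moreover have "Suc (card \<D>) = card \<C>"
      proof -
        have "card \<D> = Suc (card (\<C> - {A, B}))"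
          unfolding \<D>_def using AB_notin fin\<C> by simp
        also have "card (\<C> - {A, B}) = card \<C> - 2"
          using AB False fin\<C> by (simp add: card_Diff_subset)
        finally show ?thesis
          using card_mono[OF fin\<C>, of "{A, B}"] AB False by simp
      qed
      moreover have "?g e \<notin> span (?g ` F)"
      proof
        let ?h = "\<lambda>x. ip V x (\<lambda>w. if w \<in> A then 1 else 0)"
        assume "?g e \<in> span (?g ` F)"
        then have "?h (?g e) = 0"
        proof (rule linear_eq_0_on_span[OF linear_ip, rotated])
          fix x assume "x \<in> ?g ` F"
          then obtain e' where e': "e' \<in> F" "x = ?g e'" by blast
          then obtain C where C: "C \<in> \<C>" "e' \<in> edge_set C" using \<C>(2) by blast
          obtain a b where ab: "e' = {a, b}" "a \<noteq> b" "a \<in> C" "b \<in> C"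
            using C(2) by (rule edge_setE)
          have "a \<in> V" "b \<in> V" using ab C(1) \<C>(1) by (auto simp: partition_on_def)
          moreover have "a \<in> A \<longleftrightarrow> b \<in> A" using disj[OF C(1) AB(1)] ab by blast
          ultimately show "?h x = 0" using e' ab assms(1) by (simp add: ip_erow)
        qed
        moreover have "v \<notin> A" using disj[OF AB(1,2)] AB(4) False by blast
        moreover have "f u \<noteq> f v" using assms(3) uv by (auto simp: inj_on_def)
        ultimately show False
          using uv AB(3) assms(1) by (simp add: ip_erow real_placement_def)
      qed
      ultimately show ?thesis
        using \<C>(3) insert.hyps by (intro exI[of _ \<D>]) (simp add: rk_insert del: image_insert)
    qed
  qed
qed

text \<open>Twice the graphic rank is at least the sum of \<open>2 * card C - 2\<close> over the
  classes. Each class with at least two vertices exceeds \<open>2 * card C - 3\<close> by one, and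
  \<open>F \<noteq> {}\<close> supplies such a class; this is the \<open>+ 1\<close>.\<close>

lemma graphic_rank_cover:
  assumes "finite V" "F \<subseteq> edge_set V" "inj_on f V" "F \<noteq> {}"
  shows "\<exists>\<X>\<subseteq>Pow V. (\<forall>X\<in>\<X>. 2 \<le> card X) \<and> F \<subseteq> (\<Union>X\<in>\<X>. edge_set X) \<and>
    (\<Sum>X\<in>\<X>. 2 * card X - 3) + 1 \<le> 2 * rk (erow (real_placement f)) F"
proof -
  let ?g = "erow (real_placement f)"
  obtain \<C> where \<C>: "partition_on V \<C>" "F \<subseteq> (\<Union>C\<in>\<C>. edge_set C)"
    "card V \<le> rk ?g F + card \<C>"
    using graphic_rank_partition[OF assms(1-3)] by blast
  have fin\<C>: "finite \<C>" using \<C>(1) assms(1) by (simp add: finite_elements)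
  have finC: "finite C" if "C \<in> \<C>" for C
    using that \<C>(1) assms(1) finite_subset[of C V] by (auto simp: partition_on_def)
  define \<X> where "\<X> = {C \<in> \<C>. 2 \<le> card C}"
  have "F \<subseteq> (\<Union>X\<in>\<X>. edge_set X)"
  proof
    fix e assume "e \<in> F"
    then obtain C where C: "C \<in> \<C>" "e \<in> edge_set C" using \<C>(2) by blast
    then have "2 \<le> card C" using card_mono[OF finC[OF C(1)], of e] by (auto simp: edge_set_def)
    then show "e \<in> (\<Union>X\<in>\<X>. edge_set X)" using C by (auto simp: \<X>_def)
  qed
  moreover from this have "\<X> \<noteq> {}" using assms(4) by auto
  then have "1 \<le> card \<X>" using fin\<C> by (simp add: \<X>_def Suc_le_eq card_gt_0_iff)
  moreover have "(\<Sum>X\<in>\<X>. 2 * card X - 3) + card \<X> + 2 * card \<C> \<le> 2 * card V"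
  proof -
    have "card V = (\<Sum>C\<in>\<C>. card C)"
      using \<C>(1) finC by (metis card_Union_disjoint partition_onD1 partition_onD2)
    moreover have "(\<Sum>X\<in>\<X>. 2 * card X - 3) + card \<X> = (\<Sum>X\<in>\<X>. 2 * card X - 2)"
    proof -
      have "(\<Sum>X\<in>\<X>. 2 * card X - 3) + card \<X> = (\<Sum>X\<in>\<X>. 2 * card X - 3 + 1)"
        by (simp only: sum.distrib card_eq_sum)
      also have "\<dots> = (\<Sum>X\<in>\<X>. 2 * card X - 2)" by (rule sum.cong) (auto simp: \<X>_def)
      finally show ?thesis .
    qed
    moreover have "(\<Sum>X\<in>\<X>. 2 * card X - 2) \<le> (\<Sum>C\<in>\<C>. 2 * card C - 2)"
      using fin\<C> by (intro sum_mono2) (auto simp: \<X>_def)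
    moreover have "(\<Sum>C\<in>\<C>. 2 * card C - 2) + 2 * card \<C> = (\<Sum>C\<in>\<C>. 2 * card C)"
    proof -
      have "2 * card C - 2 + 2 = 2 * card C" if "C \<in> \<C>" for C
      proof -
        have "C \<noteq> {}" using that \<C>(1) by (auto simp: partition_on_def)
        then have "card C > 0" using finC[OF that] by (simp add: card_gt_0_iff)
        then show ?thesis by simp
      qed
      then have "(\<Sum>C\<in>\<C>. 2 * card C - 2 + 2) = (\<Sum>C\<in>\<C>. 2 * card C)" by (intro sum.cong) auto
      then show ?thesis by (simp only: sum.distrib) (simp add: mult.commute)
    qed
    ultimately show ?thesis by (simp add: sum_distrib_left)
  qed
  moreover have "\<X> \<subseteq> Pow V" "\<forall>X\<in>\<X>. 2 \<le> card X"
    using \<C>(1) by (auto simp: \<X>_def partition_on_def)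
  ultimately show ?thesis using \<C>(3) by (intro exI[of _ \<X>]) auto
qed

section \<open>Ranks under perturbation of the placement\<close>

lemma functional_erow_bound:
  fixes \<phi> :: "('a \<Rightarrow> complex) \<Rightarrow> real"
  assumes "e \<in> edge_set V" "linear \<phi>"
  shows "\<exists>K\<ge>0. \<forall>d \<eta>. (\<forall>v\<in>V. norm (d v) \<le> \<eta>) \<longrightarrow> \<bar>\<phi> (erow d e)\<bar> \<le> K * \<eta>"
proof -
  obtain u v where e: "e = {u, v}" "u \<noteq> v" "u \<in> V" "v \<in> V"
    using assms(1) by (rule edge_setE)
  \<comment> \<open>As \<open>q u - q v = 1\<close>, the row of any displacement \<open>d\<close> is
    a combination of two fixed vectors, with the real and imaginary parts of
    \<open>d u - d v\<close> as coefficients; this gives continuity without a norm on the function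
    space.\<close>
  define q where "q w = (if w = u then 1 else (0::complex))" for w
  define K where "K = 2 * (\<bar>\<phi> (erow q e)\<bar> + \<bar>\<phi> (rot (erow q e))\<bar>)"
  have "\<bar>\<phi> (erow d e)\<bar> \<le> K * \<eta>" if d: "\<forall>v\<in>V. norm (d v) \<le> \<eta>" for d \<eta>
  proof -
    let ?c = "d u - d v"
    have "erow d e = Re ?c *\<^sub>R erow q e + Im ?c *\<^sub>R rot (erow q e)"
      unfolding e(1) using e(2) by (intro erow_eq_multiple) (auto simp: q_def)
    then have "\<phi> (erow d e) = Re ?c * \<phi> (erow q e) + Im ?c * \<phi> (rot (erow q e))"
      using assms(2) by (simp add: linear_add linear_cmul)
    also have "\<bar>\<dots>\<bar> \<le> \<bar>Re ?c\<bar> * \<bar>\<phi> (erow q e)\<bar> + \<bar>Im ?c\<bar> * \<bar>\<phi> (rot (erow q e))\<bar>"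
      using abs_triangle_ineq by (metis abs_mult)
    also have "\<dots> \<le> (2 * \<eta>) * \<bar>\<phi> (erow q e)\<bar> + (2 * \<eta>) * \<bar>\<phi> (rot (erow q e))\<bar>"
    proof -
      have "norm ?c \<le> 2 * \<eta>"
        using norm_triangle_ineq4[of "d u" "d v"] d[rule_format, OF e(3)] d[rule_format, OF e(4)] by linarith
      then have "\<bar>Re ?c\<bar> \<le> 2 * \<eta>" "\<bar>Im ?c\<bar> \<le> 2 * \<eta>"
        using abs_Re_le_cmod[of ?c] abs_Im_le_cmod[of ?c] by linarith+
      then show ?thesis by (intro add_mono mult_right_mono) auto
    qed
    also have "\<dots> = K * \<eta>" by (simp add: K_def algebra_simps)
    finally show ?thesis .
  qed
  moreover have "K \<ge> 0" by (simp add: K_def)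
  ultimately show ?thesis by blast
qed

text \<open>Independent rows remain independent under small perturbations.\<close>

lemma rank_lower_semicontinuous_single:
  assumes "finite V" "F \<subseteq> edge_set V"
  shows "\<exists>\<eta>>0. \<forall>p'. (\<forall>v\<in>V. norm (p' v - p v) < \<eta>) \<longrightarrow> rk (erow p) F \<le> rk (erow p') F"
proof -
  have finF: "finite F" using finite_subset[OF assms(2) finite_edge_set[OF assms(1)]] .
  obtain I where I: "I \<subseteq> F" "lin_indep (erow p) I" "card I = rk (erow p) F"
    using ex_lin_indep[OF finF] by blast
  have finI: "finite I" using I(1) finF finite_subset by blast
  obtain \<phi> :: "'a set \<Rightarrow> ('a \<Rightarrow> complex) \<Rightarrow> real"
    where \<phi>: "\<And>i. i \<in> I \<Longrightarrow> linear (\<phi> i)"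
      "\<And>i j. i \<in> I \<Longrightarrow> j \<in> I \<Longrightarrow> \<phi> i (erow p j) = (if i = j then 1 else 0)"
    using dual_functionals[OF finI I(2)] by blast
  have "\<exists>K\<ge>0. \<forall>d \<eta>. (\<forall>v\<in>V. norm (d v) \<le> \<eta>) \<longrightarrow> \<bar>\<phi> i (erow d j)\<bar> \<le> K * \<eta>"
    if "i \<in> I" "j \<in> I" for i j
    using that \<phi>(1) I(1) assms(2) by (intro functional_erow_bound) auto
  then obtain K where K: "\<And>i j. i \<in> I \<Longrightarrow> j \<in> I \<Longrightarrow> K i j \<ge> 0"
    "\<And>i j d \<eta>. i \<in> I \<Longrightarrow> j \<in> I \<Longrightarrow> \<forall>v\<in>V. norm (d v) \<le> \<eta> \<Longrightarrow> \<bar>\<phi> i (erow d j)\<bar> \<le> K i j * \<eta>"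
    by metis
  define M where "M = (\<Sum>i\<in>I. \<Sum>j\<in>I. K i j) + 1"
  have M: "K i j < M" if "i \<in> I" "j \<in> I" for i j
  proof -
    have "K i j \<le> (\<Sum>j\<in>I. K i j)" using that K(1) finI by (intro member_le_sum) auto
    also have "\<dots> \<le> (\<Sum>i\<in>I. \<Sum>j\<in>I. K i j)"
      using that K(1) finI by (intro member_le_sum[of i I "\<lambda>i. \<Sum>j\<in>I. K i j"] sum_nonneg) auto
    finally show ?thesis by (simp add: M_def)
  qed
  have M1: "M \<ge> 1" using K(1) by (auto simp: M_def intro!: sum_nonneg)
  \<comment> \<open>Makes \<open>card I * M * \<eta>\<close> equal to
    \<open>card I / (card I + 1)\<close>, which is below one also for empty
    \<open>I\<close>.\<close>
  define \<eta> where "\<eta> = 1 / (M * (real (card I) + 1))"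
  have \<eta>: "\<eta> > 0" using M1 by (simp add: \<eta>_def)
  show ?thesis
  proof (intro exI conjI allI impI)
    show "\<eta> > 0" by fact
    fix p' assume p': "\<forall>v\<in>V. norm (p' v - p v) < \<eta>"
    have "lin_indep (erow p') I"
    proof (rule lin_indep_perturb[OF finI, where \<phi> = \<phi> and x = "erow p"])
      fix i j assume ij: "i \<in> I" "j \<in> I"
      have "erow p' j - erow p j = erow (p' - p) j"
        using linear_diff[OF linear_erow[of j], of p' p] by simp
      then have "real (card I) * \<bar>\<phi> i (erow p' j - erow p j)\<bar> \<le> real (card I) * (K i j * \<eta>)"
        using K(2)[OF ij, of "p' - p" \<eta>] p' by (intro mult_left_mono) (auto intro: less_imp_le)
      also have "\<dots> \<le> real (card I) * (M * \<eta>)"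
        using M[OF ij] \<eta> by (intro mult_left_mono mult_right_mono) auto
      also have "\<dots> = real (card I) / (real (card I) + 1)"
        using M1 by (simp add: \<eta>_def)
      also have "\<dots> < 1" by simp
      finally show "real (card I) * \<bar>\<phi> i (erow p' j - erow p j)\<bar> < 1" .
    qed (use \<phi> in auto)
    then show "rk (erow p) F \<le> rk (erow p') F"
      unfolding I(3)[symmetric] using finI finF I(1)
      by (intro lin_indep_card_le_dim) (auto intro: span_base)
  qed
qed

lemma rank_lower_semicontinuous:
  assumes "finite V"
  shows "\<exists>\<eta>>0. \<forall>p'. (\<forall>v\<in>V. norm (p' v - p v) < \<eta>) \<longrightarrow>
    (\<forall>F\<subseteq>edge_set V. rk (erow p) F \<le> rk (erow p') F)"
proof -
  let ?P = "Pow (edge_set V)"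
  obtain \<eta> where \<eta>: "\<And>F. F \<in> ?P \<Longrightarrow> \<eta> F > 0"
    "\<And>F p'. F \<in> ?P \<Longrightarrow> \<forall>v\<in>V. norm (p' v - p v) < \<eta> F \<Longrightarrow> rk (erow p) F \<le> rk (erow p') F"
    using rank_lower_semicontinuous_single[OF assms, of _ p] by (metis PowD)
  have fin: "finite (\<eta> ` ?P)" "\<eta> ` ?P \<noteq> {}"
    using finite_edge_set[OF assms] by auto
  show ?thesis
  proof (intro exI conjI allI impI)
    show "Min (\<eta> ` ?P) > 0" using fin \<eta>(1) by simp
    fix p' F assume p': "\<forall>v\<in>V. norm (p' v - p v) < Min (\<eta> ` ?P)" and F: "F \<subseteq> edge_set V"
    show "rk (erow p) F \<le> rk (erow p') F"
      using p' F fin by (intro \<eta>(2)) auto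
  qed
qed

text \<open>Local maximality is asked only along lines, with a bound depending on the direction:
  this is exactly what differentiating a dependency uses.\<close>

definition rank_stable :: "'a set \<Rightarrow> ('a \<Rightarrow> complex) \<Rightarrow> bool" where
  "rank_stable V p \<longleftrightarrow> (\<forall>q. \<forall>F\<subseteq>edge_set V. \<exists>\<epsilon>>0. \<forall>t::real. \<bar>t\<bar> < \<epsilon> \<longrightarrow> rk (erow (p + t *\<^sub>R q)) F \<le> rk (erow p) F)"

lemma rank_stableE:
  assumes "rank_stable V p" "F \<subseteq> edge_set V"
  obtains \<epsilon> where "\<epsilon> > 0" "\<And>t::real. \<bar>t\<bar> < \<epsilon> \<Longrightarrow> rk (erow (p + t *\<^sub>R q)) F \<le> rk (erow p) F"
proof -
  have "\<exists>\<epsilon>>0. \<forall>t::real. \<bar>t\<bar> < \<epsilon> \<longrightarrow> rk (erow (p + t *\<^sub>R q)) F \<le> rk (erow p) F"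
    using assms unfolding rank_stable_def by (elim allE[of _ q] allE[of _ F] impE)
  then show thesis using that by (elim exE conjE) simp
qed

text \<open>Maximise the total rank over all edge sets at once. Near a maximiser no single rank
  drops, so none can rise without raising the total.\<close>

lemma ex_rank_stable:
  fixes V :: "'a set"
  assumes "finite V"
  shows "\<exists>p. rank_stable V p"
proof -
  let ?P = "Pow (edge_set V)"
  let ?s = "\<lambda>p::'a \<Rightarrow> complex. \<Sum>F\<in>?P. rk (erow p) F"
  have finP: "finite ?P" using finite_edge_set[OF assms] by simp
  have "?s p \<le> (\<Sum>F\<in>?P. card F)" for p
  proof (rule sum_mono)
    fix F assume "F \<in> ?P"
    then have "finite F" using finite_edge_set[OF assms] finite_subset by auto
    then have "rk (erow p) F \<le> card (erow p ` F)"
      by (intro dim_le_card) (auto intro: span_base)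
    also have "\<dots> \<le> card F" using \<open>finite F\<close> by (rule card_image_le)
    finally show "rk (erow p) F \<le> card F" .
  qed
  then obtain p where p: "\<And>p'. ?s p' \<le> ?s p"
    using ex_has_greatest_nat[of "\<lambda>_. True" undefined ?s "Suc (\<Sum>F\<in>?P. card F)"] by (auto simp: less_Suc_eq_le)
  obtain \<eta> where \<eta>: "\<eta> > 0" "\<And>p' F. \<forall>v\<in>V. norm (p' v - p v) < \<eta> \<Longrightarrow> F \<in> ?P \<Longrightarrow> rk (erow p) F \<le> rk (erow p') F"
    using rank_lower_semicontinuous[OF assms, of p] by auto
  have "\<exists>\<epsilon>>0. \<forall>t::real. \<bar>t\<bar> < \<epsilon> \<longrightarrow> rk (erow (p + t *\<^sub>R q)) F \<le> rk (erow p) F" if F: "F \<subseteq> edge_set V" for q F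
  proof -
    define m where "m = (\<Sum>v\<in>V. norm (q v)) + 1"
    have m: "norm (q v) < m" if "v \<in> V" for v
      using member_le_sum[of v V "\<lambda>v. norm (q v)"] that assms by (simp add: m_def)
    have m1: "m \<ge> 1" by (simp add: m_def sum_nonneg)
    show ?thesis
    proof (intro exI conjI allI impI)
      show "\<eta> / m > 0" using \<eta>(1) m1 by simp
      fix t :: real assume t: "\<bar>t\<bar> < \<eta> / m"
      have near: "\<forall>v\<in>V. norm ((p + t *\<^sub>R q) v - p v) < \<eta>"
      proof
        fix v assume v: "v \<in> V"
        have "norm ((p + t *\<^sub>R q) v - p v) = \<bar>t\<bar> * norm (q v)" by simp
        also have "\<dots> \<le> \<bar>t\<bar> * m" using m[OF v] by (intro mult_left_mono) auto
        also have "\<dots> < \<eta>" using t m1 by (simp add: field_simps)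
        finally show "norm ((p + t *\<^sub>R q) v - p v) < \<eta>" .
      qed
      have "?s p = ?s (p + t *\<^sub>R q)"
        using p[of "p + t *\<^sub>R q"] sum_mono[of ?P "rk (erow p)" "rk (erow (p + t *\<^sub>R q))"] \<eta>(2)[OF near]
        by (intro antisym) blast+
      then have "rk (erow p) F = rk (erow (p + t *\<^sub>R q)) F"
        using sum_mono_inv[of "rk (erow p)" ?P "rk (erow (p + t *\<^sub>R q))" F] \<eta>(2)[OF near] F finP by auto
      then show "rk (erow (p + t *\<^sub>R q)) F \<le> rk (erow p) F" by simp
    qed
  qed
  then show ?thesis unfolding rank_stable_def by blast
qed

text \<open>The row of a pair of coinciding points is zero and becomes nonzero when one of them is
  moved.\<close>

lemma rank_stable_inj:
  assumes "rank_stable V p"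
  shows "inj_on p V"
proof (rule inj_onI, rule ccontr)
  fix u v assume uv: "u \<in> V" "v \<in> V" "p u = p v" "u \<noteq> v"
  define q where "q w = (if w = u then 1 else (0::complex))" for w
  let ?e = "{u, v}"
  have "{?e} \<subseteq> edge_set V" using uv by (auto simp: edge_set_def)
  then obtain \<epsilon> where \<epsilon>: "\<epsilon> > 0" "\<And>t::real. \<bar>t\<bar> < \<epsilon> \<Longrightarrow> rk (erow (p + t *\<^sub>R q)) {?e} \<le> rk (erow p) {?e}"
    using rank_stableE[OF assms, where q = q] by metis
  have p0: "erow p ?e = 0" using uv by (auto simp: erow_pair fun_eq_iff)
  let ?t = "\<epsilon> / 2"
  have "(erow (p + ?t *\<^sub>R q) ?e) u = of_real ?t"
    using uv p0 by (simp add: erow_pair q_def scaleR_conv_of_real)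
  then have "erow (p + ?t *\<^sub>R q) ?e \<noteq> 0"
    using \<epsilon>(1) by (metis divide_eq_0_iff less_irrefl of_real_eq_0_iff zero_fun_apply zero_neq_numeral)
  then have "rk (erow (p + ?t *\<^sub>R q)) {?e} = 1"
    using rk_insert[of "{}" "erow (p + ?t *\<^sub>R q)" ?e] by (simp add: dim_empty)
  moreover have "rk (erow p) {?e} = 0"
    using rk_insert[of "{}" "erow p" ?e] p0 by (simp add: dim_empty)
  ultimately show False using \<epsilon>(2)[of ?t] \<epsilon>(1) by simp
qed

text \<open>Along the line \<open>p + t q\<close>, a dependency of the rows at \<open>p\<close> evaluates to \<open>t\<close> times the vector
  on the left; were it outside the row space at \<open>p\<close>, the rank would grow for small \<open>t\<close>.\<close>

lemma dependency_derivative: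
  assumes "finite V" "rank_stable V p" "F \<subseteq> edge_set V"
    and dep: "(\<Sum>e\<in>F. c e *\<^sub>R erow p e) = 0"
  shows "(\<Sum>e\<in>F. c e *\<^sub>R erow q e) \<in> span (erow p ` F)"
proof (rule ccontr)
  let ?D = "\<Sum>e\<in>F. c e *\<^sub>R erow q e"
  assume D: "?D \<notin> span (erow p ` F)"
  have finF: "finite F" using finite_subset[OF assms(3) finite_edge_set[OF assms(1)]] .
  obtain I where I: "I \<subseteq> F" "lin_indep (erow p) I" "card I = rk (erow p) F"
    using ex_lin_indep[OF finF] by blast
  have finI: "finite I" using I(1) finF finite_subset by blast
  \<comment> \<open>The index \<open>None\<close> stands for the derivative vector
    \<open>?D\<close>, kept fixed; \<open>Some e\<close> stands for the row of \<open>e\<close>,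
    which moves with \<open>t\<close>.\<close>
  let ?J = "insert None (Some ` I)"
  define x where "x t i = (case i of None \<Rightarrow> ?D | Some e \<Rightarrow> erow (p + t *\<^sub>R q) e)" for t :: real and i
  have x0: "x 0 i = (case i of None \<Rightarrow> ?D | Some e \<Rightarrow> erow p e)" for i
    by (cases i) (simp_all add: x_def)
  have finJ: "finite ?J" using finI by simp
  have sumJ: "(\<Sum>i\<in>?J. h i) = h None + (\<Sum>e\<in>I. h (Some e))" for h :: "'a set option \<Rightarrow> 'a \<Rightarrow> complex"
    using finI by (simp add: sum.reindex)
  have "lin_indep (x 0) ?J"
    unfolding lin_indep_def
  proof (intro allI impI)
    fix a assume "(\<Sum>i\<in>?J. a i *\<^sub>R x 0 i) = 0"
    then have *: "a None *\<^sub>R ?D + (\<Sum>e\<in>I. a (Some e) *\<^sub>R erow p e) = 0"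
      unfolding sumJ by (simp add: x0)
    have "a None = 0"
    proof (rule ccontr)
      assume nz: "a None \<noteq> 0"
      have "?D = (- 1 / a None) *\<^sub>R (\<Sum>e\<in>I. a (Some e) *\<^sub>R erow p e)"
      proof -
        have "(\<Sum>e\<in>I. a (Some e) *\<^sub>R erow p e) = - (a None *\<^sub>R ?D)"
          using * by (simp add: eq_neg_iff_add_eq_0 add.commute)
        then show ?thesis using nz by simp
      qed
      also have "\<dots> \<in> span (erow p ` F)"
        using I(1) by (intro span_scale span_sum span_base) auto
      finally show False using D by simp
    qed
    moreover from this have "(\<Sum>e\<in>I. a (Some e) *\<^sub>R erow p e) = 0"
      using * by simp
    then have "\<And>e. e \<in> I \<Longrightarrow> a (Some e) = 0"
      using I(2)[unfolded lin_indep_def, rule_format, of "\<lambda>e. a (Some e)"] by blast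
    ultimately show "\<forall>i\<in>?J. a i = 0" by blast
  qed
  then obtain \<phi> :: "'a set option \<Rightarrow> ('a \<Rightarrow> complex) \<Rightarrow> real"
    where \<phi>: "\<And>i. i \<in> ?J \<Longrightarrow> linear (\<phi> i)"
      "\<And>i j. i \<in> ?J \<Longrightarrow> j \<in> ?J \<Longrightarrow> \<phi> i (x 0 j) = (if i = j then 1 else 0)"
    using dual_functionals[OF finJ] by blast
  obtain \<epsilon> where \<epsilon>: "\<epsilon> > 0" "\<And>t::real. \<bar>t\<bar> < \<epsilon> \<Longrightarrow> rk (erow (p + t *\<^sub>R q)) F \<le> rk (erow p) F"
    using rank_stableE[OF assms(2,3), where q = q] by metis
  define K where "K i j = (case j of None \<Rightarrow> 0 | Some e \<Rightarrow> \<bar>\<phi> i (erow q e)\<bar>)" for i j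
  define M where "M = (\<Sum>i\<in>?J. \<Sum>j\<in>?J. K i j) + 1"
  have K0: "K i j \<ge> 0" for i j by (simp add: K_def split: option.split)
  have M: "K i j < M" if "i \<in> ?J" "j \<in> ?J" for i j
  proof -
    have "K i j \<le> (\<Sum>j\<in>?J. K i j)" using that K0 finJ by (intro member_le_sum) auto
    also have "\<dots> \<le> (\<Sum>i\<in>?J. \<Sum>j\<in>?J. K i j)"
      using that K0 finJ by (intro member_le_sum[of i ?J "\<lambda>i. \<Sum>j\<in>?J. K i j"] sum_nonneg) auto
    finally show ?thesis by (simp add: M_def)
  qed
  have M1: "M \<ge> 1" using K0 by (auto simp: M_def intro!: sum_nonneg)
  \<comment> \<open>Below \<open>\<epsilon>\<close>, where the rank cannot exceed that at
    \<open>p\<close>, and small enough to keep the perturbed family independent.\<close>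
  define t where "t = min (\<epsilon> / 2) (1 / (M * (real (card ?J) + 1)))"
  have t: "t > 0" "t < \<epsilon>" "t \<le> 1 / (M * (real (card ?J) + 1))"
    using \<epsilon>(1) M1 by (auto simp: t_def)
  have "lin_indep (x t) ?J"
  proof (rule lin_indep_perturb[OF finJ, where \<phi> = \<phi> and x = "x 0"])
    fix i j assume ij: "i \<in> ?J" "j \<in> ?J"
    have "\<bar>\<phi> i (x t j - x 0 j)\<bar> = t * K i j"
    proof (cases j)
      case None
      then show ?thesis using linear_0[OF \<phi>(1)[OF ij(1)]] by (simp add: x_def K_def)
    next
      case (Some e)
      have "x t j - x 0 j = t *\<^sub>R erow q e"
        using Some by (simp add: x_def erow_add erow_scaleR)
      then show ?thesis using t(1) Some \<phi>(1)[OF ij(1)] by (simp add: linear_cmul K_def abs_mult)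
    qed
    then have "real (card ?J) * \<bar>\<phi> i (x t j - x 0 j)\<bar> = real (card ?J) * (t * K i j)" by simp
    also have "\<dots> \<le> real (card ?J) * (t * M)"
      using M[OF ij] t(1) by (intro mult_left_mono) auto
    also have "\<dots> \<le> real (card ?J) * (1 / (M * (real (card ?J) + 1)) * M)"
      using t(3) M1 by (intro mult_left_mono mult_right_mono) auto
    also have "\<dots> = real (card ?J) / (real (card ?J) + 1)"
      using M1 by simp
    also have "\<dots> < 1" by simp
    finally show "real (card ?J) * \<bar>\<phi> i (x t j - x 0 j)\<bar> < 1" .
  qed (use \<phi> in auto)
  moreover have "x t ` ?J \<subseteq> span (erow (p + t *\<^sub>R q) ` F)"
  proof -
    have "(\<Sum>e\<in>F. c e *\<^sub>R erow (p + t *\<^sub>R q) e) = t *\<^sub>R ?D"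
    proof -
      have "(\<Sum>e\<in>F. c e *\<^sub>R erow (p + t *\<^sub>R q) e) = (\<Sum>e\<in>F. c e *\<^sub>R erow p e + t *\<^sub>R (c e *\<^sub>R erow q e))"
        by (intro sum.cong) (simp_all add: erow_add erow_scaleR scaleR_add_right mult.commute)
      also have "\<dots> = t *\<^sub>R ?D" by (simp add: sum.distrib dep scale_sum_right)
      finally show ?thesis .
    qed
    then have "?D = (1 / t) *\<^sub>R (\<Sum>e\<in>F. c e *\<^sub>R erow (p + t *\<^sub>R q) e)" using t(1) by simp
    moreover have "(1 / t) *\<^sub>R (\<Sum>e\<in>F. c e *\<^sub>R erow (p + t *\<^sub>R q) e) \<in> span (erow (p + t *\<^sub>R q) ` F)"
      by (intro span_scale span_sum span_base) auto
    ultimately have "?D \<in> span (erow (p + t *\<^sub>R q) ` F)" by simp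
    moreover have "erow (p + t *\<^sub>R q) e \<in> span (erow (p + t *\<^sub>R q) ` F)" if "e \<in> I" for e
      using that I(1) by (intro span_base) auto
    ultimately show ?thesis by (auto simp: x_def)
  qed
  ultimately have "card ?J \<le> rk (erow (p + t *\<^sub>R q)) F"
    using finJ finF by (intro lin_indep_card_le_dim) auto
  moreover have "card ?J = Suc (card I)" using finI by (simp add: card_image)
  ultimately show False using \<epsilon>(2)[of t] t I(3) by simp
qed

section \<open>Covers bounding the rigidity rank from below\<close>

lemma ex_inj_real:
  assumes "finite V"
  obtains f :: "'a \<Rightarrow> real" where "inj_on f V"
proof -
  obtain g :: "'a \<Rightarrow> nat" where "inj_on g V"
    using finite_imp_inj_to_nat_seg[OF assms] by blast
  then have "inj_on (\<lambda>v. real (g v)) V" by (auto simp: inj_on_def)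
  then show thesis by (rule that)
qed

text \<open>If every dependency restricts to one on \<open>F1\<close>, and hence to one on
  \<open>F - F1\<close>, then maximal independent subsets of the two parts are independent
  together.\<close>

lemma rank_additive:
  fixes \<rho> :: "'e \<Rightarrow> 'v::real_vector"
  assumes "finite F" "F1 \<subseteq> F"
    and split: "\<And>c. (\<Sum>e\<in>F. c e *\<^sub>R \<rho> e) = 0 \<Longrightarrow> (\<Sum>e\<in>F1. c e *\<^sub>R \<rho> e) = 0"
  shows "rk \<rho> F1 + rk \<rho> (F - F1) \<le> rk \<rho> F"
proof -
  have fin: "finite F1" "finite (F - F1)" using assms finite_subset by auto
  obtain I1 where I1: "I1 \<subseteq> F1" "lin_indep \<rho> I1" "card I1 = rk \<rho> F1"
    using ex_lin_indep[OF fin(1)] by blast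
  obtain I2 where I2: "I2 \<subseteq> F - F1" "lin_indep \<rho> I2" "card I2 = rk \<rho> (F - F1)"
    using ex_lin_indep[OF fin(2)] by blast
  have finI: "finite I1" "finite I2" using I1(1) I2(1) fin finite_subset by blast+
  have disj: "I1 \<inter> I2 = {}" using I1(1) I2(1) by blast
  have "lin_indep \<rho> (I1 \<union> I2)"
    unfolding lin_indep_def
  proof (intro allI impI)
    fix a assume a: "(\<Sum>i\<in>I1 \<union> I2. a i *\<^sub>R \<rho> i) = 0"
    let ?c = "\<lambda>e. if e \<in> I1 \<union> I2 then a e else 0"
    have sub: "(\<Sum>e\<in>J. a e *\<^sub>R \<rho> e) = (\<Sum>e\<in>H. ?c e *\<^sub>R \<rho> e)"
      if "J \<subseteq> H" "finite H" "H \<inter> (I1 \<union> I2) = J" for J H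
      using that by (intro sum.mono_neutral_cong_left) auto
    have F: "(\<Sum>e\<in>F. ?c e *\<^sub>R \<rho> e) = 0"
      using a sub[of "I1 \<union> I2" F] I1(1) I2(1) assms(1,2) by auto
    have F1: "(\<Sum>e\<in>F1. ?c e *\<^sub>R \<rho> e) = 0" by (rule split[OF F])
    have F2: "(\<Sum>e\<in>F - F1. ?c e *\<^sub>R \<rho> e) = 0"
      using F F1 assms(1,2) by (simp add: sum_diff)
    have "(\<Sum>e\<in>I1. a e *\<^sub>R \<rho> e) = 0" "(\<Sum>e\<in>I2. a e *\<^sub>R \<rho> e) = 0"
      using F1 F2 sub[of I1 F1] sub[of I2 "F - F1"] I1(1) I2(1) fin by auto
    then show "\<forall>i\<in>I1 \<union> I2. a i = 0"
      using I1(2) I2(2) unfolding lin_indep_def by blast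
  qed
  then have "card (I1 \<union> I2) \<le> rk \<rho> F"
    using finI I1(1) I2(1) assms(1,2) by (intro lin_indep_card_le_dim) (auto intro!: span_base)
  then show ?thesis using card_Un_disjoint[OF finI disj] I1(3) I2(3) by simp
qed

text \<open>The Lovasz--Yemini rank formula. Each edge \<open>e\<close> has a direction \<open>y e\<close> complementing its row.
  The dependencies of the rows are closed under multiplication by \<open>\<lambda>e. \<phi> (y e)\<close> for any
  functional \<open>\<phi>\<close> vanishing on the row space, so the rows split as a direct sum over the classes of
  edges whose directions agree modulo the row space. A single class spans, together with one
  direction, all rows of all placements, so its rank is at least twice its graphic rank minus one.\<close>

lemma rigidity_rank_cover:
  assumes fin: "finite V" and stable: "rank_stable V p" and "F \<subseteq> edge_set V"
  shows "\<exists>\<X>\<subseteq>Pow V. (\<forall>X\<in>\<X>. 2 \<le> card X) \<and> F \<subseteq> (\<Union>X\<in>\<X>. edge_set X) \<and>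
    (\<Sum>X\<in>\<X>. 2 * card X - 3) \<le> rk (erow p) F"
proof -
  have "finite F" using finite_subset[OF assms(3) finite_edge_set[OF fin]] .
  then show ?thesis using assms(3)
  proof (induction F rule: finite_psubset_induct)
    case (psubset F)
    note F = psubset.prems
    show ?case
    proof (cases "F = {}")
      case False
      then obtain e0 where e0: "e0 \<in> F" by blast
      let ?B = "span (erow p ` F)"
      let ?h = "\<lambda>x. ip V x (rot p)"
      \<comment> \<open>The functional \<open>?h\<close> vanishes on the row space but not on the
        quarter turn of a row. With the normalisation \<open>?h (y e) = 1\<close>, the row of
        \<open>e\<close> at any placement \<open>q\<close> is \<open>?h (erow q e)\<close> times
        \<open>y e\<close> modulo the row space.\<close>
      define y where "y e = (1 / ?h (rot (erow p e))) *\<^sub>R rot (erow p e)" for e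
      have linh: "linear ?h" by (rule linear_ip)
      have hB: "?h x = 0" if "x \<in> ?B" for x
        using that by (rule linear_eq_0_on_span[OF linh, rotated]) (use ip_erow_rot(1)[OF fin] F in auto)
      have hrot: "?h (rot (erow p e)) \<noteq> 0" if "e \<in> F" for e
      proof -
        have "e \<in> edge_set V" using that F by blast
        then obtain u v where e: "e = {u, v}" "u \<noteq> v" "u \<in> V" "v \<in> V" by (rule edge_setE)
        then have "p u \<noteq> p v" using rank_stable_inj[OF stable] by (auto simp: inj_on_def)
        then have "ip V (erow p e) p \<noteq> 0"
          unfolding e(1) by (rule ip_erow_self_nonzero[OF fin e(3,4)])
        then show ?thesis using ip_erow_rot(3)[OF fin \<open>e \<in> edge_set V\<close>, of p] by (simp add: erow_rot)
      qed
      have hy: "?h (y e) = 1" if "e \<in> F" for e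
        using hrot[OF that] by (simp add: y_def linear_cmul[OF linh])
      have decomp: "erow q e - ?h (erow q e) *\<^sub>R y e \<in> ?B" if "e \<in> F" for q e
      proof -
        have eV: "e \<in> edge_set V" using that F by blast
        then obtain u v where e: "e = {u, v}" "u \<noteq> v" "u \<in> V" "v \<in> V" by (rule edge_setE)
        then have "p u \<noteq> p v" using rank_stable_inj[OF stable] by (auto simp: inj_on_def)
        define c where "c = (q u - q v) / (p u - p v)"
        have "q u - q v = c * (p u - p v)" using \<open>p u \<noteq> p v\<close> by (simp add: c_def)
        then have eq: "erow q e = Re c *\<^sub>R erow p e + Im c *\<^sub>R rot (erow p e)"
          unfolding e(1) by (rule erow_eq_multiple[OF e(2)])
        have "?h (erow q e) = Im c * ?h (rot (erow p e))"
          unfolding eq by (simp add: linear_add[OF linh] linear_cmul[OF linh] ip_erow_rot(1)[OF fin eV])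
        then have "erow q e - ?h (erow q e) *\<^sub>R y e = Re c *\<^sub>R erow p e"
          using hrot[OF that] by (simp add: eq y_def)
        then show ?thesis
          using that by (simp add: span_scale span_base)
      qed
      show ?thesis
      proof (cases "\<forall>e\<in>F. y e - y e0 \<in> ?B")
        case True
        obtain f :: "'a \<Rightarrow> real" where f: "inj_on f V" using ex_inj_real[OF fin] .
        let ?S = "insert (y e0) (erow p ` F)"
        have BS: "?B \<subseteq> span ?S" by (intro span_mono) auto
        have all: "erow q e \<in> span ?S" if "e \<in> F" for q e
        proof -
          have "erow q e = (erow q e - ?h (erow q e) *\<^sub>R y e) +
              (?h (erow q e) *\<^sub>R (y e - y e0) + ?h (erow q e) *\<^sub>R y e0)"
            by (simp add: scaleR_diff_right)
          also have "\<dots> \<in> span ?S"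
            using decomp[OF that] True[rule_format, OF that] BS
            by (intro span_add span_scale) (auto intro: span_base)
          finally show ?thesis .
        qed
        have "2 * rk (erow (real_placement f)) F \<le> dim ?S"
          using all psubset.hyps by (intro two_mult_graphic_rank_le) (auto simp: erow_rot[symmetric])
        also have "\<dots> \<le> Suc (rk (erow p) F)"
          using psubset.hyps by (simp add: dim_insert_finite)
        finally have le: "2 * rk (erow (real_placement f)) F \<le> Suc (rk (erow p) F)" .
        obtain \<X> where X: "\<X> \<subseteq> Pow V" "\<forall>X\<in>\<X>. 2 \<le> card X" "F \<subseteq> (\<Union>X\<in>\<X>. edge_set X)"
          "(\<Sum>X\<in>\<X>. 2 * card X - 3) + 1 \<le> 2 * rk (erow (real_placement f)) F"
          using graphic_rank_cover[OF fin F f False] by (elim exE conjE)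
        have "(\<Sum>X\<in>\<X>. 2 * card X - 3) \<le> rk (erow p) F" using X(4) le by simp
        with X(1-3) show ?thesis by (intro exI[of _ \<X>] conjI)
      next
        case False
        define F1 where "F1 = {e \<in> F. y e - y e0 \<in> ?B}"
        have "e0 \<in> F1" using e0 span_zero[of "erow p ` F"] by (simp add: F1_def)
        moreover have "F1 \<subseteq> F" "F1 \<noteq> F" using False by (auto simp: F1_def)
        ultimately have F1: "F1 \<subset> F" "F - F1 \<subset> F" "F1 \<subseteq> F" by blast+
        have closed: "(\<Sum>e\<in>F. (c e * \<phi> (y e)) *\<^sub>R erow p e) = 0"
          if c: "(\<Sum>e\<in>F. c e *\<^sub>R erow p e) = 0" and \<phi>: "linear \<phi>" "\<And>x. x \<in> ?B \<Longrightarrow> \<phi> x = 0"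
          for c and \<phi> :: "('a \<Rightarrow> complex) \<Rightarrow> real"
        proof -
          define z where "z = (\<Sum>e\<in>F. (c e * \<phi> (y e)) *\<^sub>R erow p e)"
          \<comment> \<open>The placement with \<open>rot q = z\<close>: by the polarisation
            identity, applying \<open>\<phi>\<close> to the dependency differentiated along
            \<open>q\<close> gives minus the squared length of \<open>z\<close>.\<close>
          define q where "q = (\<lambda>v. - \<i> * z v)"
          have rq: "rot q = z" by (simp add: q_def rot_def)
          have \<phi>q: "\<phi> (erow q e) = - (ip V (erow p e) z) * \<phi> (y e)" if "e \<in> F" for e
          proof -
            have "\<phi> (erow q e - ?h (erow q e) *\<^sub>R y e) = 0" by (rule \<phi>(2)[OF decomp[OF that]])
            moreover have "?h (erow q e) = - (ip V (erow p e) z)"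
              using ip_erow_rot(2)[OF fin, of e q p] that F rq by auto
            ultimately show ?thesis
              by (simp add: linear_diff[OF \<phi>(1)] linear_add[OF \<phi>(1)] linear_cmul[OF \<phi>(1)])
          qed
          have "0 = \<phi> (\<Sum>e\<in>F. c e *\<^sub>R erow q e)"
            using \<phi>(2)[OF dependency_derivative[OF fin stable F c]] by simp
          also have "\<dots> = (\<Sum>e\<in>F. c e * \<phi> (erow q e))"
            by (simp add: linear_sum[OF \<phi>(1)] linear_cmul[OF \<phi>(1)])
          also have "\<dots> = (\<Sum>e\<in>F. - ((c e * \<phi> (y e)) * ip V (erow p e) z))"
            using \<phi>q by (intro sum.cong) auto
          also have "\<dots> = - ip V z z"
            by (simp add: z_def linear_sum[OF linear_ip] linear_cmul[OF linear_ip] sum_negf)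
          finally have "(\<Sum>v\<in>V. inner (z v) (z v)) = 0" by (simp add: ip_def)
          then have zV: "z v = 0" if "v \<in> V" for v
            using that fin by (subst (asm) sum_nonneg_eq_0_iff) auto
          have "z v = 0" if "v \<notin> V" for v
          proof -
            have "erow p e v = 0" if "e \<in> F" for e
              using that F \<open>v \<notin> V\<close> by (auto simp: erow_def edge_set_def)
            then show ?thesis by (simp add: z_def sum_fun_apply)
          qed
          with zV have "z v = 0" for v by (cases "v \<in> V") auto
          then have "z = 0" by (intro ext) simp
          then show ?thesis unfolding z_def .
        qed
        have "\<exists>\<phi> :: ('a \<Rightarrow> complex) \<Rightarrow> real. linear \<phi> \<and> (\<forall>x\<in>?B. \<phi> x = 0) \<and> \<phi> (y e) = 0 \<and> \<phi> (y e0) = 1"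
          if e: "e \<in> F - F1" for e
        proof -
          have "y e0 \<notin> span (insert (y e) (erow p ` F))"
          proof
            assume "y e0 \<in> span (insert (y e) (erow p ` F))"
            then obtain k where k: "y e0 - k *\<^sub>R y e \<in> ?B"
              using span_breakdown_eq by blast
            then have "?h (y e0 - k *\<^sub>R y e) = 0" by (rule hB)
            \<comment> \<open>\<open>?h\<close> is one on all directions, so directions that are
              proportional modulo the row space already agree there.\<close>
            then have "k = 1"
              using hy[OF e0] hy[of e] e by (simp add: linear_diff[OF linh] linear_cmul[OF linh])
            then have "- (y e0 - y e) \<in> ?B" using span_neg[OF k] by simp
            then show False using e by (simp add: F1_def)
          qed
          then obtain \<phi> :: "('a \<Rightarrow> complex) \<Rightarrow> real" where \<phi>: "linear \<phi>" "\<phi> (y e0) = 1"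
            "\<And>x. x \<in> span (insert (y e) (erow p ` F)) \<Longrightarrow> \<phi> x = 0"
            using separating_functional by blast
          have "?B \<subseteq> span (insert (y e) (erow p ` F))" by (intro span_mono) auto
          moreover have "y e \<in> span (insert (y e) (erow p ` F))" by (intro span_base) auto
          ultimately show ?thesis using \<phi> by blast
        qed
        then have "\<exists>\<phi> :: 'a set \<Rightarrow> ('a \<Rightarrow> complex) \<Rightarrow> real. \<forall>e\<in>F - F1. linear (\<phi> e) \<and>
            (\<forall>x\<in>?B. \<phi> e x = 0) \<and> \<phi> e (y e) = 0 \<and> \<phi> e (y e0) = 1"
          by (intro bchoice ballI)
        then obtain \<phi> :: "'a set \<Rightarrow> ('a \<Rightarrow> complex) \<Rightarrow> real" where \<phi>': "\<forall>e\<in>F - F1. linear (\<phi> e) \<and>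
            (\<forall>x\<in>?B. \<phi> e x = 0) \<and> \<phi> e (y e) = 0 \<and> \<phi> e (y e0) = 1"
          by (elim exE)
        then have \<phi>: "\<And>e. e \<in> F - F1 \<Longrightarrow> linear (\<phi> e)" "\<And>e x. e \<in> F - F1 \<Longrightarrow> x \<in> ?B \<Longrightarrow> \<phi> e x = 0"
            "\<And>e. e \<in> F - F1 \<Longrightarrow> \<phi> e (y e) = 0" "\<And>e. e \<in> F - F1 \<Longrightarrow> \<phi> e (y e0) = 1"
          by simp_all
        have \<phi>1: "\<phi> e' (y e) = 1" if "e \<in> F1" "e' \<in> F - F1" for e e'
        proof -
          have "\<phi> e' (y e - y e0) = 0" using that by (intro \<phi>(2)) (auto simp: F1_def)
          then show ?thesis using \<phi>(1,4)[OF that(2)] by (simp add: linear_diff)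
        qed
        have finF2: "finite (F - F1)" using psubset.hyps by simp
        have add: "rk (erow p) F1 + rk (erow p) (F - F1) \<le> rk (erow p) F"
        proof (rule rank_additive[OF psubset.hyps F1(3)])
          fix c assume c: "(\<Sum>e\<in>F. c e *\<^sub>R erow p e) = 0"
          \<comment> \<open>Multiplying by \<open>\<phi> e' (y e)\<close> for all \<open>e'\<close>
            outside \<open>F1\<close> keeps the coefficients on \<open>F1\<close>, where every
            factor is one, and kills the others, where the factor with \<open>e' = e\<close> is
            zero.\<close>
          have "(\<Sum>e\<in>F. (c e * (\<Prod>e'\<in>D. \<phi> e' (y e))) *\<^sub>R erow p e) = 0" if "D \<subseteq> F - F1" for D
            using finite_subset[OF that finF2] that
          proof (induction D rule: finite_induct)
            case (insert d D)
            have eq: "c e * (\<Prod>e'\<in>insert d D. \<phi> e' (y e)) = (c e * (\<Prod>e'\<in>D. \<phi> e' (y e))) * \<phi> d (y e)" for e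
              using insert.hyps by simp
            show ?case
              unfolding eq using insert by (intro closed insert.IH) (auto intro: \<phi>)
          qed (use c in simp)
          from this[of "F - F1"] have "(\<Sum>e\<in>F. (c e * (\<Prod>e'\<in>F - F1. \<phi> e' (y e))) *\<^sub>R erow p e) = 0" by simp
          also have "(\<Sum>e\<in>F. (c e * (\<Prod>e'\<in>F - F1. \<phi> e' (y e))) *\<^sub>R erow p e) = (\<Sum>e\<in>F1. c e *\<^sub>R erow p e)"
          proof (rule sum.mono_neutral_cong_right[OF psubset.hyps F1(3)])
            show "\<forall>e\<in>F - F1. (c e * (\<Prod>e'\<in>F - F1. \<phi> e' (y e))) *\<^sub>R erow p e = 0"
              using \<phi>(3) finF2 by (auto intro!: prod_zero)
            show "\<And>e. e \<in> F1 \<Longrightarrow> (c e * (\<Prod>e'\<in>F - F1. \<phi> e' (y e))) *\<^sub>R erow p e = c e *\<^sub>R erow p e"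
              using \<phi>1 by simp
          qed
          finally show "(\<Sum>e\<in>F1. c e *\<^sub>R erow p e) = 0" .
        qed
        obtain \<X>1 where X1: "\<X>1 \<subseteq> Pow V" "\<forall>X\<in>\<X>1. 2 \<le> card X" "F1 \<subseteq> (\<Union>X\<in>\<X>1. edge_set X)"
          "(\<Sum>X\<in>\<X>1. 2 * card X - 3) \<le> rk (erow p) F1"
          using psubset.IH[OF F1(1) order_trans[OF F1(3) F]] by (elim exE conjE)
        obtain \<X>2 where X2: "\<X>2 \<subseteq> Pow V" "\<forall>X\<in>\<X>2. 2 \<le> card X" "F - F1 \<subseteq> (\<Union>X\<in>\<X>2. edge_set X)"
          "(\<Sum>X\<in>\<X>2. 2 * card X - 3) \<le> rk (erow p) (F - F1)"
          using psubset.IH[OF F1(2) order_trans[OF Diff_subset F]] by (elim exE conjE)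
        have "finite \<X>1" "finite \<X>2" using X1(1) X2(1) fin by (auto intro: finite_subset)
        then have "(\<Sum>X\<in>\<X>1 \<union> \<X>2. 2 * card X - 3) \<le> (\<Sum>X\<in>\<X>1. 2 * card X - 3) + (\<Sum>X\<in>\<X>2. 2 * card X - 3)"
          using sum.union_inter[of \<X>1 \<X>2 "\<lambda>X. 2 * card X - 3"] by simp
        then have "(\<Sum>X\<in>\<X>1 \<union> \<X>2. 2 * card X - 3) \<le> rk (erow p) F"
          using add X1(4) X2(4) by simp
        then show ?thesis using X1(1-3) X2(1-3) by (intro exI[of _ "\<X>1 \<union> \<X>2"]) auto
      qed
    qed (auto intro!: exI[of _ "{}"])
  qed
qed

section \<open>Density of generic points\<close>

lemma countable_polys:
  assumes "finite J"
  shows "countable {P :: ('i \<Rightarrow>\<^sub>0 nat) \<Rightarrow>\<^sub>0 rat. \<forall>m\<in>Poly_Mapping.keys P. Poly_Mapping.keys m \<subseteq> J}"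
proof -
  let ?M = "{m :: 'i \<Rightarrow>\<^sub>0 nat. Poly_Mapping.keys m \<subseteq> J}"
  let ?P = "{P :: ('i \<Rightarrow>\<^sub>0 nat) \<Rightarrow>\<^sub>0 rat. \<forall>m\<in>Poly_Mapping.keys P. Poly_Mapping.keys m \<subseteq> J}"
  obtain js where js: "set js = J" using finite_list[OF assms] by blast
  have "inj_on (\<lambda>m. map (Poly_Mapping.lookup m) js) ?M"
  proof (rule inj_onI)
    fix m m' assume m: "m \<in> ?M" "m' \<in> ?M" and eq: "map (Poly_Mapping.lookup m) js = map (Poly_Mapping.lookup m') js"
    show "m = m'"
    proof (rule poly_mapping_eqI)
      fix i
      show "Poly_Mapping.lookup m i = Poly_Mapping.lookup m' i"
      proof (cases "i \<in> J")
        case True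
        then show ?thesis using eq js by (simp add: map_eq_conv)
      next
        case False
        then have "i \<notin> Poly_Mapping.keys m" "i \<notin> Poly_Mapping.keys m'" using m by auto
        then show ?thesis by (simp add: in_keys_iff)
      qed
    qed
  qed
  then have M: "countable ?M"
    by (rule countableI')
  \<comment> \<open>A polynomial is determined by the finite set of its monomials paired with their
    coefficients.\<close>
  let ?g = "\<lambda>P :: ('i \<Rightarrow>\<^sub>0 nat) \<Rightarrow>\<^sub>0 rat. (\<lambda>m. (m, Poly_Mapping.lookup P m)) ` Poly_Mapping.keys P"
  have "inj_on ?g ?P"
  proof (rule inj_onI, rule poly_mapping_eqI)
    fix P Q :: "('i \<Rightarrow>\<^sub>0 nat) \<Rightarrow>\<^sub>0 rat" and m
    assume eq: "?g P = ?g Q"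
    show "Poly_Mapping.lookup P m = Poly_Mapping.lookup Q m"
    proof (cases "m \<in> Poly_Mapping.keys P")
      case True
      then have "(m, Poly_Mapping.lookup P m) \<in> ?g Q" using eq by blast
      then show ?thesis by auto
    next
      case False
      have "m \<notin> Poly_Mapping.keys Q"
      proof
        assume "m \<in> Poly_Mapping.keys Q"
        then have "(m, Poly_Mapping.lookup Q m) \<in> ?g P" using eq by blast
        then show False using False by auto
      qed
      with False show ?thesis by (simp add: in_keys_iff)
    qed
  qed
  moreover have "?g ` ?P \<subseteq> {A. finite A \<and> A \<subseteq> ?M \<times> (UNIV :: rat set)}" by auto
  moreover have "countable {A. finite A \<and> A \<subseteq> ?M \<times> (UNIV :: rat set)}"
    by (intro countable_Collect_finite_subset countable_SIGMA M countableI_type)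
  ultimately show ?thesis
    by (meson countable_subset countable_image_inj_on)
qed

text \<open>As a polynomial in the coordinate \<open>j\<close> alone, \<open>P\<close> has a nonzero
  coefficient polynomial \<open>R\<close> in the remaining variables, and by independence
  \<open>R\<close> does not vanish at \<open>x\<close>.\<close>

lemma mpoly_roots_finite:
  fixes x :: "'i \<Rightarrow> real"
  assumes indep: "alg_indep_over_rat I x" and "j \<notin> I"
    and P: "\<forall>m\<in>Poly_Mapping.keys P. Poly_Mapping.keys m \<subseteq> insert j I" "P \<noteq> 0"
  shows "finite {t. mpoly_eval P (x(j := t)) = 0}"
proof -
  let ?lk = "Poly_Mapping.lookup" and ?keys = "Poly_Mapping.keys"
  define a where "a m = of_rat (?lk P m) * (\<Prod>i\<in>?keys m - {j}. x i ^ ?lk m i)" for m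
  define Q where "Q = (\<Sum>m\<in>?keys P. monom (a m) (?lk m j))"
  have eval: "mpoly_eval P (x(j := t)) = poly Q t" for t
  proof -
    have "(\<Prod>i\<in>?keys m. (x(j := t)) i ^ ?lk m i) = (\<Prod>i\<in>?keys m - {j}. x i ^ ?lk m i) * t ^ ?lk m j" for m
    proof (cases "j \<in> ?keys m")
      case True
      then have "(\<Prod>i\<in>?keys m. (x(j := t)) i ^ ?lk m i) =
          (x(j := t)) j ^ ?lk m j * (\<Prod>i\<in>?keys m - {j}. (x(j := t)) i ^ ?lk m i)"
        by (intro prod.remove) auto
      also have "(\<Prod>i\<in>?keys m - {j}. (x(j := t)) i ^ ?lk m i) = (\<Prod>i\<in>?keys m - {j}. x i ^ ?lk m i)"
        by (rule prod.cong) auto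
      finally show ?thesis by simp
    next
      case False
      then have "?lk m j = 0" by (simp add: in_keys_iff)
      moreover have "(\<Prod>i\<in>?keys m. (x(j := t)) i ^ ?lk m i) = (\<Prod>i\<in>?keys m - {j}. x i ^ ?lk m i)"
        using False by (intro prod.cong) auto
      ultimately show ?thesis by simp
    qed
    then show ?thesis
      by (simp add: mpoly_eval_def Q_def poly_sum poly_monom a_def mult.assoc)
  qed
  obtain m0 where m0: "m0 \<in> ?keys P" using P(2) by (metis ex_in_conv keys_eq_empty)
  \<comment> \<open>Any power of the variable \<open>j\<close> occurring in \<open>P\<close> serves.
    \<open>h\<close> multiplies a monomial by this power, and \<open>R\<close> below is the
    coefficient of this power in \<open>P\<close>.\<close>
  define d where "d = ?lk m0 j"
  define h where "h m = (m :: 'i \<Rightarrow>\<^sub>0 nat) + Poly_Mapping.single j d" for m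
  have inj_h: "inj h" by (auto simp: h_def inj_def)
  have lkh: "?lk (h m) i = (if i = j then ?lk m j + d else ?lk m i)" for m i
    by (auto simp: h_def lookup_add lookup_single)
  have "finite {m. (if ?lk m j = 0 then ?lk P (h m) else 0) \<noteq> 0}"
    by (rule finite_subset[OF _ finite_vimageI[OF finite_keys inj_h]]) (auto simp: in_keys_iff split: if_splits)
  then have lkR: "?lk (Abs_poly_mapping (\<lambda>m. if ?lk m j = 0 then ?lk P (h m) else 0)) =
      (\<lambda>m. if ?lk m j = 0 then ?lk P (h m) else 0)"
    by (intro Abs_poly_mapping_inverse) simp
  define R where "R = Abs_poly_mapping (\<lambda>m. if ?lk m j = 0 then ?lk P (h m) else 0)"
  note lkR = lkR[folded R_def]
  have keysR: "?keys R = {m. ?lk m j = 0 \<and> h m \<in> ?keys P}"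
    unfolding set_eq_iff in_keys_iff lkR by simp
  have kh: "?keys (h m) - {j} = ?keys m" if "m \<in> ?keys R" for m
    using that by (auto simp: keysR in_keys_iff lkh split: if_splits)
  have surj: "\<exists>m'. ?lk m' j = 0 \<and> h m' = m" if "?lk m j = d" for m
  proof (intro exI conjI)
    show "?lk (m - Poly_Mapping.single j d) j = 0" using that by (simp add: lookup_minus)
    show "h (m - Poly_Mapping.single j d) = m"
      by (rule poly_mapping_eqI) (use that in \<open>auto simp: lkh lookup_minus lookup_single\<close>)
  qed
  have "Q \<noteq> 0"
  proof
    assume "Q = 0"
    then have "0 = coeff Q d" by simp
    also have "\<dots> = (\<Sum>m\<in>?keys P. if ?lk m j = d then a m else 0)"
      unfolding Q_def coeff_sum by (intro sum.cong) auto
    also have "\<dots> = (\<Sum>m\<in>{m \<in> ?keys P. ?lk m j = d}. a m)"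
      by (simp add: sum.inter_filter)
    also have "\<dots> = (\<Sum>m\<in>?keys R. a (h m))"
    proof (rule sum.reindex_cong[of h])
      show "inj_on h (?keys R)" using inj_h by (rule inj_on_subset) simp
      show "{m \<in> ?keys P. ?lk m j = d} = h ` ?keys R"
      proof
        show "h ` ?keys R \<subseteq> {m \<in> ?keys P. ?lk m j = d}" by (auto simp: keysR lkh)
        show "{m \<in> ?keys P. ?lk m j = d} \<subseteq> h ` ?keys R"
        proof
          fix m assume m: "m \<in> {m \<in> ?keys P. ?lk m j = d}"
          then obtain m' where m': "?lk m' j = 0" "h m' = m" using surj by blast
          then have "m' \<in> ?keys R" using m by (simp add: keysR)
          then show "m \<in> h ` ?keys R" using m'(2) by blast
        qed
      qed
    qed simp
    also have "\<dots> = mpoly_eval R x"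
      unfolding mpoly_eval_def
    proof (rule sum.cong[OF refl])
      fix m assume m: "m \<in> ?keys R"
      have "(\<Prod>i\<in>?keys (h m) - {j}. x i ^ ?lk (h m) i) = (\<Prod>i\<in>?keys m. x i ^ ?lk m i)"
        unfolding kh[OF m] by (rule prod.cong) (use m in \<open>auto simp: lkh keysR in_keys_iff\<close>)
      then show "a (h m) = of_rat (?lk R m) * (\<Prod>i\<in>?keys m. x i ^ ?lk m i)"
        using m by (simp add: a_def lkR keysR)
    qed
    finally have "mpoly_eval R x = 0" by simp
    moreover have "\<forall>m\<in>?keys R. ?keys m \<subseteq> I"
    proof
      fix m assume m: "m \<in> ?keys R"
      have "?keys (h m) \<subseteq> insert j I" using m P(1) by (simp add: keysR)
      then show "?keys m \<subseteq> I" unfolding kh[OF m, symmetric] by blast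
    qed
    ultimately have "R = 0" using indep unfolding alg_indep_over_rat_def by simp
    then have "?keys R = {}" by simp
    moreover obtain m' where "?lk m' j = 0" "h m' = m0" using surj[of m0] by (auto simp: d_def)
    then have "m' \<in> ?keys R" using m0 by (simp add: keysR)
    ultimately show False by simp
  qed
  then show ?thesis unfolding eval by (rule poly_roots_finite)
qed

text \<open>One coordinate at a time: there are countably many polynomials, each with finitely many
  roots, and an open interval is uncountable.\<close>

lemma generic_points_dense:
  fixes x0 :: "'i \<Rightarrow> real"
  assumes "finite I" "\<eta> > 0"
  shows "\<exists>x. alg_indep_over_rat I x \<and> (\<forall>i\<in>I. \<bar>x i - x0 i\<bar> < \<eta>)"
  using assms(1)
proof (induction I rule: finite_induct)
  case empty
  have "P = 0" if P: "\<forall>m\<in>Poly_Mapping.keys P. Poly_Mapping.keys m \<subseteq> {}" "mpoly_eval P x = 0"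
    for P :: "('i \<Rightarrow>\<^sub>0 nat) \<Rightarrow>\<^sub>0 rat" and x
  proof (rule ccontr)
    assume "P \<noteq> 0"
    moreover have "m = 0" if "m \<in> Poly_Mapping.keys P" for m
      using P(1) that by (metis bot.extremum_uniqueI keys_eq_empty)
    ultimately have k: "Poly_Mapping.keys P = {0}"
      by (metis (no_types, lifting) all_not_in_conv keys_eq_empty subsetI subset_singletonD singletonI)
    then have "mpoly_eval P x = of_rat (Poly_Mapping.lookup P 0)" by (simp add: mpoly_eval_def)
    then show False using P(2) k by (metis in_keys_iff insertI1 of_rat_eq_0_iff)
  qed
  then show ?case unfolding alg_indep_over_rat_def by auto
next
  case (insert j I)
  then obtain x where x: "alg_indep_over_rat I x" "\<forall>i\<in>I. \<bar>x i - x0 i\<bar> < \<eta>" by blast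
  let ?P = "{P :: ('i \<Rightarrow>\<^sub>0 nat) \<Rightarrow>\<^sub>0 rat. (\<forall>m\<in>Poly_Mapping.keys P. Poly_Mapping.keys m \<subseteq> insert j I)} - {0}"
  let ?bad = "\<Union>P\<in>?P. {t. mpoly_eval P (x(j := t)) = 0}"
  have "countable ?bad"
  proof (rule countable_UN)
    show "countable ?P" using countable_polys[of "insert j I"] insert.hyps by simp
    show "countable {t. mpoly_eval P (x(j := t)) = 0}" if "P \<in> ?P" for P
      using mpoly_roots_finite[OF x(1) insert.hyps(2), of P] that by (intro countable_finite) auto
  qed
  moreover have "uncountable {x0 j - \<eta> <..< x0 j + \<eta>}"
    using assms(2) by (simp add: uncountable_open_interval)
  ultimately obtain t where t: "t \<in> {x0 j - \<eta> <..< x0 j + \<eta>}" "t \<notin> ?bad"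
    by (meson countable_subset subsetI)
  have "alg_indep_over_rat (insert j I) (x(j := t))"
    unfolding alg_indep_over_rat_def using t(2) by blast
  moreover have "\<forall>i\<in>insert j I. \<bar>(x(j := t)) i - x0 i\<bar> < \<eta>"
    using t(1) x(2) insert.hyps(2) by (auto simp: abs_less_iff)
  ultimately show ?case by blast
qed

section \<open>Rigid subgraphs and spanning trees from full rank\<close>

text \<open>Twice the graphic rank is at most \<open>2 * (card V - 1)\<close> and exceeds the
  rigidity rank as soon as some edge has distinct end points; otherwise all rows are zero.\<close>

lemma rigidity_rank_le:
  assumes "finite V" "F \<subseteq> edge_set V" "2 \<le> card V"
  shows "rk (erow m) F \<le> 2 * card V - 3"
proof (cases "\<exists>u v. {u, v} \<in> F \<and> m u \<noteq> m v")
  case True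
  then obtain u v where uv: "{u, v} \<in> F" "m u \<noteq> m v" by blast
  obtain f :: "'a \<Rightarrow> real" where f: "inj_on f V" using ex_inj_real[OF assms(1)] .
  have "V \<noteq> {}" using assms(3) by auto
  then show ?thesis
    using two_mult_graphic_rank_ge[OF assms(1,2) f uv] graphic_rank_less[OF assms(1) _ assms(2), of f] by linarith
next
  case False
  have "erow m e = 0" if "e \<in> F" for e
  proof -
    have "e \<in> edge_set V" using that assms(2) by blast
    then obtain u v where e: "e = {u, v}" "u \<noteq> v" by (rule edge_setE)
    then have "m u = m v" using False that by blast
    then show ?thesis using e by (auto simp: erow_pair fun_eq_iff)
  qed
  then have "rk (erow m) F \<le> dim ({} :: ('a \<Rightarrow> complex) set)"
    by (intro dim_finite_mono) auto
  then show ?thesis by (simp add: dim_empty)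
qed

lemma full_rank_spans:
  assumes "finite V" "F \<subseteq> edge_set V" "2 \<le> card V" "rk (erow m) F = 2 * card V - 3" "e \<in> edge_set V"
  shows "erow m e \<in> span (erow m ` F)"
proof (rule ccontr)
  assume "erow m e \<notin> span (erow m ` F)"
  moreover have "finite F" using finite_subset[OF assms(2) finite_edge_set[OF assms(1)]] .
  ultimately have "rk (erow m) (insert e F) = Suc (rk (erow m) F)"
    by (simp add: rk_insert del: image_insert)
  then show False
    using rigidity_rank_le[OF assms(1) _ assms(3), of "insert e F" m] assms(2,4,5) by simp
qed

definition to_complex :: "real ^ 2 \<Rightarrow> complex" where
  "to_complex x = Complex (vec_nth x 1) (vec_nth x 2)"

lemma norm_to_complex_diff: "norm (to_complex x - to_complex y) = dist x y"
  by (simp add: to_complex_def dist_vec_def L2_set_def sum_2 cmod_def dist_real_def)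

text \<open>If \<open>q\<close> has the same edge lengths as \<open>p\<close>, then \<open>q - p\<close> is an infinitesimal motion of the
  midpoint placement, which still has full rank.\<close>

lemma rigid_of_full_rank:
  assumes fin: "finite V" and F: "F \<subseteq> edge_set V" and V2: "2 \<le> card V"
    and rank: "rk (erow z) F = 2 * card V - 3"
  shows "rigid \<lparr>verts = V, edges = F\<rparr>"
proof -
  obtain \<eta> where \<eta>: "\<eta> > 0" "\<And>z' F. \<forall>v\<in>V. norm (z' v - z v) < \<eta> \<Longrightarrow> F \<subseteq> edge_set V \<Longrightarrow>
      rk (erow z) F \<le> rk (erow z') F"
    using rank_lower_semicontinuous[OF fin, of z] by blast
  define x0 where "x0 = (\<lambda>(v, i :: 2). if i = 1 then Re (z v) else Im (z v))"
  \<comment> \<open>Two coordinates within \<open>\<eta> / 4\<close> put \<open>p\<close> within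
    \<open>\<eta> / 2\<close> of \<open>z\<close>; the midpoint of \<open>p\<close> and a placement
    within \<open>\<eta> / 4\<close> of it then stays within \<open>\<eta>\<close> of
    \<open>z\<close>.\<close>
  have "\<exists>x. alg_indep_over_rat (V \<times> (UNIV :: 2 set)) x \<and> (\<forall>i\<in>V \<times> UNIV. \<bar>x i - x0 i\<bar> < \<eta> / 4)"
    using fin \<eta>(1) by (intro generic_points_dense) auto
  then obtain x where x: "alg_indep_over_rat (V \<times> (UNIV :: 2 set)) x"
    "\<forall>i\<in>V \<times> UNIV. \<bar>x i - x0 i\<bar> < \<eta> / 4" by blast
  define p where "p v = (\<chi> i. x (v, i))" for v
  have "(\<lambda>(v, i). vec_nth (p v) i) = x" by (auto simp: p_def)
  then have gen: "generic_placement \<lparr>verts = V, edges = F\<rparr> p"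
    using x(1) by (simp add: generic_placement_def)
  have near: "norm (to_complex (p v) - z v) < \<eta> / 2" if "v \<in> V" for v
  proof -
    have "norm (to_complex (p v) - z v) \<le> \<bar>Re (to_complex (p v) - z v)\<bar> + \<bar>Im (to_complex (p v) - z v)\<bar>"
      by (rule cmod_le)
    also have "\<dots> = \<bar>x (v, 1) - x0 (v, 1)\<bar> + \<bar>x (v, 2) - x0 (v, 2)\<bar>"
      by (simp add: to_complex_def p_def x0_def)
    also have "\<dots> < \<eta> / 2"
      using x(2)[rule_format, of "(v, 1)"] x(2)[rule_format, of "(v, 2)"] that by simp
    finally show ?thesis .
  qed
  have "rigid_framework \<lparr>verts = V, edges = F\<rparr> p"
    unfolding rigid_framework_def
  proof (intro exI conjI allI impI)
    show "\<eta> / 4 > 0" using \<eta>(1) by simp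
    fix q assume q: "(\<forall>v\<in>verts \<lparr>verts = V, edges = F\<rparr>. dist (p v) (q v) < \<eta> / 4) \<and>
      equivalent_placements \<lparr>verts = V, edges = F\<rparr> p q"
    define P Q where "P v = to_complex (p v)" and "Q v = to_complex (q v)" for v
    define m where "m v = (P v + Q v) / 2" for v
    define d where "d = (\<lambda>v. Q v - P v)"
    have PQ: "norm (P v - Q v) < \<eta> / 4" if "v \<in> V" for v
      using q that by (simp add: P_def Q_def norm_to_complex_diff)
    have "\<forall>v\<in>V. norm (m v - z v) < \<eta>"
    proof
      fix v assume v: "v \<in> V"
      have "m v - z v = (P v - z v) - (P v - Q v) / 2" by (simp add: m_def field_simps)
      then have "norm (m v - z v) \<le> norm (P v - z v) + norm ((P v - Q v) / 2)"
        by (metis norm_triangle_ineq4)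
      then show "norm (m v - z v) < \<eta>"
        using near[OF v] PQ[OF v] \<eta>(1) unfolding P_def[symmetric] by (simp add: norm_divide)
    qed
    then have "rk (erow m) F = 2 * card V - 3"
      using \<eta>(2)[of m F] rank rigidity_rank_le[OF fin F V2, of m] F by simp
    note span = full_rank_spans[OF fin F V2 this]
    \<comment> \<open>A row at the midpoint applied to \<open>d\<close> is half the change of the
      squared length, with no remainder term; this is the reason for passing to the
      midpoint.\<close>
    have half: "inner ((a + b) / 2) (b - a) = ((norm b)\<^sup>2 - (norm a)\<^sup>2) / 2" for a b :: complex
      unfolding cmod_power2 by (simp add: inner_complex_def power2_eq_square field_simps)
    have ipm: "ip V (erow m {u, v}) d = ((norm (Q u - Q v))\<^sup>2 - (norm (P u - P v))\<^sup>2) / 2"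
      if "u \<in> V" "v \<in> V" "u \<noteq> v" for u v
    proof -
      have "m u - m v = ((P u - P v) + (Q u - Q v)) / 2" "d u - d v = (Q u - Q v) - (P u - P v)"
        by (simp_all add: m_def d_def field_simps)
      then show ?thesis
        using ip_erow[OF fin that, of m d] by (simp only: half)
    qed
    have "ip V (erow m e) d = 0" if "e \<in> F" for e
    proof -
      have "e \<in> edge_set V" using that F by blast
      then obtain u v where e: "e = {u, v}" "u \<noteq> v" "u \<in> V" "v \<in> V" by (rule edge_setE)
      have "dist (p u) (p v) = dist (q u) (q v)"
        using q that e(1) by (simp add: equivalent_placements_def)
      then show ?thesis
        unfolding e(1) ipm[OF e(3,4,2)] by (simp add: P_def Q_def norm_to_complex_diff)
    qed
    then have all: "ip V (erow m e) d = 0" if "e \<in> edge_set V" for e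
      using linear_eq_0_on_span[OF linear_ip _ span[OF that], of V d] by auto
    show "congruent_placements \<lparr>verts = V, edges = F\<rparr> p q"
      unfolding congruent_placements_def
    proof (intro ballI)
      fix u v assume "u \<in> verts \<lparr>verts = V, edges = F\<rparr>" "v \<in> verts \<lparr>verts = V, edges = F\<rparr>"
      then have uv: "u \<in> V" "v \<in> V" by auto
      show "dist (p u) (p v) = dist (q u) (q v)"
      proof (cases "u = v")
        case False
        then have "{u, v} \<in> edge_set V" using uv by (simp add: edge_set_def)
        then have "(norm (Q u - Q v))\<^sup>2 = (norm (P u - P v))\<^sup>2"
          using all[of "{u, v}"] ipm[OF uv False] by simp
        then show ?thesis by (simp add: P_def Q_def norm_to_complex_diff)
      qed simp
    qed
  qed
  with gen show ?thesis unfolding rigid_def by blast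
qed

text \<open>A maximal independent set of rows of \<open>F\<close> spans the rows of all pairs. Were
  it disconnected, the indicator of a component would annihilate its rows but not that of a pair
  across; a cycle would make the row of its closing edge depend on the others.\<close>

lemma spanning_tree_of_full_rank:
  assumes fin: "finite V" and F: "F \<subseteq> edge_set V" and inj: "inj_on f V"
    and rank: "Suc (rk (erow (real_placement f)) F) = card V"
  shows "\<exists>T\<subseteq>F. is_tree \<lparr>verts = V, edges = T\<rparr>"
proof -
  let ?g = "erow (real_placement f)"
  have finF: "finite F" using finite_subset[OF F finite_edge_set[OF fin]] .
  obtain T where T: "T \<subseteq> F" "lin_indep ?g T" "card T = rk ?g F"
    using ex_lin_indep[OF finF] by blast
  have finT: "finite T" using T(1) finF finite_subset by blast
  have TV: "T \<subseteq> edge_set V" using T(1) F by blast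
  have injT: "inj_on ?g T" "independent (?g ` T)" using T(2) finT by (auto simp: lin_indep_iff)
  have V: "V \<noteq> {}" using rank by auto
  have rkT: "Suc (rk ?g T) = card V"
    using injT T(3) rank by (simp add: dim_eq_card_independent card_image)
  have sp: "?g e \<in> span (?g ` T)" if "e \<in> edge_set V" for e
  proof (rule ccontr)
    assume "?g e \<notin> span (?g ` T)"
    then have "rk ?g (insert e T) = Suc (rk ?g T)"
      using finT by (simp add: rk_insert del: image_insert)
    then show False using graphic_rank_less[OF fin V, of "insert e T" f] that TV rkT by simp
  qed
  have "connected_graph \<lparr>verts = V, edges = T\<rparr>"
    unfolding connected_graph_def
  proof (intro conjI ballI)
    show "verts \<lparr>verts = V, edges = T\<rparr> \<noteq> {}" using V by simp
    fix u v assume "u \<in> verts \<lparr>verts = V, edges = T\<rparr>" "v \<in> verts \<lparr>verts = V, edges = T\<rparr>"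
    then have uv: "u \<in> V" "v \<in> V" by auto
    let ?R = "{(x, y). {x, y} \<in> edges \<lparr>verts = V, edges = T\<rparr>}"
    show "(u, v) \<in> ?R\<^sup>*"
    proof (rule ccontr)
      assume nuv: "(u, v) \<notin> ?R\<^sup>*"
      then have ne: "u \<noteq> v" by auto
      let ?d = "\<lambda>w. if (u, w) \<in> ?R\<^sup>* then 1 else (0::complex)"
      have "ip V x ?d = 0" if xT: "x \<in> ?g ` T" for x
      proof -
        obtain e where e: "e \<in> T" "x = ?g e" using xT by blast
        then have "e \<in> edge_set V" using TV by blast
        then obtain a b where ab: "e = {a, b}" "a \<noteq> b" "a \<in> V" "b \<in> V" by (rule edge_setE)
        have "(a, b) \<in> ?R" "(b, a) \<in> ?R" using e ab by (auto simp: insert_commute)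
        then have "(u, a) \<in> ?R\<^sup>* \<longleftrightarrow> (u, b) \<in> ?R\<^sup>*" by (meson rtrancl.rtrancl_into_rtrancl)
        then have "?d a - ?d b = 0" by simp
        then show ?thesis unfolding e(2) ab(1) ip_erow[OF fin ab(3,4,2)] by (simp only: inner_zero_right)
      qed
      moreover have "?g {u, v} \<in> span (?g ` T)"
        using uv ne by (intro sp) (auto simp: edge_set_def)
      ultimately have "ip V (?g {u, v}) ?d = 0"
        using linear_eq_0_on_span[OF linear_ip] by blast
      moreover have "ip V (?g {u, v}) ?d = f u - f v"
        unfolding ip_erow[OF fin uv ne] using nuv by (simp add: real_placement_def inner_complex_def)
      ultimately show False using inj uv ne by (auto simp: inj_on_def)
    qed
  qed
  moreover have "\<not> is_cycle \<lparr>verts = V, edges = T\<rparr> vs" for vs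
  proof
    assume cyc: "is_cycle \<lparr>verts = V, edges = T\<rparr> vs"
    define m where "m = length vs"
    have m: "m \<ge> 3" "distinct vs" "set vs \<subseteq> V" "\<And>i. i < m \<Longrightarrow> {vs ! i, vs ! (Suc i mod m)} \<in> T"
      using cyc by (auto simp: is_cycle_def m_def)
    define e where "e = {vs ! (m - 1), vs ! 0}"
    have eT: "e \<in> T" using m(4)[of "m - 1"] m(1) by (simp add: e_def)
    define \<delta> where "\<delta> a w = (if w = a then 1 else (0::complex))" for a w :: 'a
    have row: "?g {a, b} = (f a - f b) *\<^sub>R (\<delta> a - \<delta> b)" if "a \<noteq> b" for a b
      using that by (auto simp: erow_pair fun_eq_iff \<delta>_def real_placement_def scaleR_conv_of_real)
    have fne: "f a - f b \<noteq> 0" if "a \<in> V" "b \<in> V" "a \<noteq> b" for a b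
      using inj that by (auto simp: inj_on_def)
    \<comment> \<open>Up to a scalar, a row is a difference of two unit vectors. Telescoping along
      the cycle reaches every vertex without the closing edge \<open>e\<close>.\<close>
    have "\<delta> (vs ! 0) - \<delta> (vs ! j) \<in> span (?g ` (T - {e}))" if "j < m" for j
      using that
    proof (induction j)
      case 0
      show ?case unfolding diff_self by (rule span_zero)
    next
      case (Suc j)
      let ?a = "vs ! j" and ?b = "vs ! Suc j"
      have ab: "?a \<in> V" "?b \<in> V" "?a \<noteq> ?b"
        using Suc.prems m(2,3) nth_mem[of j vs] nth_mem[of "Suc j" vs]
        by (auto simp: m_def nth_eq_iff_index_eq)
      have T: "{?a, ?b} \<in> T" using m(4)[of j] Suc.prems by simp
      have len: "0 < length vs" "j < length vs" "Suc j < length vs" "m - 1 < length vs"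
        using Suc.prems m(1) unfolding m_def by linarith+
      note idx = nth_eq_iff_index_eq[OF m(2) len(2,1)] nth_eq_iff_index_eq[OF m(2) len(2,4)]
        nth_eq_iff_index_eq[OF m(2) len(3,4)]
      have "?a \<noteq> vs ! (m - 1)" using Suc.prems unfolding idx by simp
      \<comment> \<open>Here the length of at least three is used: the first edge of the cycle is
        not its closing edge.\<close>
      moreover have "\<not> (?a = vs ! 0 \<and> ?b = vs ! (m - 1))" using m(1) unfolding idx by linarith
      ultimately have "{?a, ?b} \<noteq> e" unfolding e_def doubleton_eq_iff by blast
      then have "?g {?a, ?b} \<in> span (?g ` (T - {e}))"
        using T by (intro span_base) auto
      then have "(1 / (f ?a - f ?b)) *\<^sub>R ?g {?a, ?b} \<in> span (?g ` (T - {e}))"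
        by (rule span_scale)
      then have "\<delta> ?a - \<delta> ?b \<in> span (?g ` (T - {e}))"
        using fne[OF ab] by (simp add: row[OF ab(3)])
      moreover have "\<delta> (vs ! 0) - \<delta> ?a \<in> span (?g ` (T - {e}))"
        by (rule Suc.IH) (use Suc.prems in simp)
      moreover have "\<delta> (vs ! 0) - \<delta> ?b = (\<delta> (vs ! 0) - \<delta> ?a) + (\<delta> ?a - \<delta> ?b)"
        by (rule ext) simp
      ultimately show ?case by (metis span_add)
    qed
    from this[of "m - 1"] have *: "\<delta> (vs ! 0) - \<delta> (vs ! (m - 1)) \<in> span (?g ` (T - {e}))"
      using m(1) by linarith
    have ne: "vs ! (m - 1) \<noteq> vs ! 0"
      using m(1) nth_eq_iff_index_eq[OF m(2), of "m - 1" 0] unfolding m_def by linarith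
    have "?g e = (f (vs ! 0) - f (vs ! (m - 1))) *\<^sub>R (\<delta> (vs ! 0) - \<delta> (vs ! (m - 1)))"
      unfolding e_def using row[of "vs ! 0" "vs ! (m - 1)"] ne by (simp add: insert_commute)
    then have "?g e \<in> span (?g ` (T - {e}))"
      using span_scale[OF *] by simp
    also have "?g ` (T - {e}) = ?g ` T - {?g e}"
      using injT(1) eT by (auto simp: inj_on_def)
    finally have "dependent (?g ` T)"
      using eT unfolding dependent_def by blast
    then show False using injT(2) by simp
  qed
  ultimately show ?thesis using T(1) unfolding is_tree_def by blast
qed

section \<open>The largest eigenvalue as a Rayleigh quotient\<close>

definition qform :: "'a set \<Rightarrow> ('a \<Rightarrow> 'a \<Rightarrow> real) \<Rightarrow> ('a \<Rightarrow> real) \<Rightarrow> real" where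
  "qform V a x = (\<Sum>v\<in>V. \<Sum>u\<in>V. a v u * x u * x v)"

definition nsq :: "'a set \<Rightarrow> ('a \<Rightarrow> real) \<Rightarrow> real" where
  "nsq V x = (\<Sum>v\<in>V. (x v)\<^sup>2)"

lemma nsq_nonneg: "nsq V x \<ge> 0"
  by (simp add: nsq_def sum_nonneg)

lemma nsq_eq_0_iff: "finite V \<Longrightarrow> nsq V x = 0 \<longleftrightarrow> (\<forall>v\<in>V. x v = 0)"
  by (simp add: nsq_def sum_nonneg_eq_0_iff)

lemma qform_cong: "(\<And>v. v \<in> V \<Longrightarrow> x v = y v) \<Longrightarrow> qform V a x = qform V a y"
  by (simp add: qform_def cong: sum.cong)

lemma nsq_cong: "(\<And>v. v \<in> V \<Longrightarrow> x v = y v) \<Longrightarrow> nsq V x = nsq V y"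
  by (simp add: nsq_def cong: sum.cong)

lemma qform_scale: "qform V a (\<lambda>v. c * x v) = c\<^sup>2 * qform V a x"
  unfolding qform_def sum_distrib_left by (intro sum.cong refl) (simp add: power2_eq_square)

lemma nsq_scale: "nsq V (\<lambda>v. c * x v) = c\<^sup>2 * nsq V x"
  unfolding nsq_def sum_distrib_left by (intro sum.cong refl) (simp add: power_mult_distrib)

lemma qform_eigen:
  assumes "\<And>v. v \<in> V \<Longrightarrow> (\<Sum>u\<in>V. a v u * x u) = c * x v"
  shows "qform V a x = c * nsq V x"
proof -
  have "qform V a x = (\<Sum>v\<in>V. (\<Sum>u\<in>V. a v u * x u) * x v)"
    by (simp add: qform_def sum_distrib_right)
  also have "\<dots> = c * nsq V x"
    unfolding nsq_def sum_distrib_left using assms by (intro sum.cong refl) (simp add: power2_eq_square)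
  finally show ?thesis .
qed

lemma qform_add:
  assumes sym: "\<And>u v. u \<in> V \<Longrightarrow> v \<in> V \<Longrightarrow> a u v = a v u"
  shows "qform V a (\<lambda>v. y v + t * d v) =
    qform V a y + 2 * t * (\<Sum>v\<in>V. d v * (\<Sum>u\<in>V. a v u * y u)) + t\<^sup>2 * qform V a d"
proof -
  have "qform V a (\<lambda>v. y v + t * d v) = (\<Sum>v\<in>V. \<Sum>u\<in>V. a v u * y u * y v
      + t * (a v u * y u * d v) + t * (a v u * d u * y v) + t\<^sup>2 * (a v u * d u * d v))"
    unfolding qform_def by (intro sum.cong refl) (simp add: algebra_simps power2_eq_square)
  also have "\<dots> = qform V a y + t * (\<Sum>v\<in>V. \<Sum>u\<in>V. a v u * y u * d v)
      + t * (\<Sum>v\<in>V. \<Sum>u\<in>V. a v u * d u * y v) + t\<^sup>2 * qform V a d"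
    by (simp add: sum.distrib sum_distrib_left qform_def)
  also have "(\<Sum>v\<in>V. \<Sum>u\<in>V. a v u * d u * y v) = (\<Sum>v\<in>V. \<Sum>u\<in>V. a v u * y u * d v)"
    by (subst sum.swap) (intro sum.cong refl, simp add: sym)
  also have "(\<Sum>v\<in>V. \<Sum>u\<in>V. a v u * y u * d v) = (\<Sum>v\<in>V. d v * (\<Sum>u\<in>V. a v u * y u))"
    by (simp add: sum_distrib_left mult_ac)
  finally show ?thesis by (simp add: algebra_simps)
qed

lemma nsq_add:
  "nsq V (\<lambda>v. y v + t * d v) = nsq V y + 2 * t * (\<Sum>v\<in>V. d v * y v) + t\<^sup>2 * nsq V d"
proof -
  have "nsq V (\<lambda>v. y v + t * d v) = (\<Sum>v\<in>V. (y v)\<^sup>2 + (2 * t) * (d v * y v) + t\<^sup>2 * (d v)\<^sup>2)"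
    unfolding nsq_def by (intro sum.cong refl) (simp add: algebra_simps power2_eq_square)
  then show ?thesis by (simp add: nsq_def sum.distrib sum_distrib_left)
qed

text \<open>The functions supported on \<open>V\<close> with entries in \<open>[-1, 1]\<close> form
  a product of compact sets, compact for pointwise convergence, so the form attains its maximum on
  the unit sphere; scaling gives the bound elsewhere.\<close>

lemma ex_rayleigh_max:
  assumes "finite V" "V \<noteq> {}"
  shows "\<exists>y. nsq V y = 1 \<and> (\<forall>z. qform V a z \<le> qform V a y * nsq V z)"
proof -
  define K where "K = Pi\<^sub>E UNIV (\<lambda>v. if v \<in> V then {-1..1} else {0::real})"
  let ?S = "K \<inter> {x. nsq V x = 1}"
  have "compactin (product_topology (\<lambda>_. euclidean) UNIV) K"
    unfolding K_def compactin_PiE by (auto simp: compactin_euclidean_iff)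
  then have "compact K" by (simp add: euclidean_product_topology compactin_euclidean_iff)
  moreover have contN: "continuous_on UNIV (nsq V)"
    unfolding nsq_def by (intro continuous_intros continuous_on_product_coordinates)
  have "closed {x. nsq V x = 1}"
    by (intro closed_Collect_eq contN continuous_on_const)
  ultimately have comp: "compact ?S" by (rule compact_Int_closed)
  have contQ: "continuous_on ?S (qform V a)"
    unfolding qform_def
    by (rule continuous_on_subset[OF _ subset_UNIV])
       (intro continuous_intros continuous_on_product_coordinates)
  obtain v0 where v0: "v0 \<in> V" using assms(2) by blast
  have inS: "(\<lambda>v. if v \<in> V then x v else 0) \<in> ?S" if "nsq V x = 1" for x
  proof -
    have "\<bar>x v\<bar> \<le> 1" if v: "v \<in> V" for v
    proof -
      have "(x v)\<^sup>2 \<le> nsq V x"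
        unfolding nsq_def using assms(1) v by (intro member_le_sum) auto
      then show ?thesis using \<open>nsq V x = 1\<close> by (simp add: abs_square_le_1)
    qed
    then have "(\<lambda>v. if v \<in> V then x v else 0) \<in> K"
      by (auto simp: K_def abs_le_iff minus_le_iff)
    moreover have "nsq V (\<lambda>v. if v \<in> V then x v else 0) = nsq V x" by (rule nsq_cong) simp
    ultimately show ?thesis using that by simp
  qed
  have "nsq V (\<lambda>v. if v = v0 then 1 else 0) = 1"
    using v0 assms(1) by (simp add: nsq_def power2_eq_square if_distrib[of "\<lambda>x. x * _"] cong: if_cong)
  from inS[OF this] have "?S \<noteq> {}" by blast
  from continuous_attains_sup[OF comp this contQ]
  obtain y where y: "y \<in> ?S" "\<And>x. x \<in> ?S \<Longrightarrow> qform V a x \<le> qform V a y" by blast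
  have "qform V a z \<le> qform V a y * nsq V z" for z
  proof (cases "nsq V z = 0")
    case True
    then have "\<forall>v\<in>V. z v = 0" using assms(1) by (simp add: nsq_eq_0_iff)
    then have "qform V a z = 0" by (simp add: qform_def)
    then show ?thesis using True by simp
  next
    case False
    then have pos: "nsq V z > 0" using nsq_nonneg[of V z] by simp
    define c where "c = 1 / sqrt (nsq V z)"
    have c2: "c\<^sup>2 * nsq V z = 1" using pos by (simp add: c_def power_divide)
    then have "nsq V (\<lambda>v. c * z v) = 1" by (simp add: nsq_scale)
    from y(2)[OF inS[OF this]] have "qform V a (\<lambda>v. c * z v) \<le> qform V a y"
      using qform_cong[of V "\<lambda>v. if v \<in> V then c * z v else 0" "\<lambda>v. c * z v" a] by simp
    then have "c\<^sup>2 * qform V a z * nsq V z \<le> qform V a y * nsq V z"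
      using pos by (intro mult_right_mono) (auto simp: qform_scale)
    moreover have "c\<^sup>2 * qform V a z * nsq V z = qform V a z"
      using c2 by (metis mult.assoc mult.commute mult.right_neutral)
    ultimately show ?thesis by simp
  qed
  then show ?thesis using y(1) by blast
qed

text \<open>Moving \<open>y\<close> along the residual \<open>d\<close> changes
  \<open>qform - c * nsq\<close> by \<open>2 * t * nsq V d\<close> to first order. Its maximum
  \<open>0\<close> is attained at \<open>y\<close>, so the residual vanishes.\<close>

lemma rayleigh_max_eigen:
  assumes fin: "finite V" and sym: "\<And>u v. u \<in> V \<Longrightarrow> v \<in> V \<Longrightarrow> a u v = a v u"
    and max: "\<And>z. qform V a z \<le> c * nsq V z" and y: "qform V a y = c * nsq V y"
    and v: "v \<in> V"
  shows "(\<Sum>u\<in>V. a v u * y u) = c * y v"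
proof -
  define d where "d v = (\<Sum>u\<in>V. a v u * y u) - c * y v" for v
  define C where "C = qform V a d - c * nsq V d"
  have "2 * t * nsq V d + t\<^sup>2 * C \<le> 0" for t
  proof -
    have sq: "(d v)\<^sup>2 = d v * (\<Sum>u\<in>V. a v u * y u) - c * (d v * y v)" for v
    proof -
      have "(d v)\<^sup>2 = d v * ((\<Sum>u\<in>V. a v u * y u) - c * y v)" by (simp only: d_def power2_eq_square)
      then show ?thesis by (simp only: right_diff_distrib mult.left_commute)
    qed
    define p r where "p = (\<Sum>v\<in>V. d v * (\<Sum>u\<in>V. a v u * y u))" and "r = (\<Sum>v\<in>V. d v * y v)"
    have "nsq V d = p - c * r"
      by (simp only: nsq_def sq sum_subtractf sum_distrib_left[of c] p_def r_def)
    moreover have "qform V a (\<lambda>v. y v + t * d v) = qform V a y + 2 * t * p + t\<^sup>2 * qform V a d"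
      unfolding p_def using sym by (rule qform_add)
    then have "qform V a (\<lambda>v. y v + t * d v) - c * nsq V (\<lambda>v. y v + t * d v) = 2 * t * (p - c * r) + t\<^sup>2 * C"
      unfolding nsq_add C_def r_def[symmetric] y by (simp add: algebra_simps)
    ultimately have "2 * t * nsq V d + t\<^sup>2 * C =
        qform V a (\<lambda>v. y v + t * d v) - c * nsq V (\<lambda>v. y v + t * d v)" by simp
    then show ?thesis using max[of "\<lambda>v. y v + t * d v"] by simp
  qed
  note le = this
  have "nsq V d = 0"
  proof (rule ccontr)
    assume "nsq V d \<noteq> 0"
    then have D: "nsq V d > 0" using nsq_nonneg[of V d] by simp
    \<comment> \<open>Small enough for the linear term to dominate:
      \<open>\<bar>t * C\<bar> \<le> nsq V d\<close>.\<close>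
    define t where "t = nsq V d / (\<bar>C\<bar> + 1)"
    have t: "t > 0" using D by (simp add: t_def add_nonneg_pos)
    have "t * (2 * nsq V d + t * C) \<le> 0" using le[of t] by (simp add: power2_eq_square algebra_simps)
    then have "2 * nsq V d + t * C \<le> 0" using t by (simp add: mult_le_0_iff)
    moreover have "\<bar>t * C\<bar> \<le> nsq V d"
    proof -
      have "\<bar>t * C\<bar> \<le> t * (\<bar>C\<bar> + 1)" using t by (simp add: abs_mult)
      then show ?thesis by (simp add: t_def add_nonneg_eq_0_iff)
    qed
    ultimately show False using D by linarith
  qed
  then show ?thesis using v fin by (simp add: nsq_eq_0_iff d_def)
qed

section \<open>Perron vectors and bounds for the spectral radius\<close>

definition adj :: "'a sgraph \<Rightarrow> 'a \<Rightarrow> 'a \<Rightarrow> real" where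
  "adj G u v = (if {u, v} \<in> edges G then 1 else 0)"

lemma adj_sym: "adj G u v = adj G v u"
  by (simp add: adj_def insert_commute)

lemma adj_nonneg: "adj G u v \<ge> 0"
  by (simp add: adj_def)

text \<open>As the adjacency matrix is nonnegative, the absolute values of a maximiser of the
  Rayleigh quotient form another one. Its eigenvalue bounds the whole spectrum, since an eigenvalue
  is the Rayleigh quotient of its eigenvector.\<close>

lemma lambda1_perron:
  assumes "simple_graph G" "verts G \<noteq> {}"
  defines "V \<equiv> verts G"
  shows "(\<exists>x. (\<forall>v\<in>V. x v \<ge> 0) \<and> (\<exists>v\<in>V. x v > 0) \<and>
           (\<forall>v\<in>V. (\<Sum>u\<in>V. adj G v u * x u) = lambda1 G * x v)) \<and>
         (\<forall>z. qform V (adj G) z \<le> lambda1 G * nsq V z)"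
proof -
  have fin: "finite V" using assms(1) by (simp add: simple_graph_def V_def)
  obtain y where y: "nsq V y = 1" "\<And>z. qform V (adj G) z \<le> qform V (adj G) y * nsq V z"
    using ex_rayleigh_max[OF fin, of "adj G"] assms(2) V_def by blast
  define c where "c = qform V (adj G) y"
  let ?x = "\<lambda>v. \<bar>y v\<bar>"
  have nx: "nsq V ?x = 1" using y(1) by (simp add: nsq_def)
  have "qform V (adj G) y \<le> qform V (adj G) ?x"
    unfolding qform_def
  proof (intro sum_mono)
    fix v u
    have "y u * y v \<le> \<bar>y u\<bar> * \<bar>y v\<bar>" by (metis abs_ge_self abs_mult)
    then show "adj G v u * y u * y v \<le> adj G v u * \<bar>y u\<bar> * \<bar>y v\<bar>"
      using adj_nonneg[of G v u] by (simp add: mult.assoc mult_left_mono)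
  qed
  then have "qform V (adj G) ?x = c * nsq V ?x"
    using y(2)[of ?x] nx by (simp add: c_def)
  then have eig: "(\<Sum>u\<in>V. adj G v u * ?x u) = c * ?x v" if "v \<in> V" for v
    using rayleigh_max_eigen[OF fin, of "adj G" c ?x v] that adj_sym[of G] y(2) by (simp add: c_def)
  have pos: "\<exists>v\<in>V. ?x v > 0"
    using nx nsq_eq_0_iff[OF fin, of ?x] by auto
  define vs where "vs = (SOME vs. distinct vs \<and> set vs = V)"
  have vs: "distinct vs" "set vs = V"
    using someI_ex[of "\<lambda>vs. distinct vs \<and> set vs = V"] finite_distinct_list[OF fin] unfolding vs_def by auto
  have ev: "eigenvalue (adj_matrix G vs) k \<longleftrightarrow>
      (\<exists>x. (\<exists>v\<in>V. x v \<noteq> 0) \<and> (\<forall>v\<in>V. (\<Sum>u\<in>V. adj G v u * x u) = k * x v))" for k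
    unfolding eigenvalue_adj_matrix_iff[OF vs(1)] vs(2) adj_def ..
  have "lambda1 G = Max (spectrum (adj_matrix G vs))"
    by (simp add: lambda1_def vs_def V_def)
  also have "\<dots> = c"
  proof (rule Max_eqI)
    show "finite (spectrum (adj_matrix G vs))"
      by (rule card_finite_spectrum(1)[of _ "length vs"]) (simp add: adj_matrix_def)
    show "c \<in> spectrum (adj_matrix G vs)"
      using eig pos unfolding spectrum_def mem_Collect_eq ev by (intro exI[of _ ?x]) auto
    fix k assume "k \<in> spectrum (adj_matrix G vs)"
    then obtain x where x: "\<exists>v\<in>V. x v \<noteq> 0" "\<And>v. v \<in> V \<Longrightarrow> (\<Sum>u\<in>V. adj G v u * x u) = k * x v"
      unfolding spectrum_def mem_Collect_eq ev by blast
    have "k * nsq V x \<le> c * nsq V x"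
      using qform_eigen[of V "adj G" x k] x(2) y(2)[of x] by (simp add: c_def)
    moreover have "nsq V x > 0"
      using x(1) nsq_eq_0_iff[OF fin, of x] nsq_nonneg[of V x] by force
    ultimately show "k \<le> c" by simp
  qed
  finally have "lambda1 G = c" .
  then show ?thesis using eig pos y(2) by (auto simp: c_def intro!: exI[of _ ?x])
qed

text \<open>A nonnegative Perron vector of \<open>G\<close>, transported along \<open>f\<close>, has
  a Rayleigh quotient in \<open>H\<close> at least as large, because further edges contribute
  nonnegative terms.\<close>

lemma lambda1_le_of_embedding:
  assumes G: "simple_graph G" "verts G \<noteq> {}" and H: "simple_graph H"
    and f: "bij_betw f (verts G) (verts H)"
    and sub: "\<And>u v. u \<in> verts G \<Longrightarrow> v \<in> verts G \<Longrightarrow> {u, v} \<in> edges G \<Longrightarrow> {f u, f v} \<in> edges H"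
  shows "lambda1 G \<le> lambda1 H"
proof -
  let ?V = "verts G" and ?W = "verts H"
  have fin: "finite ?V" using G(1) by (simp add: simple_graph_def)
  have W: "?W \<noteq> {}" using f G(2) by (auto simp: bij_betw_def)
  obtain x where x: "\<forall>v\<in>?V. x v \<ge> 0" "\<exists>v\<in>?V. x v > 0"
    "\<forall>v\<in>?V. (\<Sum>u\<in>?V. adj G v u * x u) = lambda1 G * x v"
    using lambda1_perron[OF G] by blast
  define z where "z w = x (the_inv_into ?V f w)" for w
  have zf: "z (f v) = x v" if "v \<in> ?V" for v
    using that f by (simp add: z_def bij_betw_def the_inv_into_f_f)
  have "lambda1 G * nsq ?V x = qform ?V (adj G) x"
    using x(3) qform_eigen[of ?V "adj G" x "lambda1 G"] by simp
  also have "\<dots> \<le> (\<Sum>v\<in>?V. \<Sum>u\<in>?V. adj H (f v) (f u) * z (f u) * z (f v))"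
    unfolding qform_def using sub x(1)
    by (intro sum_mono) (auto simp: zf adj_def)
  also have "\<dots> = qform ?W (adj H) z"
    unfolding qform_def by (subst sum.reindex_bij_betw[OF f, symmetric], rule sum.cong[OF refl],
        subst sum.reindex_bij_betw[OF f, symmetric]) (rule refl)
  also have "\<dots> \<le> lambda1 H * nsq ?W z" using lambda1_perron[OF H W] by blast
  also have "nsq ?W z = nsq ?V x"
    unfolding nsq_def by (subst sum.reindex_bij_betw[OF f, symmetric]) (simp add: zf)
  finally have "lambda1 G * nsq ?V x \<le> lambda1 H * nsq ?V x" .
  moreover have "nsq ?V x > 0"
    using x(2) nsq_eq_0_iff[OF fin, of x] nsq_nonneg[of ?V x] by force
  ultimately show ?thesis by simp
qed

lemma lambda1_iso:
  assumes G: "simple_graph G" "verts G \<noteq> {}" and H: "simple_graph H" and iso: "graph_iso G H"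
  shows "lambda1 G = lambda1 H"
proof (rule antisym)
  obtain f where f: "bij_betw f (verts G) (verts H)"
    "\<And>u v. u \<in> verts G \<Longrightarrow> v \<in> verts G \<Longrightarrow> {u, v} \<in> edges G \<longleftrightarrow> {f u, f v} \<in> edges H"
    using iso unfolding graph_iso_def by blast
  show "lambda1 G \<le> lambda1 H"
    using f by (intro lambda1_le_of_embedding[OF G H f(1)]) auto
  let ?g = "the_inv_into (verts G) f"
  have g: "bij_betw ?g (verts H) (verts G)" by (rule bij_betw_the_inv_into[OF f(1)])
  have "verts H \<noteq> {}" using f(1) G(2) by (auto simp: bij_betw_def)
  then show "lambda1 H \<le> lambda1 G"
  proof (rule lambda1_le_of_embedding[OF H _ G(1) g])
    fix u v assume uv: "u \<in> verts H" "v \<in> verts H" "{u, v} \<in> edges H"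
    have "f (?g u) = u" "f (?g v) = v" "?g u \<in> verts G" "?g v \<in> verts G"
      using f(1) g uv by (auto simp: bij_betw_def f_the_inv_into_f)
    then show "{?g u, ?g v} \<in> edges G" using f(2)[of "?g u" "?g v"] uv by simp
  qed
qed

lemma degree_eq_sum:
  assumes "simple_graph G" "v \<in> verts G"
  shows "real (degree G v) = (\<Sum>u\<in>verts G. adj G v u)"
proof -
  let ?V = "verts G"
  have fin: "finite ?V" using assms(1) by (simp add: simple_graph_def)
  have "{e \<in> edges G. v \<in> e} = (\<lambda>u. {v, u}) ` {u \<in> ?V. {v, u} \<in> edges G}"
  proof (rule subset_antisym; rule subsetI)
    fix e assume e: "e \<in> {e \<in> edges G. v \<in> e}"
    then have "e \<subseteq> ?V" "card e = 2" using assms(1) by (auto simp: simple_graph_def)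
    then obtain u where "e = {v, u}" using e by (auto simp: card_2_iff)
    then show "e \<in> (\<lambda>u. {v, u}) ` {u \<in> ?V. {v, u} \<in> edges G}" using e \<open>e \<subseteq> ?V\<close> by auto
  qed auto
  moreover have "inj_on (\<lambda>u. {v, u}) {u \<in> ?V. {v, u} \<in> edges G}"
    by (auto simp: inj_on_def doubleton_eq_iff)
  ultimately have "degree G v = card {u \<in> ?V. {v, u} \<in> edges G}"
    unfolding degree_def by (simp add: card_image)
  then show ?thesis using fin by (simp add: adj_def sum.If_cases Int_def)
qed

text \<open>Sum the eigenvalue equation of \<open>A\<^sup>2 - (\<delta> - 1) A\<close> over all vertices.\<close>

lemma lambda1_degree_bound:
  assumes G: "simple_graph G" "verts G \<noteq> {}"
    and deg: "\<And>v. v \<in> verts G \<Longrightarrow> \<delta> \<le> degree G v"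
  shows "(lambda1 G)\<^sup>2 - (real \<delta> - 1) * lambda1 G \<le>
    (\<Sum>v\<in>verts G. real (degree G v)) - (real (card (verts G)) - 1) * real \<delta>"
proof -
  let ?V = "verts G" and ?a = "adj G" and ?l = "lambda1 G"
  define d where "d v = real (degree G v)" for v
  have fin: "finite ?V" using G(1) by (simp add: simple_graph_def)
  obtain x where x: "\<forall>v\<in>?V. x v \<ge> 0" "\<exists>v\<in>?V. x v > 0" "\<And>v. v \<in> ?V \<Longrightarrow> (\<Sum>u\<in>?V. ?a v u * x u) = ?l * x v"
    using lambda1_perron[OF G] by blast
  define S where "S = (\<Sum>v\<in>?V. x v)"
  have S: "S > 0" using x(1,2) fin by (auto simp: S_def intro!: sum_pos2)
  have dsum: "d v = (\<Sum>u\<in>?V. ?a v u)" if "v \<in> ?V" for v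
    using degree_eq_sum[OF G(1) that] by (simp add: d_def)
  have lS: "?l * S = (\<Sum>v\<in>?V. d v * x v)"
  proof -
    have "?l * S = (\<Sum>v\<in>?V. \<Sum>u\<in>?V. ?a v u * x u)"
      unfolding S_def sum_distrib_left using x(3) by simp
    also have "\<dots> = (\<Sum>u\<in>?V. \<Sum>v\<in>?V. ?a v u * x u)" by (rule sum.swap)
    also have "\<dots> = (\<Sum>u\<in>?V. d u * x u)"
      by (intro sum.cong refl) (simp add: dsum sum_distrib_right adj_sym)
    finally show ?thesis .
  qed
  have llS: "?l\<^sup>2 * S = (\<Sum>w\<in>?V. x w * (\<Sum>u\<in>?V. ?a w u * d u))"
  proof -
    have "?l\<^sup>2 * S = (\<Sum>v\<in>?V. d v * (?l * x v))"
      using lS by (simp add: power2_eq_square mult.assoc sum_distrib_left mult.left_commute)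
    also have "\<dots> = (\<Sum>v\<in>?V. \<Sum>w\<in>?V. d v * (?a v w * x w))"
      by (simp add: x(3)[symmetric] sum_distrib_left)
    also have "\<dots> = (\<Sum>w\<in>?V. \<Sum>v\<in>?V. d v * (?a v w * x w))" by (rule sum.swap)
    also have "\<dots> = (\<Sum>w\<in>?V. x w * (\<Sum>v\<in>?V. ?a w v * d v))"
      by (intro sum.cong refl) (simp add: sum_distrib_left mult_ac adj_sym)
    finally show ?thesis .
  qed
  define c where "c = (\<Sum>v\<in>?V. d v) - (real (card ?V) - 1) * real \<delta>"
  \<comment> \<open>The row sum at \<open>w\<close>: the degrees of the neighbours are the total
    minus \<open>d w\<close> and minus the degrees of the non-neighbours, each at least
    \<open>\<delta>\<close>.\<close>
  have row: "(\<Sum>u\<in>?V. ?a w u * d u) - (real \<delta> - 1) * d w \<le> c" if w: "w \<in> ?V" for w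
  proof -
    have aw: "?a w w = 0" using G(1) by (auto simp: adj_def simple_graph_def)
    have "(\<Sum>u\<in>?V. d u) - (\<Sum>u\<in>?V. ?a w u * d u) = (\<Sum>u\<in>?V. (1 - ?a w u) * d u)"
      by (simp add: sum_subtractf[symmetric] algebra_simps)
    also have "\<dots> = d w + (\<Sum>u\<in>?V - {w}. (1 - ?a w u) * d u)"
      using w fin aw by (simp add: sum.remove)
    finally have e1: "(\<Sum>u\<in>?V. d u) - (\<Sum>u\<in>?V. ?a w u * d u) = d w + (\<Sum>u\<in>?V - {w}. (1 - ?a w u) * d u)" .
    have "(\<Sum>u\<in>?V - {w}. (1 - ?a w u) * real \<delta>) \<le> (\<Sum>u\<in>?V - {w}. (1 - ?a w u) * d u)"
      using deg by (intro sum_mono mult_left_mono) (auto simp: d_def adj_def)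
    also have "(\<Sum>u\<in>?V - {w}. (1 - ?a w u) * real \<delta>) = (real (card ?V) - 1 - d w) * real \<delta>"
    proof -
      have "(\<Sum>u\<in>?V - {w}. 1 - ?a w u) = (\<Sum>u\<in>?V. 1 - ?a w u) - 1"
        using w fin aw by (simp add: sum.remove)
      then show ?thesis by (simp add: sum_distrib_right[symmetric] sum_subtractf dsum[OF w])
    qed
    finally have "d w + (real (card ?V) - 1 - d w) * real \<delta> \<le> (\<Sum>u\<in>?V. d u) - (\<Sum>u\<in>?V. ?a w u * d u)"
      unfolding e1 by simp
    then show ?thesis by (simp add: c_def algebra_simps)
  qed
  have "(?l\<^sup>2 - (real \<delta> - 1) * ?l) * S = ?l\<^sup>2 * S - (real \<delta> - 1) * (?l * S)"
    by (simp add: algebra_simps)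
  also have "\<dots> = (\<Sum>w\<in>?V. x w * ((\<Sum>u\<in>?V. ?a w u * d u) - (real \<delta> - 1) * d w))"
    unfolding llS lS by (simp add: sum_subtractf sum_distrib_left algebra_simps)
  also have "\<dots> \<le> (\<Sum>w\<in>?V. x w * c)"
    using row x(1) by (intro sum_mono mult_left_mono) auto
  also have "\<dots> = c * S" by (simp add: S_def sum_distrib_left mult.commute)
  finally show ?thesis using S by (simp add: c_def d_def)
qed

section \<open>The spectral radius of graphs close to the extremal graph\<close>

text \<open>The graph \<open>K\<^sub>1 \<or> (K\<^sub>A \<union> K\<^sub>B)\<close> with the additional edges in \<open>C\<close> between \<open>A\<close> and \<open>B\<close>. In the
  eigenvalue equations, \<open>N\<close> is the eigenvalue plus one.\<close>

definition hub_graph :: "'a \<Rightarrow> 'a set \<Rightarrow> 'a set \<Rightarrow> ('a \<times> 'a) set \<Rightarrow> 'a sgraph" where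
  "hub_graph w A B C = \<lparr>verts = insert w (A \<union> B),
     edges = {e \<in> edge_set (insert w (A \<union> B)). w \<in> e \<or> e \<subseteq> A \<or> e \<subseteq> B \<or> (\<exists>(a, b)\<in>C. e = {a, b})}\<rparr>"

text \<open>Adding the entry of the vertex itself to both sides of its equation completes the
  neighbourhood sum to a sum over whole cliques; this shifts the eigenvalue by one.\<close>

definition hub_eigen :: "'a \<Rightarrow> 'a set \<Rightarrow> 'a set \<Rightarrow> ('a \<times> 'a) set \<Rightarrow> real \<Rightarrow> ('a \<Rightarrow> real) \<Rightarrow> bool" where
  "hub_eigen w A B C N x \<longleftrightarrow> x w > 0 \<and> (\<forall>a\<in>A. x a > 0) \<and> (\<forall>b\<in>B. x b > 0) \<and>
     N * x w = x w + sum x A + sum x B \<and>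
     (\<forall>a\<in>A. N * x a = x w + sum x A + (\<Sum>b\<in>{b \<in> B. (a, b) \<in> C}. x b)) \<and>
     (\<forall>b\<in>B. N * x b = x w + sum x B + (\<Sum>a\<in>{a \<in> A. (a, b) \<in> C}. x a))"

lemma sum_rows:
  assumes "finite A" "finite B" "C \<subseteq> A \<times> B"
  shows "(\<Sum>a\<in>A. \<Sum>b\<in>{b \<in> B. (a, b) \<in> C}. f a b) = (\<Sum>(a, b)\<in>C. f a b)"
proof -
  have "Sigma A (\<lambda>a. {b \<in> B. (a, b) \<in> C}) = C" using assms(3) by auto
  then show ?thesis using assms by (simp add: sum.Sigma)
qed

lemma sum_cols:
  assumes "finite A" "finite B" "C \<subseteq> A \<times> B"
  shows "(\<Sum>b\<in>B. \<Sum>a\<in>{a \<in> A. (a, b) \<in> C}. f a b) = (\<Sum>(a, b)\<in>C. f a b)"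
proof -
  have "(\<Sum>b\<in>B. \<Sum>a\<in>{a \<in> A. (a, b) \<in> C}. f a b) = (\<Sum>(b, a)\<in>C\<inverse>. f a b)"
    using sum_rows[OF assms(2,1), of "C\<inverse>" "\<lambda>b a. f a b"] assms(3) by (simp add: subset_iff)
  also have "\<dots> = (\<Sum>(a, b)\<in>C. f a b)"
    by (rule sum.reindex_bij_witness[of _ prod.swap prod.swap]) auto
  finally show ?thesis .
qed

text \<open>The value \<open>(x w + sum x B) / N\<close> separates the entries on \<open>A\<close>
  from those on \<open>B\<close>. Summing the equations over the small part \<open>A\<close>, with
  at most \<open>card A / 4\<close> cross edges of weight at most \<open>x w\<close>, gives
  \<open>sum x A \<le> 5 / 4 * x w\<close>, which keeps the entries on \<open>A\<close> low.\<close>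

lemma hub_eigen_bounds:
  assumes fin: "finite A" "finite B" and C: "C \<subseteq> A \<times> B" and card: "4 * card C \<le> card A" "6 \<le> card A"
    "2 * card A \<le> card B + 1" and eig: "hub_eigen w A B C N x"
  shows "N > real (card B) + 1"
    and "a \<in> A \<Longrightarrow> N * x a < x w + sum x B"
    and "b \<in> B \<Longrightarrow> x w + sum x B \<le> N * x b"
proof -
  have pos: "x w > 0" "\<And>a. a \<in> A \<Longrightarrow> x a > 0" "\<And>b. b \<in> B \<Longrightarrow> x b > 0"
    and Nw: "N * x w = x w + sum x A + sum x B"
    and Na: "\<And>a. a \<in> A \<Longrightarrow> N * x a = x w + sum x A + (\<Sum>b\<in>{b \<in> B. (a, b) \<in> C}. x b)"
    and Nb: "\<And>b. b \<in> B \<Longrightarrow> N * x b = x w + sum x B + (\<Sum>a\<in>{a \<in> A. (a, b) \<in> C}. x a)"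
    using eig unfolding hub_eigen_def by auto
  let ?T = "x w + sum x B"
  have XA: "sum x A > 0" using pos(2) fin(1) card(2) by (intro sum_pos) auto
  have XB: "sum x B \<ge> 0" using pos(3) by (intro sum_nonneg) (auto intro: less_imp_le)
  have T: "?T > 0" using pos(1) XB by simp
  show low: "?T \<le> N * x b" if "b \<in> B" for b
  proof -
    have "(\<Sum>a\<in>{a \<in> A. (a, b) \<in> C}. x a) \<ge> 0"
      using pos(2) by (intro sum_nonneg) (auto intro: less_imp_le)
    then show ?thesis using Nb[OF that] by simp
  qed
  have "N * ?T = N * x w + (\<Sum>b\<in>B. N * x b)" by (simp add: algebra_simps sum_distrib_left)
  moreover have "(\<Sum>b\<in>B. ?T) \<le> (\<Sum>b\<in>B. N * x b)" using low by (intro sum_mono) auto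
  ultimately have "(real (card B) + 1) * ?T < N * ?T" using Nw XA by (simp add: algebra_simps)
  then show N: "N > real (card B) + 1" using T by simp
  then have N2: "N > 2 * real (card A)" using card(3) by linarith
  have N0: "N > 0" using N by simp
  have xb: "x b \<le> x w" if "b \<in> B" for b
  proof -
    have "(\<Sum>a\<in>{a \<in> A. (a, b) \<in> C}. x a) \<le> sum x A"
      using fin pos(2) by (intro sum_mono2) (auto intro: less_imp_le)
    then have "N * x b \<le> N * x w" using Nb[OF that] Nw by simp
    then show ?thesis using N0 by simp
  qed
  have finC: "finite C" using C fin by (meson finite_SigmaI finite_subset)
  have "N * sum x A = (\<Sum>a\<in>A. N * x a)" by (simp add: sum_distrib_left)
  also have "\<dots> = real (card A) * (x w + sum x A) + (\<Sum>a\<in>A. \<Sum>b\<in>{b \<in> B. (a, b) \<in> C}. x b)"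
    using Na by (simp add: sum.distrib)
  also have "(\<Sum>a\<in>A. \<Sum>b\<in>{b \<in> B. (a, b) \<in> C}. x b) = (\<Sum>(a, b)\<in>C. x b)"
    by (rule sum_rows[OF fin C])
  also have "\<dots> \<le> (\<Sum>(a, b)\<in>C. x w)"
    using xb C by (intro sum_mono) auto
  also have "\<dots> = real (card C) * x w" by simp
  also have "\<dots> \<le> (real (card A) / 4) * x w"
    using card(1) pos(1) by (intro mult_right_mono) auto
  finally have "(N - real (card A)) * sum x A \<le> (5 / 4) * real (card A) * x w"
    by (simp add: algebra_simps)
  moreover have "real (card A) * sum x A \<le> (N - real (card A)) * sum x A"
    using N2 XA by (intro mult_right_mono) auto
  ultimately have "real (card A) * sum x A \<le> real (card A) * ((5 / 4) * x w)" by simp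
  then have XAw: "sum x A \<le> (5 / 4) * x w"
    using card(2) by (simp only: mult_le_cancel_left_pos of_nat_0_less_iff)
  assume a: "a \<in> A"
  have "(\<Sum>b\<in>{b \<in> B. (a, b) \<in> C}. x b) \<le> real (card {b \<in> B. (a, b) \<in> C}) * x w"
    using xb by (intro sum_bounded_above) auto
  also have "\<dots> \<le> (real (card A) / 4) * x w"
  proof (intro mult_right_mono)
    have "card {b \<in> B. (a, b) \<in> C} = card ((\<lambda>b. (a, b)) ` {b \<in> B. (a, b) \<in> C})"
      by (rule card_image[symmetric]) (simp add: inj_on_def)
    also have "\<dots> \<le> card C" using finC by (intro card_mono) auto
    finally show "real (card {b \<in> B. (a, b) \<in> C}) \<le> real (card A) / 4" using card(1) by linarith
  qed (use pos(1) in simp)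
  finally have h: "(\<Sum>b\<in>{b \<in> B. (a, b) \<in> C}. x b) \<le> (real (card A) / 4) * x w" .
  \<comment> \<open>\<open>7 / 2 = 1 + 5 / 4 + 5 / 4\<close>: the terms \<open>x w\<close> and
    \<open>sum x A\<close> of \<open>N * x a\<close>, and once more \<open>sum x A\<close>, by which
    \<open>N * x w\<close> exceeds \<open>?T\<close>.\<close>
  have "(7 / 2 + real (card A) / 4) * x w < N * x w"
    using N2 card(2) pos(1) by (intro mult_strict_right_mono) auto
  then show "N * x a < ?T"
    using Na[OF a] h XAw Nw pos(1) by (simp add: algebra_simps)
qed

text \<open>Pair the eigenvector of one graph with that of the other: the adjacencies common to both
  graphs cancel by symmetry, and only the cross edges remain.\<close>

lemma hub_eigen_form:
  assumes fin: "finite A" "finite B" and C: "C \<subseteq> A \<times> B" "C' \<subseteq> A \<times> B"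
    and x: "hub_eigen w A B C N x" and y: "hub_eigen w A B C' M y"
  shows "(M - N) * (x w * y w + (\<Sum>a\<in>A. x a * y a) + (\<Sum>b\<in>B. x b * y b)) =
    ((\<Sum>(a, b)\<in>C'. x a * y b) + (\<Sum>(a, b)\<in>C'. x b * y a)) -
    ((\<Sum>(a, b)\<in>C. x a * y b) + (\<Sum>(a, b)\<in>C. x b * y a))"
proof -
  have expand: "M * (x w * y w + (\<Sum>a\<in>A. x a * y a) + (\<Sum>b\<in>B. x b * y b)) =
      x w * y w + x w * sum y A + x w * sum y B + sum x A * y w + sum x A * sum y A +
      sum x B * y w + sum x B * sum y B + (\<Sum>(a, b)\<in>C'. x a * y b) + (\<Sum>(a, b)\<in>C'. x b * y a)"
    if y: "hub_eigen w A B C' M y" and C: "C' \<subseteq> A \<times> B" for M C' and x y :: "'a \<Rightarrow> real"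
  proof -
    have "(\<Sum>a\<in>A. x a * (M * y a)) = (\<Sum>a\<in>A. x a * (y w + sum y A) + (\<Sum>b\<in>{b \<in> B. (a, b) \<in> C'}. x a * y b))"
      using y by (intro sum.cong refl) (simp add: hub_eigen_def algebra_simps sum_distrib_left)
    then have A: "(\<Sum>a\<in>A. x a * (M * y a)) = sum x A * (y w + sum y A) + (\<Sum>(a, b)\<in>C'. x a * y b)"
      by (simp only: sum.distrib sum_distrib_right sum_rows[OF fin C])
    have "(\<Sum>b\<in>B. x b * (M * y b)) = (\<Sum>b\<in>B. x b * (y w + sum y B) + (\<Sum>a\<in>{a \<in> A. (a, b) \<in> C'}. x b * y a))"
      using y by (intro sum.cong refl) (simp add: hub_eigen_def algebra_simps sum_distrib_left)
    then have B: "(\<Sum>b\<in>B. x b * (M * y b)) = sum x B * (y w + sum y B) + (\<Sum>(a, b)\<in>C'. x b * y a)"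
      by (simp only: sum.distrib sum_distrib_right sum_cols[OF fin C, of "\<lambda>a b. x b * y a"])
    have "M * (x w * y w + (\<Sum>a\<in>A. x a * y a) + (\<Sum>b\<in>B. x b * y b)) =
        x w * (M * y w) + (\<Sum>a\<in>A. x a * (M * y a)) + (\<Sum>b\<in>B. x b * (M * y b))"
      by (simp add: sum_distrib_left algebra_simps)
    also have "M * y w = y w + sum y A + sum y B" using y by (simp add: hub_eigen_def)
    finally show ?thesis unfolding A B by (simp add: algebra_simps)
  qed
  have swap: "(\<Sum>a\<in>S. y a * x a) = (\<Sum>a\<in>S. x a * y a)" "(\<Sum>(a, b)\<in>C. y a * x b) = (\<Sum>(a, b)\<in>C. x b * y a)"
    "(\<Sum>(a, b)\<in>C. y b * x a) = (\<Sum>(a, b)\<in>C. x a * y b)" for S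
    by (simp_all add: mult.commute)
  show ?thesis
    using expand[OF y C(2), of x] expand[OF x C(1), of y]
    unfolding left_diff_distrib swap by (simp add: mult.commute)
qed

text \<open>Among at most \<open>k - 1\<close> extra edges, a star at a vertex of \<open>A\<close> maximises the eigenvalue: compare
  the Perron vectors \<open>x\<close> and \<open>y\<close> of the two graphs, with the star centred at the largest entry of \<open>x\<close>
  in \<open>A\<close>.\<close>

lemma hub_eigen_star_extremal:
  assumes fin: "finite A" "finite B" and C: "C \<subseteq> A \<times> B" and card: "card C < k" "4 * k \<le> card A" "6 \<le> card A"
    "2 * card A \<le> card B + 1" and a1: "a1 \<in> A" "\<And>a. a \<in> A \<Longrightarrow> x a \<le> x a1"
    and W: "W \<subseteq> B" "card W = k - 1" "\<And>b. (a1, b) \<in> C \<Longrightarrow> b \<in> W"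
    and x: "hub_eigen w A B C N x" and y: "hub_eigen w A B ({a1} \<times> W) M y" and MN: "M \<le> N"
  shows "C = {a1} \<times> W"
proof -
  let ?S = "{a1} \<times> W"
  have finW: "finite W" using W(1) fin(2) finite_subset by blast
  have finC: "finite C" using C fin by (meson finite_SigmaI finite_subset)
  have S: "?S \<subseteq> A \<times> B" "card ?S = k - 1" using a1(1) W(1,2) by (auto simp: card_cartesian_product)
  have px: "x w > 0" "\<And>a. a \<in> A \<Longrightarrow> x a > 0" "\<And>b. b \<in> B \<Longrightarrow> x b > 0"
    and xb: "\<And>b. b \<in> B \<Longrightarrow> N * x b = x w + sum x B + (\<Sum>a\<in>{a \<in> A. (a, b) \<in> C}. x a)"
    using x unfolding hub_eigen_def by auto
  have py: "y w > 0" "\<And>a. a \<in> A \<Longrightarrow> y a > 0" "\<And>b. b \<in> B \<Longrightarrow> y b > 0"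
    and ya: "\<And>a. a \<in> A \<Longrightarrow> M * y a = y w + sum y A + (\<Sum>b\<in>{b \<in> B. (a, b) \<in> ?S}. y b)"
    and yb: "\<And>b. b \<in> B \<Longrightarrow> M * y b = y w + sum y B + (\<Sum>a\<in>{a \<in> A. (a, b) \<in> ?S}. y a)"
    using y unfolding hub_eigen_def by auto
  have c4: "4 * card C \<le> card A" "4 * card ?S \<le> card A" using card(1,2) S(2) by auto
  note bx = hub_eigen_bounds[OF fin C c4(1) card(3,4) x]
  note by' = hub_eigen_bounds[OF fin S(1) c4(2) card(3,4) y]
  have M0: "M > 0" using by'(1) by simp
  have N0: "N > 0" using bx(1) by simp
  \<comment> \<open>\<open>\<beta>\<close> separates the entries of \<open>x\<close> on
    \<open>A\<close> from those on \<open>B\<close>. \<open>\<eta>\<close> is the value of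
    \<open>y\<close> on \<open>A\<close> away from the centre, \<open>\<tau>\<close> and
    \<open>\<omega>\<close> are its values on \<open>B\<close> outside and inside
    \<open>W\<close>.\<close>
  define \<beta> where "\<beta> = (x w + sum x B) / N"
  define \<eta> where "\<eta> = (y w + sum y A) / M"
  define \<tau> where "\<tau> = (y w + sum y B) / M"
  define \<omega> where "\<omega> = \<tau> + y a1 / M"
  have sums: "sum x B \<ge> 0" "sum y A \<ge> 0" "sum y B \<ge> 0"
    using px py by (auto intro!: sum_nonneg simp: less_imp_le)
  have \<beta>: "\<beta> > 0" using px(1) sums N0 by (simp add: \<beta>_def add_pos_nonneg)
  have \<eta>: "\<eta> > 0" using py(1) sums M0 by (simp add: \<eta>_def add_pos_nonneg)
  have xa\<beta>: "x a < \<beta>" if "a \<in> A" for a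
    using bx(2)[OF that] N0 by (simp add: \<beta>_def field_simps)
  have xb\<beta>: "\<beta> \<le> x b" if "b \<in> B" for b
    using bx(3)[OF that] N0 by (simp add: \<beta>_def field_simps)
  have y_other: "y a = \<eta>" if "a \<in> A" "a \<noteq> a1" for a
    using ya[OF that(1)] that(2) M0 by (simp add: \<eta>_def field_simps)
  have yW: "y b = \<omega>" if "b \<in> W" for b
  proof -
    have "{a \<in> A. (a, b) \<in> ?S} = {a1}" using that a1(1) by auto
    then show ?thesis using yb[of b] that W(1) M0 by (auto simp: \<omega>_def \<tau>_def field_simps)
  qed
  have yB: "y b \<le> \<omega>" if b: "b \<in> B" for b
  proof (cases "b \<in> W")
    case False
    then have e: "{a \<in> A. (a, b) \<in> ?S} = {}" by auto
    have "y b = \<tau>" using yb[OF b, unfolded e] M0 by (simp add: \<tau>_def field_simps)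
    then show ?thesis using py(2)[OF a1(1)] M0 by (simp add: \<omega>_def)
  qed (simp add: yW)
  have ya1: "M * y a1 = M * \<eta> + real (k - 1) * \<omega>"
  proof -
    have e: "{b \<in> B. (a1, b) \<in> ?S} = W" using W(1) by auto
    show ?thesis using ya[OF a1(1), unfolded e] M0 yW W(2) by (simp add: \<eta>_def)
  qed
  have \<omega>0: "\<omega> > 0"
    using py(1) py(2)[OF a1(1)] sums M0 by (simp add: \<omega>_def \<tau>_def add_pos_pos add_pos_nonneg)
  have "\<eta> < \<tau>"
  proof -
    have "M * \<eta> \<le> M * y a1" using ya1 \<omega>0 by simp
    also have "\<dots> < M * \<tau>" using by'(2)[OF a1(1)] M0 by (simp add: \<tau>_def)
    finally show ?thesis using M0 by simp
  qed
  then have \<eta>\<omega>: "\<eta> \<le> \<omega>" using py(2)[OF a1(1)] M0 by (simp add: \<omega>_def add_increasing2)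
  \<comment> \<open>An edge of \<open>C\<close> away from the centre weighs less than one of the
    star: \<open>x b\<close> exceeds \<open>\<beta>\<close> by less than
    \<open>(k - 1) * \<beta> / M\<close>, while \<open>y a1\<close> exceeds \<open>\<eta>\<close> by
    exactly \<open>(k - 1) * \<omega> / M\<close>, and \<open>\<eta> \<le> \<omega>\<close>.\<close>
  have key: "x b * \<eta> < \<beta> * y a1" if ab: "(a, b) \<in> C" for a b
  proof -
    have b: "b \<in> B" and a: "a \<in> {a \<in> A. (a, b) \<in> C}" using ab C by auto
    have "(\<Sum>a\<in>{a \<in> A. (a, b) \<in> C}. x a) < (\<Sum>a\<in>{a \<in> A. (a, b) \<in> C}. \<beta>)"
      using a fin xa\<beta> by (intro sum_strict_mono) auto
    also have "\<dots> \<le> real (k - 1) * \<beta>"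
    proof -
      have "card {a \<in> A. (a, b) \<in> C} = card ((\<lambda>a. (a, b)) ` {a \<in> A. (a, b) \<in> C})"
        by (rule card_image[symmetric]) (simp add: inj_on_def)
      also have "\<dots> \<le> card C" using finC by (intro card_mono) auto
      finally have "card {a \<in> A. (a, b) \<in> C} \<le> k - 1" using card(1) by simp
      then show ?thesis using \<beta> by (simp add: mult_right_mono)
    qed
    finally have "N * x b < N * \<beta> + real (k - 1) * \<beta>" using xb[OF b] N0 by (simp add: \<beta>_def)
    then have "x b < \<beta> + real (k - 1) * \<beta> / N" using N0 by (simp add: field_simps)
    also have "\<dots> \<le> \<beta> + real (k - 1) * \<beta> / M"
      using MN M0 \<beta> by (intro add_left_mono divide_left_mono) auto
    finally have "x b * \<eta> < (\<beta> + real (k - 1) * \<beta> / M) * \<eta>" using \<eta> by (rule mult_strict_right_mono)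
    also have "\<dots> = \<beta> * (\<eta> + real (k - 1) * \<eta> / M)" by (simp add: algebra_simps)
    also have "\<dots> \<le> \<beta> * (\<eta> + real (k - 1) * \<omega> / M)"
      using \<eta>\<omega> M0 \<beta> by (intro mult_left_mono add_left_mono divide_right_mono) auto
    also have "\<eta> + real (k - 1) * \<omega> / M = y a1" using ya1 M0 by (simp add: field_simps)
    finally show ?thesis .
  qed
  have D1: "(\<Sum>(a, b)\<in>C. x a * y b) \<le> (\<Sum>(a, b)\<in>?S. x a * y b)"
  proof -
    have "(\<Sum>(a, b)\<in>C. x a * y b) \<le> (\<Sum>(a, b)\<in>C. x a1 * \<omega>)"
    proof (intro sum_mono)
      fix e assume "e \<in> C"
      then obtain a b where e: "e = (a, b)" "a \<in> A" "b \<in> B" using C by auto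
      have "x a * y b \<le> x a1 * \<omega>"
        using a1(2)[OF e(2)] yB[OF e(3)] px(2)[OF a1(1)] py(3)[OF e(3)] by (intro mult_mono) auto
      then show "(case e of (a, b) \<Rightarrow> x a * y b) \<le> (case e of (a, b) \<Rightarrow> x a1 * \<omega>)" by (simp add: e(1))
    qed
    also have "\<dots> \<le> real (k - 1) * (x a1 * \<omega>)"
      using card(1) px(2)[OF a1(1)] \<omega>0 by (auto intro!: mult_right_mono)
    also have "\<dots> = (\<Sum>(a, b)\<in>?S. x a1 * \<omega>)" using S(2) by simp
    also have "\<dots> = (\<Sum>(a, b)\<in>?S. x a * y b)" by (rule sum.cong) (auto simp: yW)
    finally show ?thesis .
  qed
  have ip: "x w * y w + (\<Sum>a\<in>A. x a * y a) + (\<Sum>b\<in>B. x b * y b) \<ge> 0"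
    using px py by (intro add_nonneg_nonneg sum_nonneg mult_nonneg_nonneg) (simp_all add: less_imp_le)
  \<comment> \<open>As \<open>M \<le> N\<close>, both sides of \<open>hub_eigen_form\<close> are at
    most zero; what the star gains in the first sum it must lose in the second.\<close>
  then have D2: "(\<Sum>(a, b)\<in>?S. x b * y a) \<le> (\<Sum>(a, b)\<in>C. x b * y a)"
    using hub_eigen_form[OF fin C S(1) x y] D1 MN
      mult_nonpos_nonneg[of "M - N" "x w * y w + (\<Sum>a\<in>A. x a * y a) + (\<Sum>b\<in>B. x b * y b)"] by linarith
  let ?I = "C \<inter> ?S"
  have split: "sum h C = sum h ?I + sum h (C - ?S)" "sum h ?S = sum h ?I + sum h (?S - C)" for h :: "'a \<times> 'a \<Rightarrow> real"
    using finC finW by (simp_all add: sum.Int_Diff[of C h ?S] sum.Int_Diff[of ?S h C] Int_commute)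
  have le: "(\<Sum>(a, b)\<in>?S - C. x b * y a) \<le> (\<Sum>(a, b)\<in>C - ?S. x b * y a)"
    using D2 unfolding split[of "\<lambda>(a, b). x b * y a"] by simp
  have lower: "real (card (?S - C)) * (\<beta> * y a1) \<le> (\<Sum>(a, b)\<in>?S - C. x b * y a)"
    unfolding sum_constant[symmetric]
    using W(1) xb\<beta> py(2)[OF a1(1)] by (intro sum_mono) (auto intro!: mult_right_mono simp: subset_iff)
  have cards: "card (C - ?S) \<le> card (?S - C)"
    using finC finW card(1) S(2) card_Diff_subset_Int[of C ?S] card_Diff_subset_Int[of ?S C] by (simp add: Int_commute)
  have C': "a \<in> A" "a \<noteq> a1" if "(a, b) \<in> C - ?S" for a b
    using that C W(3) by auto
  have by1: "\<beta> * y a1 > 0" using \<beta> py(2)[OF a1(1)] by simp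
  \<comment> \<open>\<open>C\<close> has no more edges outside the star than the star has outside
    \<open>C\<close>. Each of the former weighs strictly less than \<open>\<beta> * y a1\<close>,
    each of the latter at least that.\<close>
  have e: "C - ?S = {}"
  proof (rule ccontr)
    assume ne: "C - ?S \<noteq> {}"
    have "(\<Sum>(a, b)\<in>C - ?S. x b * y a) < (\<Sum>(a, b)\<in>C - ?S. \<beta> * y a1)"
    proof (rule sum_strict_mono)
      fix e assume e: "e \<in> C - ?S"
      obtain a b where ab: "e = (a, b)" by (cases e)
      have ab': "(a, b) \<in> C - ?S" using e unfolding ab .
      have "y a = \<eta>" by (rule y_other[OF C'[OF ab']])
      moreover have "x b * \<eta> < \<beta> * y a1" by (rule key[OF DiffD1[OF ab']])
      ultimately show "(case e of (a, b) \<Rightarrow> x b * y a) < (case e of (a, b) \<Rightarrow> \<beta> * y a1)"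
        unfolding ab by simp
    qed (use finC ne in auto)
    also have "\<dots> = real (card (C - ?S)) * (\<beta> * y a1)" by simp
    also have "\<dots> \<le> real (card (?S - C)) * (\<beta> * y a1)"
      using cards by1 by (intro mult_right_mono) auto
    finally show False using le lower by simp
  qed
  have "real (card (?S - C)) * (\<beta> * y a1) \<le> 0"
    using order_trans[OF lower le] unfolding e by simp
  then have "card (?S - C) = 0" using by1 by (metis linorder_not_less mult_pos_pos of_nat_0_less_iff bot_nat_0.not_eq_extremum)
  then have "?S - C = {}" using finW by simp
  with e show ?thesis by blast
qed

section \<open>Perron vectors of hub graphs, and the extremal graph as a hub graph\<close>

lemma simple_hub_graph:
  assumes "finite A" "finite B"
  shows "simple_graph (hub_graph w A B C)"
  using assms by (auto simp: simple_graph_def hub_graph_def edge_set_def)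

lemma hub_graph_edge_iff:
  assumes "u \<in> insert w (A \<union> B)" "v \<in> insert w (A \<union> B)" "C \<subseteq> A \<times> B"
  shows "{u, v} \<in> edges (hub_graph w A B C) \<longleftrightarrow> u \<noteq> v \<and>
    (u = w \<or> v = w \<or> u \<in> A \<and> v \<in> A \<or> u \<in> B \<and> v \<in> B \<or> (u, v) \<in> C \<or> (v, u) \<in> C)"
proof -
  have "{u, v} \<in> edge_set (insert w (A \<union> B)) \<longleftrightarrow> u \<noteq> v"
    using assms by (cases "u = v") (auto simp: edge_set_def)
  moreover have "(\<exists>(a, b)\<in>C. {u, v} = {a, b}) \<longleftrightarrow> (u, v) \<in> C \<or> (v, u) \<in> C"
    by (auto simp: doubleton_eq_iff split: prod.splits)
  ultimately show ?thesis by (auto simp: hub_graph_def)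
qed

lemma neighbour_sum:
  assumes "simple_graph G" "v \<in> verts G"
  shows "(\<Sum>u\<in>verts G. adj G v u * x u) + x v = (\<Sum>u\<in>{u \<in> verts G. u = v \<or> {v, u} \<in> edges G}. x u)"
proof -
  have fin: "finite (verts G)" using assms(1) by (simp add: simple_graph_def)
  have vv: "{v, v} \<notin> edges G" using assms(1) by (auto simp: simple_graph_def)
  have "{u \<in> verts G. u = v \<or> {v, u} \<in> edges G} = insert v {u \<in> verts G. {v, u} \<in> edges G}"
    using assms(2) by auto
  then have "(\<Sum>u\<in>{u \<in> verts G. u = v \<or> {v, u} \<in> edges G}. x u) = x v + (\<Sum>u\<in>{u \<in> verts G. {v, u} \<in> edges G}. x u)"
    using fin vv by simp
  also have "(\<Sum>u\<in>{u \<in> verts G. {v, u} \<in> edges G}. x u) = (\<Sum>u\<in>verts G. adj G v u * x u)"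
    using fin by (simp add: sum.inter_filter adj_def if_distrib[of "\<lambda>c. c * _"] cong: if_cong)
  finally show ?thesis by simp
qed

text \<open>The hub is adjacent to every vertex: \<open>x w = 0\<close> would make all entries
  vanish, and \<open>x w > 0\<close> makes the right side of every equation positive. The eigenvalue
  is arbitrary, as an eigenvector of a subgraph is inserted later.\<close>

lemma hub_eigenI:
  assumes fin: "finite A" "finite B" and disj: "A \<inter> B = {}" "w \<notin> A" "w \<notin> B" "C \<subseteq> A \<times> B" and ne: "A \<noteq> {}"
    and x: "\<And>v. v \<in> insert w (A \<union> B) \<Longrightarrow> x v \<ge> 0" "\<exists>v\<in>insert w (A \<union> B). x v > 0"
    "\<And>v. v \<in> insert w (A \<union> B) \<Longrightarrow>
       (\<Sum>u\<in>insert w (A \<union> B). adj (hub_graph w A B C) v u * x u) = c * x v"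
  shows "hub_eigen w A B C (c + 1) x"
proof -
  let ?G = "hub_graph w A B C" and ?V = "insert w (A \<union> B)"
  have V: "verts ?G = ?V" by (simp add: hub_graph_def)
  have finV: "finite ?V" using fin by simp
  have eq: "(c + 1) * x v = (\<Sum>u\<in>{u \<in> ?V. u = v \<or> {v, u} \<in> edges ?G}. x u)" if "v \<in> ?V" for v
    using neighbour_sum[OF simple_hub_graph[OF fin], of v w C x] x(3)[OF that] that
    unfolding V by (simp only: distrib_right mult_1)
  have edge: "{v, u} \<in> edges ?G \<longleftrightarrow> v \<noteq> u \<and>
      (v = w \<or> u = w \<or> v \<in> A \<and> u \<in> A \<or> v \<in> B \<and> u \<in> B \<or> (v, u) \<in> C \<or> (u, v) \<in> C)"
    if "v \<in> ?V" "u \<in> ?V" for u v using hub_graph_edge_iff[OF that disj(4)] .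
  have "{u \<in> ?V. u = w \<or> {w, u} \<in> edges ?G} = insert w (A \<union> B)" using edge by auto
  moreover have "sum x (insert w (A \<union> B)) = x w + sum x A + sum x B"
    using fin disj by (simp add: sum.union_disjoint)
  ultimately have eqw: "(c + 1) * x w = x w + sum x A + sum x B" using eq[of w] by simp
  have eqa: "(c + 1) * x a = x w + sum x A + (\<Sum>b\<in>{b \<in> B. (a, b) \<in> C}. x b)" if a: "a \<in> A" for a
  proof -
    have "{u \<in> ?V. u = a \<or> {a, u} \<in> edges ?G} = insert w (A \<union> {b \<in> B. (a, b) \<in> C})"
    proof (rule Set.set_eqI)
      fix u
      show "u \<in> {u \<in> ?V. u = a \<or> {a, u} \<in> edges ?G} \<longleftrightarrow> u \<in> insert w (A \<union> {b \<in> B. (a, b) \<in> C})"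
        using edge[of a u] a disj by blast
    qed
    then have "(c + 1) * x a = sum x (insert w (A \<union> {b \<in> B. (a, b) \<in> C}))" using eq[of a] a by simp
    also have "\<dots> = x w + sum x A + (\<Sum>b\<in>{b \<in> B. (a, b) \<in> C}. x b)"
    proof -
      have "A \<inter> {b \<in> B. (a, b) \<in> C} = {}" using disj by auto
      then show ?thesis using fin disj by (simp add: sum.union_disjoint)
    qed
    finally show ?thesis .
  qed
  have eqb: "(c + 1) * x b = x w + sum x B + (\<Sum>a\<in>{a \<in> A. (a, b) \<in> C}. x a)" if b: "b \<in> B" for b
  proof -
    have "{u \<in> ?V. u = b \<or> {b, u} \<in> edges ?G} = insert w (B \<union> {a \<in> A. (a, b) \<in> C})"
    proof (rule Set.set_eqI)
      fix u
      show "u \<in> {u \<in> ?V. u = b \<or> {b, u} \<in> edges ?G} \<longleftrightarrow> u \<in> insert w (B \<union> {a \<in> A. (a, b) \<in> C})"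
        using edge[of b u] b disj by blast
    qed
    then have "(c + 1) * x b = sum x (insert w (B \<union> {a \<in> A. (a, b) \<in> C}))" using eq[of b] b by simp
    also have "\<dots> = x w + sum x B + (\<Sum>a\<in>{a \<in> A. (a, b) \<in> C}. x a)"
    proof -
      have "B \<inter> {a \<in> A. (a, b) \<in> C} = {}" using disj by auto
      then show ?thesis using fin disj by (simp add: sum.union_disjoint)
    qed
    finally show ?thesis .
  qed
  have nn: "sum x A \<ge> 0" "sum x B \<ge> 0"
    "(\<Sum>b\<in>{b \<in> B. (a, b) \<in> C}. x b) \<ge> 0" "(\<Sum>a\<in>{a \<in> A. (a, b) \<in> C}. x a) \<ge> 0" for a b
    using x(1) by (auto intro!: sum_nonneg)
  have w: "x w > 0"
  proof (rule ccontr)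
    assume "\<not> x w > 0"
    then have "x w = 0" using x(1)[of w] by simp
    then have "sum x A = 0" "sum x B = 0" using eqw nn by auto
    then have "\<forall>a\<in>A. x a = 0" "\<forall>b\<in>B. x b = 0"
      using fin x(1) by (simp_all add: sum_nonneg_eq_0_iff)
    then show False using x(2) \<open>x w = 0\<close> by auto
  qed
  have "x a > 0" if "a \<in> A" for a
    using eqa[OF that] nn(1) nn(3)[of a] w x(1)[of a] that by (cases "x a = 0") auto
  moreover have "x b > 0" if "b \<in> B" for b
    using eqb[OF that] nn(2) nn(4)[of b] w x(1)[of b] that by (cases "x b = 0") auto
  ultimately show ?thesis unfolding hub_eigen_def using w eqw eqa eqb by blast
qed

lemma hub_eigen_lambda1:
  assumes "finite A" "finite B" "A \<inter> B = {}" "w \<notin> A" "w \<notin> B" "C \<subseteq> A \<times> B" "A \<noteq> {}"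
  obtains x where "hub_eigen w A B C (lambda1 (hub_graph w A B C) + 1) x"
proof -
  have V: "verts (hub_graph w A B C) = insert w (A \<union> B)" by (simp add: hub_graph_def)
  obtain x where "\<forall>v\<in>insert w (A \<union> B). x v \<ge> 0" "\<exists>v\<in>insert w (A \<union> B). x v > 0"
    "\<forall>v\<in>insert w (A \<union> B). (\<Sum>u\<in>insert w (A \<union> B). adj (hub_graph w A B C) v u * x u) = lambda1 (hub_graph w A B C) * x v"
    using lambda1_perron[OF simple_hub_graph[OF assms(1,2)], of w C] unfolding V by blast
  then show thesis using that[OF hub_eigenI[OF assms]] by blast
qed

lemma extremal_graph_edge_iff:
  assumes "u < n" "v < n" "1 \<le> \<delta>"
  shows "{u, v} \<in> edges (extremal_graph n \<delta> k) \<longleftrightarrow> u \<noteq> v \<and>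
    (u = 0 \<or> v = 0 \<or> u \<in> {1..\<delta>} \<and> v \<in> {1..\<delta>} \<or> u \<in> {\<delta>+1..<n} \<and> v \<in> {\<delta>+1..<n} \<or>
     u = 1 \<and> v \<in> {\<delta>+1..<\<delta>+k} \<or> v = 1 \<and> u \<in> {\<delta>+1..<\<delta>+k})"
proof (cases "u = v")
  case True
  then show ?thesis
    using assms by (auto simp: extremal_graph_def add_edges_def graph_join_def graph_union_def complete_graph_def
        singleton_insert_inj_eq')
next
  case False
  then have "card {u, v} = 2" by simp
  then show ?thesis
    using assms False
    by (auto simp: extremal_graph_def add_edges_def graph_join_def graph_union_def complete_graph_def doubleton_eq_iff)
qed

lemma simple_extremal_graph:
  assumes "1 \<le> \<delta>" "1 \<le> k" "\<delta> + k \<le> n"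
  shows "simple_graph (extremal_graph n \<delta> k)" "verts (extremal_graph n \<delta> k) = {..<n}"
proof -
  show V: "verts (extremal_graph n \<delta> k) = {..<n}"
    using assms by (auto simp: extremal_graph_def add_edges_def graph_join_def graph_union_def complete_graph_def)
  show "simple_graph (extremal_graph n \<delta> k)"
    unfolding simple_graph_def V using assms
    by (auto simp: extremal_graph_def add_edges_def graph_join_def graph_union_def complete_graph_def card_2_iff)
qed

lemma hub_star_iso_extremal:
  assumes fin: "finite A" "finite B" and disj: "A \<inter> B = {}" "w \<notin> A" "w \<notin> B"
    and card: "card A = \<delta>" "card B + \<delta> + 1 = n" "1 \<le> k" "\<delta> + k \<le> n"
    and a1: "a1 \<in> A" and W: "W \<subseteq> B" "card W = k - 1"
  shows "graph_iso (hub_graph w A B ({a1} \<times> W)) (extremal_graph n \<delta> k)"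
proof -
  have finW: "finite W" using W(1) fin(2) finite_subset by blast
  have \<delta>: "1 \<le> \<delta>" using a1 fin(1) card(1) by (metis One_nat_def Suc_leI card_gt_0_iff empty_iff)
  obtain g1 where g1: "bij_betw g1 (A - {a1}) {2..\<delta>}"
    using finite_same_card_bij[of "A - {a1}" "{2..\<delta>}"] fin a1 card(1) \<delta> by auto
  obtain g2 where g2: "bij_betw g2 W {\<delta>+1..<\<delta>+k}"
    using finite_same_card_bij[of W "{\<delta>+1..<\<delta>+k}"] finW W(2) by auto
  have "card (B - W) = card {\<delta>+k..<n}"
    using card_Diff_subset[OF finW W(1)] W(2) card by simp
  then obtain g3 where g3: "bij_betw g3 (B - W) {\<delta>+k..<n}"
    using finite_same_card_bij[of "B - W" "{\<delta>+k..<n}"] fin by auto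
  define f where "f v = (if v = w then 0 else if v = a1 then 1 else if v \<in> A then g1 v
    else if v \<in> W then g2 v else g3 v)" for v
  have fA: "bij_betw f (A - {a1}) {2..\<delta>}"
    using disj by (intro iffD1[OF bij_betw_cong g1]) (auto simp: f_def)
  have fW: "bij_betw f W {\<delta>+1..<\<delta>+k}"
    using disj W(1) a1 by (intro iffD1[OF bij_betw_cong g2]) (auto simp: f_def)
  have fB: "bij_betw f (B - W) {\<delta>+k..<n}"
    using disj W(1) a1 by (intro iffD1[OF bij_betw_cong g3]) (auto simp: f_def)
  have fw: "f w = 0" "f a1 = 1" using a1 disj by (auto simp: f_def)
  have 1: "bij_betw f A {1..\<delta>}"
  proof -
    have "bij_betw f ((A - {a1}) \<union> {a1}) ({2..\<delta>} \<union> {1})"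
      using fA fw by (intro bij_betw_combine) (auto simp: bij_betw_def)
    moreover have "(A - {a1}) \<union> {a1} = A" "{2..\<delta>} \<union> {1} = {1..\<delta>}" using a1 \<delta> by auto
    ultimately show ?thesis by simp
  qed
  have 2: "bij_betw f B {\<delta>+1..<n}"
  proof -
    have "bij_betw f (W \<union> (B - W)) ({\<delta>+1..<\<delta>+k} \<union> {\<delta>+k..<n})"
      using fW fB by (intro bij_betw_combine) auto
    moreover have "W \<union> (B - W) = B" "{\<delta>+1..<\<delta>+k} \<union> {\<delta>+k..<n} = {\<delta>+1..<n}" using W(1) card by auto
    ultimately show ?thesis by simp
  qed
  have bij: "bij_betw f (insert w (A \<union> B)) {..<n}"
  proof -
    have "bij_betw f ({w} \<union> (A \<union> B)) ({0} \<union> ({1..\<delta>} \<union> {\<delta>+1..<n}))"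
      using 1 2 fw by (intro bij_betw_combine) (auto simp: bij_betw_def)
    moreover have "{0} \<union> ({1..\<delta>} \<union> {\<delta>+1..<n}) = {..<n}" using card by auto
    ultimately show ?thesis by simp
  qed
  have sub: "{a1} \<times> W \<subseteq> A \<times> B" using a1 W(1) by auto
  have inj: "inj_on f (insert w (A \<union> B))" using bij by (simp add: bij_betw_def)
  have im: "f ` A = {1..\<delta>}" "f ` B = {\<delta>+1..<n}" "f ` W = {\<delta>+1..<\<delta>+k}"
    using 1 2 fW by (auto simp: bij_betw_def)
  have mem: "f v \<in> {1..\<delta>} \<longleftrightarrow> v \<in> A" "f v \<in> {\<delta>+1..<n} \<longleftrightarrow> v \<in> B" "f v \<in> {\<delta>+1..<\<delta>+k} \<longleftrightarrow> v \<in> W"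
    "f v = 0 \<longleftrightarrow> v = w" "f v = 1 \<longleftrightarrow> v = a1" "f v < n" if v: "v \<in> insert w (A \<union> B)" for v
  proof -
    have "f v \<in> f ` S \<longleftrightarrow> v \<in> S" if "S \<subseteq> insert w (A \<union> B)" for S
      using inj_on_image_mem_iff[OF inj v that] .
    then show "f v \<in> {1..\<delta>} \<longleftrightarrow> v \<in> A" "f v \<in> {\<delta>+1..<n} \<longleftrightarrow> v \<in> B" "f v \<in> {\<delta>+1..<\<delta>+k} \<longleftrightarrow> v \<in> W"
      unfolding im[symmetric] using W(1) by blast+
    show "f v = 0 \<longleftrightarrow> v = w" "f v = 1 \<longleftrightarrow> v = a1"
      using inj_on_eq_iff[OF inj v, of w] inj_on_eq_iff[OF inj v, of a1] fw a1 by auto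
    show "f v < n" using bij v by (auto simp: bij_betw_def)
  qed
  show ?thesis
    unfolding graph_iso_def
  proof (intro exI conjI ballI)
    show "bij_betw f (verts (hub_graph w A B ({a1} \<times> W))) (verts (extremal_graph n \<delta> k))"
      using bij simple_extremal_graph(2)[OF \<delta> card(3,4)] by (simp add: hub_graph_def)
    fix u v assume "u \<in> verts (hub_graph w A B ({a1} \<times> W))" "v \<in> verts (hub_graph w A B ({a1} \<times> W))"
    then have uv: "u \<in> insert w (A \<union> B)" "v \<in> insert w (A \<union> B)" by (simp_all add: hub_graph_def)
    have "f u = f v \<longleftrightarrow> u = v" by (rule inj_on_eq_iff[OF inj uv])
    then show "{u, v} \<in> edges (hub_graph w A B ({a1} \<times> W)) \<longleftrightarrow> {f u, f v} \<in> edges (extremal_graph n \<delta> k)"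
      unfolding hub_graph_edge_iff[OF uv sub] extremal_graph_edge_iff[OF mem(6)[OF uv(1)] mem(6)[OF uv(2)] \<delta>]
        mem(1-5)[OF uv(1)] mem(1-5)[OF uv(2)] by auto
  qed
qed

section \<open>Counting edges outside a cover\<close>

text \<open>When \<open>\<X>\<close> covers \<open>F\<close>, these edges lie outside
  \<open>F\<close>; they are the supply to be compared with the rank defect.\<close>

definition outer_edges :: "'a sgraph \<Rightarrow> 'a set set \<Rightarrow> 'a set set" where
  "outer_edges G \<X> = {e \<in> edges G. \<forall>X\<in>\<X>. \<not> e \<subseteq> X}"

lemma simple_graphD:
  assumes "simple_graph G"
  shows "finite (verts G)" "edges G \<subseteq> edge_set (verts G)" "finite (edges G)"
proof -
  show "finite (verts G)" "edges G \<subseteq> edge_set (verts G)"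
    using assms by (auto simp: simple_graph_def edge_set_def)
  then show "finite (edges G)" using finite_edge_set finite_subset by blast
qed

lemma card_edge_set: "finite V \<Longrightarrow> 2 * real (card (edge_set V)) = real (card V) * (real (card V) - 1)"
proof -
  assume "finite V"
  have "2 * real (n choose 2) = real n * (real n - 1)" for n
    by (induction n) (simp_all add: numeral_2_eq_2 algebra_simps)
  then show ?thesis using \<open>finite V\<close> unfolding edge_set_def by (simp add: n_subsets)
qed

lemma sum_degree_in:
  assumes "simple_graph G" "S \<subseteq> verts G"
  shows "(\<Sum>v\<in>S. degree G v) = (\<Sum>e\<in>edges G. card (e \<inter> S))"
proof -
  have fin: "finite S" "finite (edges G)" using simple_graphD[OF assms(1)] assms(2) finite_subset by blast+
  have "(\<Sum>v\<in>S. degree G v) = (\<Sum>v\<in>S. \<Sum>e\<in>edges G. if v \<in> e then 1 else 0)"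
    using fin by (simp add: degree_def sum.If_cases Int_def)
  also have "\<dots> = (\<Sum>e\<in>edges G. \<Sum>v\<in>S. if v \<in> e then 1 else 0)" by (rule sum.swap)
  also have "\<dots> = (\<Sum>e\<in>edges G. card (e \<inter> S))"
    using fin by (intro sum.cong refl) (simp add: sum.If_cases Int_commute)
  finally show ?thesis .
qed

text \<open>All edges at an uncovered vertex are outer. The degree sum over \<open>R\<close> counts
  an outer edge twice if it lies inside \<open>R\<close> and at most once otherwise.\<close>

lemma outer_edges_uncovered:
  assumes G: "simple_graph G" and deg: "\<And>v. v \<in> verts G \<Longrightarrow> \<delta> \<le> degree G v"
    and R: "R = verts G - \<Union>\<X>"
  shows "card R * \<delta> + card {e \<in> outer_edges G \<X>. \<not> e \<subseteq> R} \<le> 2 * card (outer_edges G \<X>)"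
proof -
  let ?O = "outer_edges G \<X>"
  note fin = simple_graphD[OF G]
  have finO: "finite ?O" using fin(3) by (simp add: outer_edges_def)
  have "card R * \<delta> \<le> (\<Sum>v\<in>R. degree G v)"
    using deg sum_mono[of R "\<lambda>_. \<delta>" "degree G"] by (auto simp: R)
  also have "\<dots> = (\<Sum>e\<in>edges G. card (e \<inter> R))"
    by (rule sum_degree_in[OF G]) (auto simp: R)
  also have "\<dots> = (\<Sum>e\<in>?O. card (e \<inter> R))"
  proof (rule sum.mono_neutral_right[OF fin(3)])
    show "?O \<subseteq> edges G" by (auto simp: outer_edges_def)
    show "\<forall>e\<in>edges G - ?O. card (e \<inter> R) = 0"
    proof
      fix e assume "e \<in> edges G - ?O"
      then have "e \<inter> R = {}" by (auto simp: outer_edges_def R)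
      then show "card (e \<inter> R) = 0" by simp
    qed
  qed
  finally have "card R * \<delta> + card {e \<in> ?O. \<not> e \<subseteq> R} \<le> (\<Sum>e\<in>?O. card (e \<inter> R) + (if \<not> e \<subseteq> R then 1 else 0))"
    using finO by (simp add: sum.distrib sum.If_cases Int_def)
  also have "\<dots> \<le> (\<Sum>e\<in>?O. 2)"
  proof (rule sum_mono)
    fix e assume "e \<in> ?O"
    then have "e \<in> edge_set (verts G)" using fin(2) by (auto simp: outer_edges_def)
    then have e: "finite e" "card e = 2" by (auto simp: edge_set_def intro: card_ge_0_finite)
    have "\<not> e \<subseteq> R \<Longrightarrow> card (e \<inter> R) < card e" using e by (intro psubset_card_mono) auto
    moreover have "card (e \<inter> R) \<le> card e" using e by (intro card_mono) auto
    ultimately show "card (e \<inter> R) + (if \<not> e \<subseteq> R then 1 else 0) \<le> 2"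
      using e(2) by (cases "e \<subseteq> R") auto
  qed
  finally show ?thesis by simp
qed

text \<open>Every pair of vertices is a non-edge, lies in a block or belongs to \<open>D\<close>.
  Leaving \<open>D\<close> open allows the set of uncovered vertices to be treated as one more
  block.\<close>

lemma pairs_covered:
  assumes G: "simple_graph G" and X: "\<X> \<subseteq> Pow (verts G)"
    and O: "\<And>e. e \<in> edges G \<Longrightarrow> (\<And>X. X \<in> \<X> \<Longrightarrow> \<not> e \<subseteq> X) \<Longrightarrow> e \<in> D" "finite D"
  shows "real (card (verts G)) * (real (card (verts G)) - 1) \<le> (\<Sum>X\<in>\<X>. real (card X) * (real (card X) - 1)) +
    2 * real (card D) + 2 * real (card (edge_set (verts G) - edges G))"
proof -
  note fin = simple_graphD[OF G]
  have finX: "finite \<X>" "\<And>X. X \<in> \<X> \<Longrightarrow> finite X" using X fin(1) by (auto intro: finite_subset)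
  let ?M = "edge_set (verts G) - edges G"
  have "edge_set (verts G) \<subseteq> (\<Union>X\<in>\<X>. edge_set X) \<union> D \<union> ?M"
  proof
    fix e assume e: "e \<in> edge_set (verts G)"
    show "e \<in> (\<Union>X\<in>\<X>. edge_set X) \<union> D \<union> ?M"
    proof (cases "e \<in> edges G \<and> e \<notin> D")
      case True
      then obtain X where "X \<in> \<X>" "e \<subseteq> X" using O(1)[of e] by blast
      then show ?thesis using e by (auto simp: edge_set_def)
    qed (use e in auto)
  qed
  moreover have "finite ((\<Union>X\<in>\<X>. edge_set X) \<union> D \<union> ?M)"
    using finX O(2) finite_edge_set fin(1) by auto
  ultimately have "card (edge_set (verts G)) \<le> card ((\<Union>X\<in>\<X>. edge_set X) \<union> D \<union> ?M)"
    by (intro card_mono)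
  also have "\<dots> \<le> card (\<Union>X\<in>\<X>. edge_set X) + card D + card ?M"
    by (meson add_le_mono1 card_Un_le order_trans)
  also have "card (\<Union>X\<in>\<X>. edge_set X) \<le> (\<Sum>X\<in>\<X>. card (edge_set X))"
    by (rule card_UN_le[OF finX(1)])
  finally have "2 * real (card (edge_set (verts G))) \<le> 2 * (\<Sum>X\<in>\<X>. real (card (edge_set X))) + 2 * real (card D) + 2 * real (card ?M)"
    by (simp flip: of_nat_sum of_nat_add)
  also have "2 * (\<Sum>X\<in>\<X>. real (card (edge_set X))) = (\<Sum>X\<in>\<X>. real (card X) * (real (card X) - 1))"
    unfolding sum_distrib_left using finX(2) by (intro sum.cong refl card_edge_set) auto
  finally show ?thesis using card_edge_set[OF fin(1)] by simp
qed

text \<open>A vertex lying in no block but \<open>X\<close> has at most \<open>card X - 1\<close>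
  edges that are not outer, so at least \<open>\<delta> + 1 - card X\<close> outer ones, and an
  outer edge meets \<open>A\<close> at most once because \<open>A\<close> lies inside the block
  \<open>X\<close>.\<close>

lemma outer_edges_private_part:
  assumes G: "simple_graph G" and deg: "\<And>v. v \<in> verts G \<Longrightarrow> \<delta> \<le> degree G v"
    and X: "X \<in> \<X>" "X \<subseteq> verts G" and A: "A \<subseteq> X" "\<And>Y. Y \<in> \<X> \<Longrightarrow> Y \<noteq> X \<Longrightarrow> A \<inter> Y = {}"
  shows "card A * (\<delta> + 1) \<le> card (outer_edges G \<X>) + card A * card X"
proof -
  let ?O = "outer_edges G \<X>"
  note fin = simple_graphD[OF G]
  have finO: "finite ?O" using fin(3) by (simp add: outer_edges_def)
  have finX: "finite X" "finite A"
    using finite_subset[OF X(2) fin(1)] finite_subset[OF A(1)] by simp_all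
  have "\<delta> + 1 \<le> card {e \<in> ?O. v \<in> e} + card X" if v: "v \<in> A" for v
  proof -
    have vV: "v \<in> verts G" "v \<in> X" using v A(1) X(2) by auto
    have sub: "{e \<in> edges G. v \<in> e} \<subseteq> {e \<in> ?O. v \<in> e} \<union> (\<lambda>u. {v, u}) ` (X - {v})"
    proof
      fix e assume e: "e \<in> {e \<in> edges G. v \<in> e}"
      show "e \<in> {e \<in> ?O. v \<in> e} \<union> (\<lambda>u. {v, u}) ` (X - {v})"
      proof (cases "e \<in> ?O")
        case False
        then obtain Y where Y: "Y \<in> \<X>" "e \<subseteq> Y" using e by (auto simp: outer_edges_def)
        have "Y = X" using A(2)[OF Y(1)] Y(2) e v by auto
        moreover have "card e = 2" using e fin(2) by (auto simp: edge_set_def)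
        then obtain u where "e = {v, u}" "u \<noteq> v" using e by (auto simp: card_2_iff)
        ultimately show ?thesis using Y(2) by auto
      qed (use e in auto)
    qed
    have "\<delta> \<le> degree G v" by (rule deg[OF vV(1)])
    also have "\<dots> \<le> card ({e \<in> ?O. v \<in> e} \<union> (\<lambda>u. {v, u}) ` (X - {v}))"
      unfolding degree_def using sub finO finX by (intro card_mono) auto
    also have "\<dots> \<le> card {e \<in> ?O. v \<in> e} + card ((\<lambda>u. {v, u}) ` (X - {v}))" by (rule card_Un_le)
    also have "card ((\<lambda>u. {v, u}) ` (X - {v})) \<le> card (X - {v})" using finX by (intro card_image_le) auto
    finally have "\<delta> \<le> card {e \<in> ?O. v \<in> e} + card (X - {v})" by simp
    moreover have "card X = Suc (card (X - {v}))" using vV(2) finX(1) by (metis card.remove)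
    ultimately show ?thesis by simp
  qed
  then have "(\<Sum>v\<in>A. \<delta> + 1) \<le> (\<Sum>v\<in>A. card {e \<in> ?O. v \<in> e} + card X)" by (rule sum_mono)
  then have "card A * (\<delta> + 1) \<le> (\<Sum>v\<in>A. card {e \<in> ?O. v \<in> e}) + card A * card X"
    by (simp add: sum.distrib)
  moreover have "(\<Sum>v\<in>A. card {e \<in> ?O. v \<in> e}) \<le> card ?O"
  proof -
    have "(\<Sum>v\<in>A. card {e \<in> ?O. v \<in> e}) = (\<Sum>v\<in>A. \<Sum>e\<in>?O. if v \<in> e then 1 else 0)"
      using finO by (simp add: sum.If_cases Int_def)
    also have "\<dots> = (\<Sum>e\<in>?O. \<Sum>v\<in>A. if v \<in> e then 1 else 0)" by (rule sum.swap)
    also have "\<dots> = (\<Sum>e\<in>?O. card (e \<inter> A))"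
      using finX by (intro sum.cong refl) (simp add: sum.If_cases Int_commute)
    also have "\<dots> \<le> (\<Sum>e\<in>?O. 1)"
    proof (rule sum_mono)
      fix e assume e: "e \<in> ?O"
      then have "e \<in> edge_set (verts G)" using fin(2) by (auto simp: outer_edges_def)
      then have e2: "finite e" "card e = 2" by (auto simp: edge_set_def intro: card_ge_0_finite)
      have "\<not> e \<subseteq> A" using e X(1) A(1) by (auto simp: outer_edges_def)
      then have "card (e \<inter> A) < card e" using e2 by (intro psubset_card_mono) auto
      then show "card (e \<inter> A) \<le> 1" using e2 by simp
    qed
    finally show ?thesis by simp
  qed
  ultimately show ?thesis by simp
qed

text \<open>For \<open>t = 2 * card X - 3\<close>, \<open>g d t + 2 * d * t\<close> equals
  \<open>4 * card X * (card X - 1)\<close>; so \<open>g\<close> measures the pairs inside a block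
  against its contribution to the rank. Superadditivity is
  \<open>g d (s + t) - g d s - g d t = 2 * s * t - 3\<close>.\<close>

lemma superadditive_quadratic:
  fixes z :: "'i \<Rightarrow> real"
  defines "g \<equiv> \<lambda>d t :: real. t\<^sup>2 - (2 * d - 4) * t + 3"
  assumes "finite S" "S \<noteq> {}" "\<And>i. i \<in> S \<Longrightarrow> z i \<ge> 3"
  shows "(\<Sum>i\<in>S. g d (z i)) \<le> g d (\<Sum>i\<in>S. z i)"
  using assms(2-)
proof (induction S rule: finite_ne_induct)
  case (insert i S)
  have "(\<Sum>i\<in>S. z i) \<ge> 3"
  proof -
    obtain j where j: "j \<in> S" using insert.hyps(2) by blast
    have "0 \<le> z i" if "i \<in> S" for i using insert.prems[of i] that by simp
    then have "z j \<le> (\<Sum>i\<in>S. z i)" using j insert.hyps(1) by (intro member_le_sum) auto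
    then show ?thesis using insert.prems[of j] j by simp
  qed
  moreover have "z i \<ge> 3" using insert.prems by simp
  ultimately have "3 * 3 \<le> z i * (\<Sum>i\<in>S. z i)" by (intro mult_mono) auto
  then have "g d (z i) + g d (\<Sum>i\<in>S. z i) \<le> g d (z i + (\<Sum>i\<in>S. z i))"
    by (simp add: g_def power2_eq_square algebra_simps)
  moreover have "(\<Sum>i\<in>S. g d (z i)) \<le> g d (\<Sum>i\<in>S. z i)" using insert by simp
  ultimately show ?case using insert.hyps by simp
qed simp

text \<open>Merge all parts but two; by convexity the total is then largest when two parts are at
  the minimum \<open>c\<close> and the third takes everything else.\<close>

lemma three_part_quadratic:
  fixes z :: "'i \<Rightarrow> real"
  defines "g \<equiv> \<lambda>d t :: real. t\<^sup>2 - (2 * d - 4) * t + 3"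
  assumes S: "finite S" "3 \<le> card S" and z: "\<And>i. i \<in> S \<Longrightarrow> z i \<ge> c" and "c \<ge> 3"
  shows "(\<Sum>i\<in>S. g d (z i)) \<le> g d ((\<Sum>i\<in>S. z i) - 2 * c) + 2 * g d c" "(\<Sum>i\<in>S. z i) \<ge> 3 * c"
proof -
  obtain i where i: "i \<in> S" using S by (metis card.empty ex_in_conv not_numeral_le_zero)
  have "card (S - {i}) \<ge> 2" using S i by simp
  then obtain j where j: "j \<in> S - {i}" by (metis card.empty ex_in_conv not_numeral_le_zero)
  define Q where "Q = S - {i} - {j}"
  have Q: "finite Q" "card Q \<ge> 1" using S i j by (auto simp: Q_def)
  then have Qne: "Q \<noteq> {}" by auto
  have split: "sum h S = h i + (h j + sum h Q)" for h :: "'i \<Rightarrow> real"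
    using S(1) i j by (simp add: Q_def sum.remove)
  have zQ: "z k \<ge> 3" if "k \<in> Q" for k using z[of k] that assms(5) by (auto simp: Q_def)
  obtain m where m: "m \<in> Q" using Qne by blast
  have "0 \<le> z k" if "k \<in> Q" for k using zQ[OF that] by simp
  then have "z m \<le> sum z Q" using m Q(1) by (intro member_le_sum) auto
  then have s: "sum z Q \<ge> c" using z[of m] m by (auto simp: Q_def)
  have ij: "z i \<ge> c" "z j \<ge> c" using z i j by auto
  show "(\<Sum>i\<in>S. z i) \<ge> 3 * c" unfolding split using ij s by simp
  have "(\<Sum>i\<in>S. g d (z i)) \<le> g d (z i) + (g d (z j) + g d (sum z Q))"
    unfolding split using superadditive_quadratic[of Q z d, OF Q(1) Qne zQ] by (simp add: g_def)
  also have "\<dots> \<le> g d ((z i + (z j + sum z Q)) - 2 * c) + 2 * g d c"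
  proof -
    have "0 \<le> (z i - c) * (z j - c)" "0 \<le> (z i - c) * (sum z Q - c)" "0 \<le> (z j - c) * (sum z Q - c)"
      using ij s by auto
    then show ?thesis by (simp add: g_def power2_eq_square algebra_simps)
  qed
  finally show "(\<Sum>i\<in>S. g d (z i)) \<le> g d ((\<Sum>i\<in>S. z i) - 2 * c) + 2 * g d c" unfolding split .
qed

text \<open>The difference of the two sides is \<open>2 * (x - 2) * (d - 1 - x) + d - 4\<close>. It
  makes the edges inside a small block at most \<open>d / 4\<close> times its contribution to the
  rank bound.\<close>

lemma small_block_le:
  fixes x d :: real
  assumes "2 \<le> x" "x \<le> d - 1" "6 \<le> d"
  shows "2 * (x * (x - 1)) \<le> d * (2 * x - 3)"
proof -
  have "0 \<le> (x - 2) * (d - 1 - x)" using assms by simp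
  then show ?thesis using assms(3) by (simp add: algebra_simps)
qed

text \<open>Disjoint blocks in the first two cases, and one common vertex, not counted in
  \<open>a\<close> and \<open>b\<close>, in the last two; \<open>r\<close> is the number of
  uncovered vertices and \<open>M\<close> twice the number of non-edges. Expanding \<open>n\<close>
  leaves products such as \<open>a * b\<close>, bounded below by a product of two nonnegative
  differences.\<close>

lemma two_blocks_arith:
  fixes a b r n d D M :: real
  assumes M: "M \<le> 2 * d * n - 2 * d\<^sup>2 - d - 1" and d: "6 \<le> d" "3 * d \<le> n"
  shows "a \<ge> d \<Longrightarrow> b \<ge> d \<Longrightarrow> r \<ge> 1 \<Longrightarrow> n = a + b + r \<Longrightarrow>
      n * (n - 1) \<le> a * (a - 1) + b * (b - 1) + r * (r - 1) + 2 * D + M \<Longrightarrow> 3 * d \<le> 2 * D"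
    and "a \<ge> d + 1 \<Longrightarrow> b \<ge> d + 1 \<Longrightarrow> n = a + b \<Longrightarrow>
      n * (n - 1) \<le> a * (a - 1) + b * (b - 1) + 2 * D + M \<Longrightarrow> 3 * d \<le> 4 * D"
    and "a \<ge> d - 1 \<Longrightarrow> b \<ge> d - 1 \<Longrightarrow> r \<ge> 1 \<Longrightarrow> n = a + b + 1 + r \<Longrightarrow>
      n * (n - 1) \<le> (a + 1) * a + (b + 1) * b + r * (r - 1) + 2 * D + M \<Longrightarrow> d \<le> 2 * D"
    and "a \<ge> d + 1 \<Longrightarrow> b \<ge> d + 1 \<Longrightarrow> n = a + b + 1 \<Longrightarrow>
      n * (n - 1) \<le> (a + 1) * a + (b + 1) * b + 2 * D + M \<Longrightarrow> d \<le> 4 * D"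
proof -
  show "3 * d \<le> 2 * D" if "a \<ge> d" "b \<ge> d" "r \<ge> 1" and n: "n = a + b + r"
    and "n * (n - 1) \<le> a * (a - 1) + b * (b - 1) + r * (r - 1) + 2 * D + M"
  proof -
    have "0 \<le> (a - d) * (b - d)" "0 \<le> (r - 1) * (a + b - d)" using that d by auto
    then show ?thesis using that(1,2,5) M unfolding n by (simp add: algebra_simps power2_eq_square)
  qed
  show "3 * d \<le> 4 * D" if "a \<ge> d + 1" "b \<ge> d + 1" and n: "n = a + b"
    and "n * (n - 1) \<le> a * (a - 1) + b * (b - 1) + 2 * D + M"
  proof -
    have "0 \<le> (a - d - 1) * (b - d - 1)" using that by simp
    then show ?thesis using that(4) M d unfolding n by (simp add: algebra_simps power2_eq_square)
  qed
  show "d \<le> 2 * D" if "a \<ge> d - 1" "b \<ge> d - 1" "r \<ge> 1" and n: "n = a + b + 1 + r"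
    and "n * (n - 1) \<le> (a + 1) * a + (b + 1) * b + r * (r - 1) + 2 * D + M"
  proof -
    have "0 \<le> (a - d + 1) * (b - d + 1)" "0 \<le> (r - 1) * (a + b + 1 - d)" using that d by auto
    then show ?thesis using that(5) M unfolding n by (simp add: algebra_simps power2_eq_square)
  qed
  show "d \<le> 4 * D" if "a \<ge> d + 1" "b \<ge> d + 1" and n: "n = a + b + 1"
    and "n * (n - 1) \<le> (a + 1) * a + (b + 1) * b + 2 * D + M"
  proof -
    have "0 \<le> (a - d - 1) * (b - d - 1)" using that by simp
    then show ?thesis using that(4) M d unfolding n by (simp add: algebra_simps power2_eq_square)
  qed
qed

text \<open>The upper end for \<open>t\<close> is \<open>2 * n - 4\<close>, the largest sum still
  below full rank, minus two parts of size \<open>2 * d - 3\<close>. The quadratic is largest at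
  that end, and what remains follows from \<open>n \<ge> 3 * d\<close>.\<close>

lemma many_blocks_arith:
  fixes n d t :: real
  defines "g \<equiv> \<lambda>t. t\<^sup>2 - (2 * d - 4) * t + 3"
  assumes d: "6 \<le> d" "3 * d \<le> n" and t: "2 * d - 3 \<le> t" "t \<le> 2 * n - 4 * d + 2"
  shows "g t + 2 * g (2 * d - 3) + 2 * d * (2 * n - 3) + 4 * (2 * d * n - 2 * d\<^sup>2 - d - 1) \<le> 4 * (n * (n - 1))"
proof -
  have "0 \<le> (2 * n - 4 * d + 2 - t) * (2 * n - 4 * d + 2 + t - 2 * d + 4)"
    using d t by (intro mult_nonneg_nonneg) auto
  then have "g t \<le> g (2 * n - 4 * d + 2)" by (simp add: g_def power2_eq_square algebra_simps)
  moreover have "0 \<le> (n - 3 * d) * (8 * d - 20)" using d by simp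
  moreover have "0 \<le> d * (8 * d - 20) - 11"
  proof -
    have "6 * 28 \<le> d * (8 * d - 20)" using d by (intro mult_mono) auto
    then show ?thesis by simp
  qed
  ultimately show ?thesis using d(1) by (simp add: g_def power2_eq_square algebra_simps)
qed

text \<open>The second alternative is the configuration of the extremal graph. Three or more blocks are
  excluded by convexity: they cover too few pairs of vertices.\<close>

lemma large_cover_excess:
  assumes G: "simple_graph G" and deg: "\<And>v. v \<in> verts G \<Longrightarrow> \<delta> \<le> degree G v"
    and n: "card (verts G) = n" and \<delta>: "6 \<le> \<delta>" "3 * \<delta> \<le> n"
    and miss: "2 * real (card (edge_set (verts G) - edges G)) \<le> 2 * real \<delta> * real n - 2 * (real \<delta>)\<^sup>2 - real \<delta> - 1"
    and X: "\<X> \<subseteq> Pow (verts G)" "\<And>X. X \<in> \<X> \<Longrightarrow> \<delta> \<le> card X"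
  shows "real \<delta> * (2 * real n - 3 - real (\<Sum>X\<in>\<X>. 2 * card X - 3)) \<le> 4 * real (card (outer_edges G \<X>)) \<or>
    (\<exists>w A B. verts G = insert w (A \<union> B) \<and> A \<inter> B = {} \<and> w \<notin> A \<and> w \<notin> B \<and> card A = \<delta> \<and>
       (\<Sum>X\<in>\<X>. 2 * card X - 3) + 4 = 2 * n \<and>
       card {(a, b) \<in> A \<times> B. {a, b} \<in> edges G} \<le> card (outer_edges G \<X>))"
proof -
  let ?V = "verts G" and ?O = "outer_edges G \<X>"
  define Z where "Z = (\<Sum>X\<in>\<X>. 2 * card X - 3)"
  define oc where "oc = real (card ?O)"
  define d where "d = real \<delta>"
  define M where "M = 2 * real (card (edge_set ?V - edges G))"
  define R where "R = ?V - \<Union>\<X>"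
  define D where "D = {e \<in> ?O. \<not> e \<subseteq> R}"
  note fin = simple_graphD[OF G]
  have finX: "finite \<X>" "\<And>X. X \<in> \<X> \<Longrightarrow> finite X" using X(1) fin(1) by (auto intro: finite_subset)
  have finO: "finite ?O" using fin(3) by (simp add: outer_edges_def)
  have finD: "finite D" using finO by (simp add: D_def)
  have finR: "finite R" using fin(1) by (simp add: R_def)
  have d: "6 \<le> d" "3 * d \<le> real n" using \<delta> by (auto simp: d_def)
  have M: "M \<le> 2 * d * real n - 2 * d\<^sup>2 - d - 1" using miss by (simp add: M_def d_def)
  have "card R * \<delta> + card D \<le> 2 * card ?O"
    using outer_edges_uncovered[OF G deg R_def] by (simp add: D_def)
  then have unc: "real (card R) * d + real (card D) \<le> 2 * oc"
    unfolding oc_def d_def by (simp flip: of_nat_mult of_nat_add)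
  have DO: "real (card D) \<le> oc" using finO by (auto simp: D_def oc_def intro: card_mono)
  have goal: "?thesis" if "d * (2 * real n - 3 - real Z) \<le> 4 * oc"
    using that by (simp add: d_def Z_def oc_def)
  show ?thesis
  proof (cases "2 * n \<le> Z + 3")
    case True
    then have "2 * real n - 3 - real Z \<le> 0" by linarith
    then have "d * (2 * real n - 3 - real Z) \<le> 0" using d(1) by (simp add: mult_nonneg_nonpos)
    then show ?thesis using goal by (simp add: oc_def)
  next
    case Zn: False
    consider "card \<X> = 0" | "card \<X> = 1" | "card \<X> = 2" | "card \<X> \<ge> 3" by linarith
    then show ?thesis
    proof cases
      case 1
      then have "\<X> = {}" using finX(1) by simp
      then have "R = ?V" "Z = 0" by (auto simp: R_def Z_def)
      then have "d * (2 * real n - 3 - real Z) \<le> 4 * oc" using unc n d by (simp add: algebra_simps)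
      then show ?thesis by (rule goal)
    next
      case 2
      then obtain X0 where X0: "\<X> = {X0}" by (auto simp: card_1_singleton_iff)
      have "X0 \<subseteq> ?V" "\<delta> \<le> card X0" using X X0 by auto
      have "card R = n - card X0"
        using \<open>X0 \<subseteq> ?V\<close> X0 n fin(1) finX(2) by (simp add: R_def card_Diff_subset)
      moreover have "card X0 \<le> n" using \<open>X0 \<subseteq> ?V\<close> n fin(1) card_mono by blast
      moreover have "Z = 2 * card X0 - 3" by (simp add: Z_def X0)
      ultimately have "2 * real n - 3 - real Z = 2 * real (card R)" using \<open>\<delta> \<le> card X0\<close> \<delta>(1) by simp
      then have "d * (2 * real n - 3 - real Z) \<le> 4 * oc" using unc by (simp add: algebra_simps)
      then show ?thesis by (rule goal)
    next
      case 3
      then obtain X1 X2 where X12: "\<X> = {X1, X2}" "X1 \<noteq> X2" by (auto simp: card_2_iff)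
      have sub: "X1 \<subseteq> ?V" "X2 \<subseteq> ?V" and ge: "\<delta> \<le> card X1" "\<delta> \<le> card X2" using X X12 by auto
      have f12: "finite X1" "finite X2" using finX X12 by auto
      define i where "i = card (X1 \<inter> X2)"
      have i: "i \<le> card X1" "i \<le> card X2" using f12 by (auto simp: i_def intro: card_mono)
      have cU: "card (X1 \<union> X2) + i = card X1 + card X2"
        using card_Un_Int[OF f12] by (simp add: i_def)
      have "card R + card (X1 \<union> X2) = n"
      proof -
        have "R = ?V - (X1 \<union> X2)" by (auto simp: R_def X12)
        then have "card R = n - card (X1 \<union> X2)" using f12 sub n by (simp add: card_Diff_subset)
        moreover have "card (X1 \<union> X2) \<le> n" using sub n fin(1) card_mono[of ?V "X1 \<union> X2"] by auto
        ultimately show ?thesis by simp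
      qed
      then have nr: "n + i = card X1 + card X2 + card R" using cU by simp
      have Z: "Z = (2 * card X1 - 3) + (2 * card X2 - 3)" by (simp add: Z_def X12)
      then have Zr: "real Z = 2 * real (card X1) + 2 * real (card X2) - 6" using ge \<delta>(1) by simp
      have dem: "2 * real n - 3 - real Z = 2 * real (card R) + 3 - 2 * real i" using nr Zr by linarith
      have RX: "R \<inter> X1 = {}" "R \<inter> X2 = {}" by (auto simp: R_def X12)
      have "X1 \<noteq> {}" "X2 \<noteq> {}" using ge \<delta>(1) by auto
      then have Rne: "R \<noteq> X1" "R \<noteq> X2" using RX by auto
      have pairs: "real n * (real n - 1) \<le> real (card X1) * (real (card X1) - 1) + real (card X2) * (real (card X2) - 1)
          + real (card R) * (real (card R) - 1) + 2 * real (card D) + M"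
      proof -
        have "{X1, X2, R} \<subseteq> Pow ?V" using sub by (auto simp: R_def)
        moreover have "e \<in> D" if "e \<in> edges G" "\<And>X. X \<in> {X1, X2, R} \<Longrightarrow> \<not> e \<subseteq> X" for e
          using that by (auto simp: D_def outer_edges_def X12)
        ultimately show ?thesis
          using pairs_covered[OF G, of "{X1, X2, R}" D] finD X12(2) Rne n by (simp add: M_def)
      qed
      \<comment> \<open>The demand is \<open>d * (2 * card R + 3 - 2 * i)\<close>. By
        \<open>unc\<close> the uncovered vertices pay for the part \<open>2 * card R\<close>, so
        \<open>D\<close> has to pay only for the rest.\<close>
      have half: ?thesis if "d * (3 - 2 * real i) \<le> 2 * real (card D)"
      proof (rule goal)
        show "d * (2 * real n - 3 - real Z) \<le> 4 * oc" unfolding dem using that unc by (simp add: algebra_simps)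
      qed
      have direct: ?thesis if "card R = 0" "d * (3 - 2 * real i) \<le> 4 * oc"
      proof (rule goal)
        show "d * (2 * real n - 3 - real Z) \<le> 4 * oc" unfolding dem using that by simp
      qed
      have priv: "card (X1 - X2) * (\<delta> + 1) \<le> card ?O + card (X1 - X2) * card X1"
        "card (X2 - X1) * (\<delta> + 1) \<le> card ?O + card (X2 - X1) * card X2"
        by (rule outer_edges_private_part[OF G deg]; use sub in \<open>auto simp: X12\<close>)+
      have cd: "card (X1 - X2) = card X1 - i" "card (X2 - X1) = card X2 - i"
        using f12 by (simp_all add: i_def card_Diff_subset_Int Int_commute)
      consider "2 \<le> i" | "i = 0" "1 \<le> card R" | "i = 1" "1 \<le> card R" | "i = 0" "card R = 0" | "i = 1" "card R = 0"
        by linarith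
      then show ?thesis
      proof cases
        case 1
        then have "d * (3 - 2 * real i) \<le> 0" using d(1) by (intro mult_nonneg_nonpos) auto
        then show ?thesis by (intro half) simp
      next
        case 2
        have "3 * d \<le> 2 * real (card D)"
          using two_blocks_arith(1)[OF M d, of "real (card X1)" "real (card X2)" "real (card R)" "real (card D)"]
            pairs nr 2 ge by (simp add: d_def)
        then show ?thesis using 2 by (intro half) simp
      next
        case 3
        have "d \<le> 2 * real (card D)"
          using two_blocks_arith(3)[OF M d, of "real (card X1) - 1" "real (card X2) - 1" "real (card R)" "real (card D)"]
            pairs nr 3 ge by (simp add: d_def)
        then show ?thesis using 3 by (intro half) simp
      next
        case 4
        have "3 * d \<le> 4 * oc"
        proof (cases "card X1 = \<delta> \<or> card X2 = \<delta>")
          case True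
          then have "\<delta> \<le> card ?O" using priv cd 4 by auto
          then show ?thesis by (simp add: d_def oc_def)
        next
          case False
          then have "3 * d \<le> 4 * real (card D)"
            using two_blocks_arith(2)[OF M d, of "real (card X1)" "real (card X2)" "real (card D)"]
              pairs nr 4 ge by (simp add: d_def)
          then show ?thesis using DO by simp
        qed
        then show ?thesis using 4 by (intro direct) auto
      next
        case 5
        \<comment> \<open>A block of \<open>\<delta>\<close> vertices, one of them shared, has
          \<open>\<delta> - 1\<close> private vertices, and each of these has an outer edge.\<close>
        have small: "d \<le> 4 * oc" if "card X1 = \<delta> \<or> card X2 = \<delta>"
        proof -
          have "(\<delta> - 1) * (\<delta> + 1) \<le> card ?O + (\<delta> - 1) * \<delta>" using that priv cd 5 by auto
          moreover obtain m where "\<delta> = Suc m" using \<delta>(1) by (cases \<delta>) auto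
          ultimately have "\<delta> - 1 \<le> card ?O" by simp
          then show ?thesis using \<delta>(1) by (simp add: d_def oc_def)
        qed
        \<comment> \<open>In a block of \<open>\<delta> + 1\<close> vertices the private ones may
          have all their edges inside, so the minimum degree yields no outer edge; this is the
          exceptional alternative, with the private part as \<open>A\<close>.\<close>
        have exc: ?thesis if Y: "Y1 \<in> \<X>" "Y2 \<in> \<X>" "card (Y1 \<inter> Y2) = 1" "Y1 \<union> Y2 = ?V" "card (Y1 - Y2) = \<delta>" "\<X> = {Y1, Y2}" for Y1 Y2
        proof -
          obtain w where w: "Y1 \<inter> Y2 = {w}" using Y(3) by (auto simp: card_1_singleton_iff)
          define A B where "A = Y1 - Y2" and "B = Y2 - Y1"
          have "verts G = insert w (A \<union> B)" "A \<inter> B = {}" "w \<notin> A" "w \<notin> B" "card A = \<delta>"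
            using Y(4,5) w by (auto simp: A_def B_def)
          moreover have "Z + 4 = 2 * n" using Z nr 5 ge \<delta>(1) by simp
          moreover have "card {(a, b) \<in> A \<times> B. {a, b} \<in> edges G} \<le> card ?O"
          proof -
            have "inj_on (\<lambda>(a, b). {a, b}) {(a, b) \<in> A \<times> B. {a, b} \<in> edges G}"
              by (auto simp: inj_on_def doubleton_eq_iff A_def B_def)
            moreover have "(\<lambda>(a, b). {a, b}) ` {(a, b) \<in> A \<times> B. {a, b} \<in> edges G} \<subseteq> ?O"
              by (auto simp: outer_edges_def Y(6) A_def B_def)
            ultimately show ?thesis using finO by (rule card_inj_on_le)
          qed
          ultimately show ?thesis unfolding Z_def by blast
        qed
        have UV: "X1 \<union> X2 = ?V"
        proof -
          have "R = {}" using 5(2) finR by simp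
          then show ?thesis using sub by (auto simp: R_def X12)
        qed
        consider "card X1 = \<delta> \<or> card X2 = \<delta>" | "card X1 = \<delta> + 1" | "card X2 = \<delta> + 1"
          | "\<delta> + 2 \<le> card X1" "\<delta> + 2 \<le> card X2" using ge by linarith
        then show ?thesis
        proof cases
          case 1
          show ?thesis using small[OF 1] 5 by (intro direct) auto
        next
          case 2
          show ?thesis
            using 2 5 cd UV by (intro exc[of X1 X2]) (auto simp: X12 i_def)
        next
          case 3
          show ?thesis
            using 3 5 cd UV by (intro exc[of X2 X1]) (auto simp: X12 i_def Int_commute)
        next
          case 4
          have "d \<le> 4 * real (card D)"
            using two_blocks_arith(4)[OF M d, of "real (card X1) - 1" "real (card X2) - 1" "real (card D)"]
              pairs nr 4 5 by (simp add: d_def)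
          then show ?thesis using DO 5 by (intro direct) auto
        qed
      qed
    next
      case 4
      let ?z = "\<lambda>X. 2 * real (card X) - 3"
      let ?g = "\<lambda>t. t\<^sup>2 - (2 * d - 4) * t + 3"
      have Zz: "real Z = (\<Sum>X\<in>\<X>. ?z X)"
        unfolding Z_def of_nat_sum using X(2) \<delta>(1) by (intro sum.cong refl) (force simp: of_nat_diff)
      have zge: "2 * d - 3 \<le> ?z X" if "X \<in> \<X>" for X using X(2)[OF that] by (simp add: d_def)
      have tp: "(\<Sum>X\<in>\<X>. ?g (?z X)) \<le> ?g (real Z - 2 * (2 * d - 3)) + 2 * ?g (2 * d - 3)" "real Z \<ge> 3 * (2 * d - 3)"
        using three_part_quadratic(1)[of \<X> "2 * d - 3" ?z d] three_part_quadratic(2)[of \<X> "2 * d - 3" ?z]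
          finX(1) 4 zge d(1) unfolding Zz by auto
      have pairs: "real n * (real n - 1) \<le> (\<Sum>X\<in>\<X>. real (card X) * (real (card X) - 1)) + 2 * oc + M"
        using pairs_covered[OF G X(1), of ?O] finO n by (simp add: outer_edges_def oc_def M_def)
      have "4 * (\<Sum>X\<in>\<X>. real (card X) * (real (card X) - 1)) = (\<Sum>X\<in>\<X>. ?g (?z X)) + 2 * d * real Z"
        unfolding Zz sum_distrib_left sum.distrib[symmetric]
        by (intro sum.cong refl) (simp add: power2_eq_square algebra_simps)
      then have "4 * (real n * (real n - 1)) \<le> (\<Sum>X\<in>\<X>. ?g (?z X)) + 2 * d * real Z + 8 * oc + 4 * M"
        using pairs by linarith
      moreover have "?g (real Z - 2 * (2 * d - 3)) + 2 * ?g (2 * d - 3) + 2 * d * (2 * real n - 3) +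
          4 * (2 * d * real n - 2 * d\<^sup>2 - d - 1) \<le> 4 * (real n * (real n - 1))"
        using Zn tp(2) by (intro many_blocks_arith d) auto
      \<comment> \<open>The combination of the four inequalities above, stated for plain reals so
        that the nonlinear terms are atoms.\<close>
      moreover have "k \<le> p + q" if "s \<le> g" "m \<le> t" "c \<le> s + p + q + 4 * m" "g + k + 4 * t \<le> c"
        for s g c k p q m t :: real using that by linarith
      note this[OF tp(1) M]
      ultimately have "2 * d * (2 * real n - 3) \<le> 2 * d * real Z + 8 * oc"
        by blast
      then show ?thesis by (intro goal) (simp add: algebra_simps)
    qed
  qed
qed

text \<open>Blocks with fewer than \<open>\<delta>\<close> vertices can be dissolved, since they contain few edges.\<close>

lemma cover_excess:
  assumes G: "simple_graph G" and deg: "\<And>v. v \<in> verts G \<Longrightarrow> \<delta> \<le> degree G v"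
    and n: "card (verts G) = n" and \<delta>: "6 \<le> \<delta>" "3 * \<delta> \<le> n"
    and miss: "2 * real (card (edge_set (verts G) - edges G)) \<le> 2 * real \<delta> * real n - 2 * (real \<delta>)\<^sup>2 - real \<delta> - 1"
    and X: "\<X> \<subseteq> Pow (verts G)" "\<And>X. X \<in> \<X> \<Longrightarrow> 2 \<le> card X"
  shows "real \<delta> * (2 * real n - 3 - real (\<Sum>X\<in>\<X>. 2 * card X - 3)) \<le> 4 * real (card (outer_edges G \<X>)) \<or>
    (\<exists>w A B. verts G = insert w (A \<union> B) \<and> A \<inter> B = {} \<and> w \<notin> A \<and> w \<notin> B \<and> card A = \<delta> \<and>
       (\<Sum>X\<in>\<X>. 2 * card X - 3) + 4 = 2 * n \<and>
       card {(a, b) \<in> A \<times> B. {a, b} \<in> edges G} \<le> card (outer_edges G \<X>))"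
proof -
  define L where "L = {X \<in> \<X>. \<delta> \<le> card X}"
  define S where "S = \<X> - L"
  note fin = simple_graphD[OF G]
  have finX: "finite \<X>" "\<And>X. X \<in> \<X> \<Longrightarrow> finite X" using X(1) fin(1) by (auto intro: finite_subset)
  have finS: "finite S" using finX by (simp add: S_def)
  have finO: "finite (outer_edges G \<X>)" using fin(3) by (simp add: outer_edges_def)
  have split: "(\<Sum>X\<in>\<X>. 2 * card X - 3) = (\<Sum>X\<in>L. 2 * card X - 3) + (\<Sum>X\<in>S. 2 * card X - 3)"
  proof -
    have "L \<subseteq> \<X>" by (auto simp: L_def)
    from sum.subset_diff[OF this finX(1)] show ?thesis by (simp only: S_def add.commute)
  qed
  have "card (outer_edges G L) \<le> card (outer_edges G \<X> \<union> (\<Union>X\<in>S. edge_set X))"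
  proof (rule card_mono)
    show "finite (outer_edges G \<X> \<union> (\<Union>X\<in>S. edge_set X))"
      using finO finS finX(2) finite_edge_set by (auto simp: S_def)
    show "outer_edges G L \<subseteq> outer_edges G \<X> \<union> (\<Union>X\<in>S. edge_set X)"
      using fin(2) by (auto simp: outer_edges_def S_def edge_set_def)
  qed
  also have "\<dots> \<le> card (outer_edges G \<X>) + (\<Sum>X\<in>S. card (edge_set X))"
    using card_Un_le[of "outer_edges G \<X>" "\<Union>X\<in>S. edge_set X"] card_UN_le[OF finS, of edge_set] by linarith
  finally have "4 * real (card (outer_edges G L)) \<le> 4 * real (card (outer_edges G \<X>)) + (\<Sum>X\<in>S. 4 * real (card (edge_set X)))"
    by (simp flip: of_nat_sum of_nat_add sum_distrib_left)
  also have "(\<Sum>X\<in>S. 4 * real (card (edge_set X))) \<le> (\<Sum>X\<in>S. real \<delta> * real (2 * card X - 3))"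
  proof (rule sum_mono)
    fix Y assume Y: "Y \<in> S"
    then have c: "2 \<le> card Y" "card Y < \<delta>" "finite Y" using X(2) finX(2) by (auto simp: S_def L_def)
    have "4 * real (card (edge_set Y)) = 2 * (real (card Y) * (real (card Y) - 1))"
      using card_edge_set[OF c(3)] by simp
    also have "\<dots> \<le> real \<delta> * (2 * real (card Y) - 3)"
      using c \<delta>(1) by (intro small_block_le) auto
    also have "2 * real (card Y) - 3 \<le> real (2 * card Y - 3)" by simp
    finally show "4 * real (card (edge_set Y)) \<le> real \<delta> * real (2 * card Y - 3)" by (simp add: mult_left_mono)
  qed
  finally have OL: "4 * real (card (outer_edges G L)) \<le> 4 * real (card (outer_edges G \<X>)) + real \<delta> * real (\<Sum>X\<in>S. 2 * card X - 3)"
    by (simp add: sum_distrib_left)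
  have L: "L \<subseteq> Pow (verts G)" "\<And>X. X \<in> L \<Longrightarrow> \<delta> \<le> card X" using X(1) by (auto simp: L_def)
  show ?thesis
    using large_cover_excess[OF G deg n \<delta> miss L]
  proof (rule disjE)
    assume "real \<delta> * (2 * real n - 3 - real (\<Sum>X\<in>L. 2 * card X - 3)) \<le> 4 * real (card (outer_edges G L))"
    then show ?thesis using OL unfolding split by (simp add: algebra_simps)
  next
    assume exc: "\<exists>w A B. verts G = insert w (A \<union> B) \<and> A \<inter> B = {} \<and> w \<notin> A \<and> w \<notin> B \<and> card A = \<delta> \<and>
       (\<Sum>X\<in>L. 2 * card X - 3) + 4 = 2 * n \<and>
       card {(a, b) \<in> A \<times> B. {a, b} \<in> edges G} \<le> card (outer_edges G L)"
    show ?thesis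
    proof (cases "S = {}")
      case True
      then have "L = \<X>" by (auto simp: S_def L_def)
      then show ?thesis using exc by simp
    next
      case False
      then obtain Y where Y: "Y \<in> S" by blast
      \<comment> \<open>One small block lifts the sum from \<open>2 * n - 4\<close> to at least
        \<open>2 * n - 3\<close>, so that nothing is demanded any more.\<close>
      then have "1 \<le> 2 * card Y - 3" using X(2)[of Y] by (auto simp: S_def)
      also have "\<dots> \<le> (\<Sum>X\<in>S. 2 * card X - 3)" using Y finS by (intro member_le_sum) auto
      finally have "2 * n \<le> (\<Sum>X\<in>\<X>. 2 * card X - 3) + 3" using exc split by auto
      then have "2 * real n - 3 - real (\<Sum>X\<in>\<X>. 2 * card X - 3) \<le> 0" by linarith
      then have "real \<delta> * (2 * real n - 3 - real (\<Sum>X\<in>\<X>. 2 * card X - 3)) \<le> 0"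
        by (simp add: mult_nonneg_nonpos)
      then show ?thesis by (meson of_nat_0_le_iff order_trans mult_nonneg_nonneg zero_le_numeral)
    qed
  qed
qed

section \<open>Packing under the spectral condition\<close>

text \<open>The hub and the larger part form a clique on \<open>n - \<delta>\<close> vertices, whose
  spectral radius is \<open>n - \<delta> - 1\<close>; the positive entries on the smaller part make
  the inequality strict.\<close>

lemma lambda1_extremal_graph_gt:
  assumes "6 \<le> \<delta>" "3 * \<delta> \<le> n" "1 \<le> k" "4 * k \<le> \<delta>"
  shows "real n - real \<delta> - 1 < lambda1 (extremal_graph n \<delta> k)"
proof -
  let ?A = "{1..\<delta>}" and ?B = "{\<delta>+1..<n}" and ?W = "{\<delta>+1..<\<delta>+k}"
  let ?H = "hub_graph 0 ?A ?B ({1} \<times> ?W)"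
  have "graph_iso ?H (extremal_graph n \<delta> k)"
    using assms by (intro hub_star_iso_extremal) auto
  moreover have sub: "{1} \<times> ?W \<subseteq> ?A \<times> ?B" using assms by auto
  ultimately have eq: "lambda1 ?H = lambda1 (extremal_graph n \<delta> k)"
    using assms by (intro lambda1_iso simple_hub_graph simple_extremal_graph(1)) (auto simp: hub_graph_def)
  have "finite ?A" "finite ?B" "?A \<inter> ?B = {}" "0 \<notin> ?A" "0 \<notin> ?B" "?A \<noteq> {}" using assms by auto
  then obtain x where "hub_eigen 0 ?A ?B ({1} \<times> ?W) (lambda1 ?H + 1) x"
    using hub_eigen_lambda1 sub by metis
  then have "lambda1 ?H + 1 > real (card ?B) + 1"
    using assms sub by (intro hub_eigen_bounds(1)) (auto simp: card_cartesian_product)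
  then show ?thesis using assms eq by (simp add: of_nat_diff)
qed

text \<open>Pair the positive Perron vector of the hub graph with the nonnegative one of
  \<open>G\<close>. All contributions of missing edges vanish, so the vector of \<open>G\<close>
  also satisfies the equations of the hub graph and is therefore positive, which leaves no room for
  a missing edge.\<close>

lemma subgraph_of_hub_graph_eq:
  assumes fin: "finite A" "finite B" and disj: "A \<inter> B = {}" "w \<notin> A" "w \<notin> B" "C \<subseteq> A \<times> B" "A \<noteq> {}"
    and G: "simple_graph G" "verts G = insert w (A \<union> B)" and sub: "edges G \<subseteq> edges (hub_graph w A B C)"
    and le: "lambda1 (hub_graph w A B C) \<le> lambda1 G"
  shows "edges G = edges (hub_graph w A B C)"
proof (rule ccontr)
  let ?H = "hub_graph w A B C" and ?V = "insert w (A \<union> B)"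
  assume "edges G \<noteq> edges ?H"
  then obtain e where e: "e \<in> edges ?H" "e \<notin> edges G" using sub by blast
  have H: "simple_graph ?H" by (rule simple_hub_graph[OF fin])
  have V: "verts ?H = ?V" by (simp add: hub_graph_def)
  have finV: "finite ?V" using fin by simp
  have "e \<in> edge_set ?V" using simple_graphD(2)[OF H] e(1) V by auto
  then obtain u0 v0 where uv0: "e = {u0, v0}" "u0 \<in> ?V" "v0 \<in> ?V" by (rule edge_setE)
  obtain x where x: "\<forall>v\<in>?V. x v \<ge> 0" "\<exists>v\<in>?V. x v > 0"
    "\<And>v. v \<in> ?V \<Longrightarrow> (\<Sum>u\<in>?V. adj G v u * x u) = lambda1 G * x v"
    using lambda1_perron[OF G(1)] unfolding G(2) by blast
  obtain y where y: "\<forall>v\<in>?V. y v \<ge> 0" "\<exists>v\<in>?V. y v > 0"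
    "\<And>v. v \<in> ?V \<Longrightarrow> (\<Sum>u\<in>?V. adj ?H v u * y u) = lambda1 ?H * y v"
    using lambda1_perron[OF H] unfolding V by blast
  have "hub_eigen w A B C (lambda1 ?H + 1) y"
    using y by (intro hub_eigenI[OF fin disj]) auto
  then have ypos: "y v > 0" if "v \<in> ?V" for v using that by (auto simp: hub_eigen_def)
  have nn: "(adj ?H v u - adj G v u) * y v * x u \<ge> 0" if "v \<in> ?V" "u \<in> ?V" for u v
    using sub x(1) ypos[OF that(1)] that by (auto simp: adj_def intro!: mult_nonneg_nonneg)
  have "(\<Sum>v\<in>?V. \<Sum>u\<in>?V. (adj ?H v u - adj G v u) * y v * x u) =
      (\<Sum>v\<in>?V. \<Sum>u\<in>?V. adj ?H v u * y v * x u) - (\<Sum>v\<in>?V. \<Sum>u\<in>?V. adj G v u * y v * x u)"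
    by (simp add: sum_subtractf[symmetric] left_diff_distrib)
  also have "(\<Sum>v\<in>?V. \<Sum>u\<in>?V. adj G v u * y v * x u) = (\<Sum>v\<in>?V. y v * (\<Sum>u\<in>?V. adj G v u * x u))"
    by (simp only: sum_distrib_left mult_ac)
  also have "\<dots> = (\<Sum>v\<in>?V. lambda1 G * (y v * x v))"
    using x(3) by (intro sum.cong refl) simp
  also have "(\<Sum>v\<in>?V. \<Sum>u\<in>?V. adj ?H v u * y v * x u) = (\<Sum>u\<in>?V. \<Sum>v\<in>?V. adj ?H v u * y v * x u)"
    by (rule sum.swap)
  also have "\<dots> = (\<Sum>u\<in>?V. x u * (\<Sum>v\<in>?V. adj ?H u v * y v))"
    by (simp only: sum_distrib_left mult_ac adj_sym)
  also have "\<dots> = (\<Sum>v\<in>?V. lambda1 ?H * (y v * x v))"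
    using y(3) by (intro sum.cong refl) simp
  finally have "(\<Sum>v\<in>?V. \<Sum>u\<in>?V. (adj ?H v u - adj G v u) * y v * x u) =
      (lambda1 ?H - lambda1 G) * (\<Sum>v\<in>?V. y v * x v)"
    by (simp only: sum_distrib_left[symmetric] left_diff_distrib)
  also have "\<dots> \<le> 0"
    using le x(1) ypos by (intro mult_nonpos_nonneg sum_nonneg mult_nonneg_nonneg) (auto intro: less_imp_le)
  finally have "(\<Sum>v\<in>?V. \<Sum>u\<in>?V. (adj ?H v u - adj G v u) * y v * x u) = 0"
    using nn by (intro antisym sum_nonneg) auto
  then have z: "(adj ?H v u - adj G v u) * y v * x u = 0" if "v \<in> ?V" "u \<in> ?V" for u v
  proof -
    have "\<forall>v\<in>?V. (\<Sum>u\<in>?V. (adj ?H v u - adj G v u) * y v * x u) = 0"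
      using \<open>(\<Sum>v\<in>?V. \<Sum>u\<in>?V. (adj ?H v u - adj G v u) * y v * x u) = 0\<close> finV nn
      by (subst (asm) sum_nonneg_eq_0_iff) (auto intro!: sum_nonneg)
    then have "(\<Sum>u\<in>?V. (adj ?H v u - adj G v u) * y v * x u) = 0" using that by blast
    then have "\<forall>u\<in>?V. (adj ?H v u - adj G v u) * y v * x u = 0"
      using finV nn[OF that(1)] by (subst (asm) sum_nonneg_eq_0_iff) auto
    then show ?thesis using that by blast
  qed
  have z': "adj ?H v u * x u = adj G v u * x u" if "v \<in> ?V" "u \<in> ?V" for u v
    using z[OF that] ypos[OF that(1)] by auto
  have "hub_eigen w A B C (lambda1 G + 1) x"
  proof (rule hub_eigenI[OF fin disj])
    fix v assume v: "v \<in> ?V"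
    have "(\<Sum>u\<in>?V. adj ?H v u * x u) = (\<Sum>u\<in>?V. adj G v u * x u)"
      using z'[OF v] by (rule sum.cong[OF refl])
    then show "(\<Sum>u\<in>?V. adj ?H v u * x u) = lambda1 G * x v" using x(3)[OF v] by simp
  qed (use x in auto)
  then have "x v0 > 0" using uv0(3) by (auto simp: hub_eigen_def)
  moreover have "adj ?H u0 v0 = 1" "adj G u0 v0 = 0" using e uv0(1) by (simp_all add: adj_def)
  ultimately show False using z'[OF uv0(2,3)] by simp
qed

text \<open>\<open>G\<close> lies in the hub graph \<open>?H\<close> with the same cross edges, and
  the star graph \<open>?H'\<close> is extremal, so
  \<open>lambda1 ?H' \<le> lambda1 G \<le> lambda1 ?H\<close>. The comparison of Perron vectors then
  makes the cross edges a star, and equality of the outer terms leaves no edge missing from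
  \<open>G\<close>.\<close>

lemma iso_extremal_of_small_cut:
  assumes G: "simple_graph G" "card (verts G) = n" "verts G = insert w (A \<union> B)"
    and disj: "A \<inter> B = {}" "w \<notin> A" "w \<notin> B" and A: "card A = \<delta>"
    and \<delta>: "6 \<le> \<delta>" "3 * \<delta> \<le> n" "1 \<le> k" "4 * k \<le> \<delta>"
    and cut: "card {(a, b) \<in> A \<times> B. {a, b} \<in> edges G} < k"
    and spec: "lambda1 (extremal_graph n \<delta> k) \<le> lambda1 G"
  shows "graph_iso G (extremal_graph n \<delta> k)"
proof -
  define C where "C = {(a, b) \<in> A \<times> B. {a, b} \<in> edges G}"
  let ?H = "hub_graph w A B C"
  have finV: "finite (verts G)" using simple_graphD(1)[OF G(1)] .
  have fin: "finite A" "finite B" using finV G(3) by (auto intro: finite_subset)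
  have C: "C \<subseteq> A \<times> B" by (auto simp: C_def)
  have finC: "finite C" using C fin by (meson finite_SigmaI finite_subset)
  have Ane: "A \<noteq> {}" using A \<delta>(1) by auto
  have cB: "card B + \<delta> + 1 = n"
    using G(2) A disj fin unfolding G(3) by (simp add: card_Un_disjoint)
  have sub: "edges G \<subseteq> edges ?H"
  proof
    fix e assume e: "e \<in> edges G"
    then have "e \<in> edge_set (verts G)" using simple_graphD(2)[OF G(1)] by blast
    then obtain u v where uv: "e = {u, v}" "u \<noteq> v" "u \<in> insert w (A \<union> B)" "v \<in> insert w (A \<union> B)"
      unfolding G(3) by (rule edge_setE)
    show "e \<in> edges ?H"
      using e uv(2-) unfolding uv(1) hub_graph_edge_iff[OF uv(3,4) C]
      by (auto simp: C_def insert_commute)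
  qed
  have VH: "verts ?H = verts G" by (simp add: hub_graph_def G(3))
  have H: "simple_graph ?H" by (rule simple_hub_graph[OF fin])
  have GH: "lambda1 G \<le> lambda1 ?H"
    using sub VH G by (intro lambda1_le_of_embedding[where f = id]) (auto simp: H)
  obtain x where x: "hub_eigen w A B C (lambda1 ?H + 1) x"
    using hub_eigen_lambda1[OF fin disj C Ane] by blast
  have "Max (x ` A) \<in> x ` A" using fin(1) Ane by (intro Max_in) auto
  then obtain a1 where a1: "a1 \<in> A" "Max (x ` A) = x a1" by blast
  have a1max: "x a \<le> x a1" if "a \<in> A" for a
    unfolding a1(2)[symmetric] using fin(1) that by (intro Max_ge) auto
  define N1 where "N1 = {b. (a1, b) \<in> C}"
  have "card N1 \<le> card C"
  proof -
    have "card N1 = card ((\<lambda>b. (a1, b)) ` N1)" by (rule card_image[symmetric]) (simp add: inj_on_def)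
    also have "\<dots> \<le> card C" using finC by (intro card_mono) (auto simp: N1_def)
    finally show ?thesis .
  qed
  moreover have "card C < k" using cut by (simp add: C_def)
  ultimately have "card N1 \<le> k - 1" by linarith
  moreover have "k - 1 \<le> card B" using cB \<delta> by linarith
  moreover have "N1 \<subseteq> B" using C by (auto simp: N1_def)
  \<comment> \<open>The star has to contain all cross edges at \<open>a1\<close>, so that the edges
    of \<open>C\<close> outside it start at other vertices of \<open>A\<close>.\<close>
  ultimately obtain W where W: "N1 \<subseteq> W" "W \<subseteq> B" "card W = k - 1"
    using exists_subset_between[of N1 "k - 1" B] fin(2) by blast
  let ?S = "{a1} \<times> W"
  let ?H' = "hub_graph w A B ?S"
  have S: "?S \<subseteq> A \<times> B" using a1(1) W(2) by auto
  have iso: "graph_iso ?H' (extremal_graph n \<delta> k)"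
    using \<delta> cB A a1(1) W by (intro hub_star_iso_extremal[OF fin disj]) auto
  have "lambda1 ?H' = lambda1 (extremal_graph n \<delta> k)"
    using \<delta> iso by (intro lambda1_iso simple_hub_graph[OF fin] simple_extremal_graph(1)) (auto simp: hub_graph_def)
  then have H': "lambda1 ?H' \<le> lambda1 G" using spec by simp
  obtain y where y: "hub_eigen w A B ?S (lambda1 ?H' + 1) y"
    using hub_eigen_lambda1[OF fin disj S Ane] by blast
  have "C = ?S"
  proof (rule hub_eigen_star_extremal[OF fin C \<open>card C < k\<close> _ _ _ a1(1) a1max W(2,3) _ x y])
    show "lambda1 ?H' + 1 \<le> lambda1 ?H + 1" using H' GH by simp
    show "b \<in> W" if "(a1, b) \<in> C" for b using that W(1) by (auto simp: N1_def)
  qed (use \<delta> A cB in auto)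
  then have "edges G = edges ?H'"
    using H' sub by (intro subgraph_of_hub_graph_eq[OF fin disj S Ane G(1,3)]) auto
  moreover have "verts G = verts ?H'" by (simp add: hub_graph_def G(3))
  ultimately show ?thesis using iso unfolding graph_iso_def by simp
qed

text \<open>The function \<open>t\<^sup>2 - (\<delta> - 1) * t\<close> is larger at
  \<open>lambda1 G\<close> than at \<open>n - \<delta> - 1\<close>, so the degree bound turns into a
  strict lower bound for the number of edges.\<close>

lemma nonedges_bound:
  assumes G: "simple_graph G" "card (verts G) = n" and deg: "\<And>v. v \<in> verts G \<Longrightarrow> \<delta> \<le> degree G v"
    and \<delta>: "6 \<le> \<delta>" "3 * \<delta> \<le> n" and spec: "real n - real \<delta> - 1 < lambda1 G"
  shows "2 * real (card (edge_set (verts G) - edges G)) \<le> 2 * real \<delta> * real n - 2 * (real \<delta>)\<^sup>2 - real \<delta> - 1"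
proof -
  note fin = simple_graphD[OF G(1)]
  let ?L = "real n - real \<delta> - 1"
  have ne: "verts G \<noteq> {}" using G(2) \<delta> by auto
  have "(\<Sum>v\<in>verts G. degree G v) = (\<Sum>e\<in>edges G. card (e \<inter> verts G))"
    by (rule sum_degree_in[OF G(1)]) simp
  also have "\<dots> = (\<Sum>e\<in>edges G. 2)"
  proof (rule sum.cong[OF refl])
    fix e assume "e \<in> edges G"
    then have "e \<subseteq> verts G" "card e = 2" using fin(2) by (auto simp: edge_set_def)
    then show "card (e \<inter> verts G) = 2" by (simp add: Int_absorb2)
  qed
  finally have "(\<Sum>v\<in>verts G. degree G v) = 2 * card (edges G)" by simp
  then have sum: "(\<Sum>v\<in>verts G. real (degree G v)) = 2 * real (card (edges G))"
    by (simp flip: of_nat_sum)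
  have "0 < (lambda1 G - ?L) * (lambda1 G + ?L - (real \<delta> - 1))"
    using spec \<delta> by (intro mult_pos_pos) auto
  then have "?L\<^sup>2 - (real \<delta> - 1) * ?L < (lambda1 G)\<^sup>2 - (real \<delta> - 1) * lambda1 G"
    by (simp add: power2_eq_square algebra_simps)
  also have "\<dots> \<le> 2 * real (card (edges G)) - (real n - 1) * real \<delta>"
    using lambda1_degree_bound[OF G(1) ne deg] sum G(2) by simp
  \<comment> \<open>Both sides are integers, so the strict inequality gains one: this is the
    \<open>- 1\<close> in the conclusion.\<close>
  finally have "real_of_int ((int n - int \<delta> - 1)\<^sup>2 - (int \<delta> - 1) * (int n - int \<delta> - 1) + (int n - 1) * int \<delta>)
      < real_of_int (2 * int (card (edges G)))" by simp
  then have "(int n - int \<delta> - 1)\<^sup>2 - (int \<delta> - 1) * (int n - int \<delta> - 1) + (int n - 1) * int \<delta> + 1 \<le> 2 * int (card (edges G))"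
    unfolding of_int_less_iff by simp
  then have "real_of_int ((int n - int \<delta> - 1)\<^sup>2 - (int \<delta> - 1) * (int n - int \<delta> - 1) + (int n - 1) * int \<delta> + 1)
      \<le> real_of_int (2 * int (card (edges G)))" unfolding of_int_le_iff .
  then have E: "?L\<^sup>2 - (real \<delta> - 1) * ?L + (real n - 1) * real \<delta> + 1 \<le> 2 * real (card (edges G))" by simp
  have "card (edge_set (verts G) - edges G) = card (edge_set (verts G)) - card (edges G)"
    by (rule card_Diff_subset[OF fin(3,2)])
  moreover have "card (edges G) \<le> card (edge_set (verts G))"
    by (rule card_mono[OF finite_edge_set[OF fin(1)] fin(2)])
  ultimately have "2 * real (card (edge_set (verts G) - edges G)) = real n * (real n - 1) - 2 * real (card (edges G))"
    using card_edge_set[OF fin(1)] G(2) by (simp add: of_nat_diff)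
  then show ?thesis using E by (simp add: power2_eq_square algebra_simps)
qed

theorem theorem1p3:
  fixes G :: "'a sgraph" and n \<delta> k :: nat
  assumes "\<delta> \<ge> 6" and "n \<ge> 3 * \<delta>"
    and "1 \<le> k" and "real k \<le> real \<delta> / 4"
    and "simple_graph G" and "card (verts G) = n" and "min_degree G = \<delta>"
    and "lambda1 G \<ge> lambda1 (extremal_graph n \<delta> k)"
  shows "graph_iso G (extremal_graph n \<delta> k) \<or>
    (\<exists>(R :: nat \<Rightarrow> 'a sgraph) (T :: nat \<Rightarrow> 'a sgraph).
       let l = nat \<lfloor>(real \<delta> - 4 * real k) / 2\<rfloor> in
         (\<forall>i<k. spanning_subgraph (R i) G \<and> rigid (R i)) \<and>
         (\<forall>j<l. spanning_subgraph (T j) G \<and> is_tree (T j)) \<and>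
         disjoint_family_on (\<lambda>i. edges (R i)) {..<k} \<and>
         disjoint_family_on (\<lambda>j. edges (T j)) {..<l} \<and>
         (\<forall>i<k. \<forall>j<l. edges (R i) \<inter> edges (T j) = {}))"
proof (cases "graph_iso G (extremal_graph n \<delta> k)")
  case False
  note G = assms(5,6)
  let ?V = "verts G" and ?E = "edges G"
  note fin = simple_graphD[OF G(1)]
  define l where "l = nat \<lfloor>(real \<delta> - 4 * real k) / 2\<rfloor>"
  have k4: "4 * k \<le> \<delta>" using assms(4) by linarith
  \<comment> \<open>The only property of the number \<open>l\<close> of trees that is used.\<close>
  have kl: "4 * real k + 2 * real l \<le> real \<delta>"
  proof -
    have "(real \<delta> - 4 * real k) / 2 \<ge> 0" using assms(4) by simp
    then have "real l = of_int \<lfloor>(real \<delta> - 4 * real k) / 2\<rfloor>" by (simp add: l_def)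
    also have "\<dots> \<le> (real \<delta> - 4 * real k) / 2" by (rule of_int_floor_le)
    finally show ?thesis by simp
  qed
  have n2: "2 \<le> card ?V" using assms(1,2) G(2) by simp
  then have Vne: "?V \<noteq> {}" by auto
  have deg: "\<delta> \<le> degree G v" if "v \<in> ?V" for v
    using assms(7) fin(1) that by (auto simp: min_degree_def intro!: Min_le)
  have "real n - real \<delta> - 1 < lambda1 G"
    using lambda1_extremal_graph_gt[OF assms(1,2,3) k4] assms(8) by simp
  note miss = nonedges_bound[OF G deg assms(1,2) this]
  have cut: "k \<le> card {(a, b) \<in> A \<times> B. {a, b} \<in> ?E}"
    if "?V = insert w (A \<union> B)" "A \<inter> B = {}" "w \<notin> A" "w \<notin> B" "card A = \<delta>" for w A B
    using iso_extremal_of_small_cut[OF G that assms(1,2,3) k4 _ assms(8)] False by (meson not_le)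
  obtain p where p: "rank_stable ?V p" using ex_rank_stable[OF fin(1)] by blast
  obtain f :: "'a \<Rightarrow> real" where f: "inj_on f ?V" using ex_inj_real[OF fin(1)] .
  define rR where "rR = rk (erow p)"
  define rG where "rG = rk (erow (real_placement f))"
  \<comment> \<open>The indices below \<open>k\<close> stand for rigid subgraphs, the next
    \<open>l\<close> for trees. A single placement \<open>p\<close> serves for all the former;
    genericity is restored for each of them by \<open>rigid_of_full_rank\<close>.\<close>
  define r where "r i = (if i < k then rR else rG)" for i
  define rho where "rho i = (if i < k then 2 * n - 3 else n - 1)" for i
  have sumkl: "(\<Sum>i\<in>{..<k + l}. if i < k then a else b) = k * a + l * b" for a b :: nat
  proof -
    have "(\<Sum>i\<in>{..<k + l}. if i < k then a else b) = (\<Sum>i\<in>{..<k}. a) + (\<Sum>i\<in>{k..<k + l}. b)"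
      unfolding sum.If_cases[OF finite_lessThan] by (intro arg_cong2[where f = "(+)"] sum.cong) auto
    then show ?thesis by simp
  qed
  have rR_le: "rR F \<le> 2 * n - 3" if "F \<subseteq> ?E" for F
    using rigidity_rank_le[OF fin(1) order_trans[OF that fin(2)] n2] G(2) by (simp add: rR_def)
  have rG_le: "rG F \<le> n - 1" if "F \<subseteq> ?E" for F
    using graphic_rank_less[OF fin(1) Vne order_trans[OF that fin(2)], of f] G(2) by (simp add: rG_def)
  have "\<exists>P. (\<forall>i\<in>{..<k + l}. P i \<subseteq> ?E \<and> r i (P i) = rho i) \<and> disjoint_family_on P {..<k + l}"
  proof (rule disjoint_spanning_sets[OF fin(3)])
    show "rank_fun ?E (r i)" for i
      unfolding r_def rR_def rG_def by (cases "i < k") (simp_all add: rank_fun_rk[OF fin(3)])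
    show "r i F \<le> rho i" if "F \<subseteq> ?E" for i F
      using rR_le[OF that] rG_le[OF that] by (simp add: r_def rho_def)
    fix F assume F: "F \<subseteq> ?E"
    have rho: "(\<Sum>i\<in>{..<k + l}. rho i) = k * (2 * n - 3) + l * (n - 1)"
      unfolding rho_def by (rule sumkl)
    have rF: "(\<Sum>i\<in>{..<k + l}. r i F) = k * rR F + l * rG F"
    proof -
      have "r i F = (if i < k then rR F else rG F)" for i by (simp add: r_def)
      then show ?thesis by (simp only: sumkl)
    qed
    have finEF: "finite (?E - F)" using fin(3) by simp
    have n18: "real n \<ge> 18" using assms(1,2) by simp
    have "real k * (2 * real n - 3) + real l * (real n - 1) \<le> real (card (?E - F)) + (real k * real (rR F) + real l * real (rG F))"
    \<comment> \<open>The comparison of the two ranks requires an edge. Without one, the bound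
      \<open>n * \<delta> / 2\<close> on the number of edges from the minimum degree is
      enough.\<close>
    proof (cases "F = {}")
      case True
      have "card ?V * \<delta> \<le> 2 * card ?E"
        using outer_edges_uncovered[OF G(1) deg, of "?V" "{}"] by (simp add: outer_edges_def)
      then have "real n * real \<delta> \<le> 2 * real (card ?E)"
        using G(2) by (simp flip: of_nat_mult)
      moreover have "real n * (4 * real k + 2 * real l) \<le> real n * real \<delta>"
        using kl by (intro mult_left_mono) auto
      ultimately have "real k * (2 * real n - 3) + real l * (real n - 1) \<le> real (card ?E)"
        by (simp add: algebra_simps)
      moreover have "0 \<le> real k * real (rR F)" "0 \<le> real l * real (rG F)" "card (?E - F) = card ?E"
        using True by simp_all
      ultimately show ?thesis by linarith
    next
      case Fne: False
      have FV: "F \<subseteq> edge_set ?V" using F fin(2) by blast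
      obtain e where e: "e \<in> F" using Fne by blast
      then have "e \<in> edge_set ?V" using FV by blast
      then obtain u v where uv: "e = {u, v}" "u \<noteq> v" "u \<in> ?V" "v \<in> ?V" by (rule edge_setE)
      then have "{u, v} \<in> F" "p u \<noteq> p v"
        using e rank_stable_inj[OF p] by (auto simp: inj_on_def)
      then have RG: "Suc (rR F) \<le> 2 * rG F"
        unfolding rR_def rG_def by (rule two_mult_graphic_rank_ge[OF fin(1) FV f])
      obtain \<X> where X: "\<X> \<subseteq> Pow ?V" "\<forall>X\<in>\<X>. 2 \<le> card X" "F \<subseteq> (\<Union>X\<in>\<X>. edge_set X)"
        "(\<Sum>X\<in>\<X>. 2 * card X - 3) \<le> rR F"
        using rigidity_rank_cover[OF fin(1) p FV] unfolding rR_def by (elim exE conjE)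
      have "outer_edges G \<X> \<subseteq> ?E - F"
        using X(3) by (force simp: outer_edges_def edge_set_def)
      then have OE: "card (outer_edges G \<X>) \<le> card (?E - F)" by (rule card_mono[OF finEF])
      define a where "a = 2 * real n - 3 - real (rR F)"
      have a0: "a \<ge> 0" using rR_le[OF F] n18 by (simp add: a_def)
      have ga: "2 * (real n - 1 - real (rG F)) \<le> a" using RG by (simp add: a_def)
      have "real \<delta> * (2 * real n - 3 - real (\<Sum>X\<in>\<X>. 2 * card X - 3)) \<le> 4 * real (card (outer_edges G \<X>)) \<or>
          (\<exists>w A B. ?V = insert w (A \<union> B) \<and> A \<inter> B = {} \<and> w \<notin> A \<and> w \<notin> B \<and> card A = \<delta> \<and>
             (\<Sum>X\<in>\<X>. 2 * card X - 3) + 4 = 2 * n \<and>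
             card {(a, b) \<in> A \<times> B. {a, b} \<in> ?E} \<le> card (outer_edges G \<X>))"
        using X(2) by (intro cover_excess[OF G(1) deg G(2) assms(1,2) miss X(1)]) auto
      then have "real k * a + real l * (real n - 1 - real (rG F)) \<le> real (card (?E - F))"
      proof
        assume *: "real \<delta> * (2 * real n - 3 - real (\<Sum>X\<in>\<X>. 2 * card X - 3)) \<le> 4 * real (card (outer_edges G \<X>))"
        have "4 * (real k * a + real l * (real n - 1 - real (rG F))) \<le> (4 * real k + 2 * real l) * a"
          using mult_left_mono[OF ga, of "2 * real l"] by (simp add: algebra_simps)
        also have "\<dots> \<le> real \<delta> * a" using kl a0 by (rule mult_right_mono)
        also have "\<dots> \<le> real \<delta> * (2 * real n - 3 - real (\<Sum>X\<in>\<X>. 2 * card X - 3))"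
          using X(4) unfolding a_def by (intro mult_left_mono) linarith+
        also have "\<dots> \<le> 4 * real (card (?E - F))" using * OE by linarith
        finally show ?thesis by simp
      next
        assume "\<exists>w A B. ?V = insert w (A \<union> B) \<and> A \<inter> B = {} \<and> w \<notin> A \<and> w \<notin> B \<and> card A = \<delta> \<and>
             (\<Sum>X\<in>\<X>. 2 * card X - 3) + 4 = 2 * n \<and>
             card {(a, b) \<in> A \<times> B. {a, b} \<in> ?E} \<le> card (outer_edges G \<X>)"
        then obtain w A B where w: "?V = insert w (A \<union> B)" "A \<inter> B = {}" "w \<notin> A" "w \<notin> B" "card A = \<delta>"
          "(\<Sum>X\<in>\<X>. 2 * card X - 3) + 4 = 2 * n"
          "card {(a, b) \<in> A \<times> B. {a, b} \<in> ?E} \<le> card (outer_edges G \<X>)" by blast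
        have "k \<le> card (?E - F)" using cut[OF w(1-5)] w(7) OE by linarith
        moreover have a1: "a \<le> 1" using w(6) X(4) unfolding a_def by linarith
        moreover have "2 * n \<le> rR F + 4" using w(6) X(4) by linarith
        \<comment> \<open>\<open>2 * rG F\<close> is even and at least \<open>2 * n - 3\<close>, so
          the graphic rank is full and the trees demand nothing.\<close>
        then have "n \<le> rG F + 1" using RG by presburger
        then have "real n - 1 - real (rG F) \<le> 0" by linarith
        then have "real l * (real n - 1 - real (rG F)) \<le> 0" by (simp add: mult_nonneg_nonpos)
        moreover have "real k * a \<le> real k" using a1 mult_left_mono[of a 1 "real k"] by simp
        ultimately show ?thesis by linarith
      qed
      then show ?thesis by (simp add: a_def algebra_simps)
    qed
    moreover have "real (2 * n - 3) = 2 * real n - 3" "real (n - 1) = real n - 1"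
      using n18 by (auto simp: of_nat_diff)
    ultimately have "real (k * (2 * n - 3) + l * (n - 1)) \<le> real (card (?E - F) + (k * rR F + l * rG F))"
      by simp
    then show "(\<Sum>i\<in>{..<k + l}. rho i) \<le> card (?E - F) + (\<Sum>i\<in>{..<k + l}. r i F)"
      unfolding rho rF of_nat_le_iff .
  qed simp
  then obtain P where P': "\<forall>i\<in>{..<k + l}. P i \<subseteq> ?E \<and> r i (P i) = rho i" "disjoint_family_on P {..<k + l}"
    by (elim exE conjE)
  have P: "P i \<subseteq> ?E" "r i (P i) = rho i" if "i < k + l" for i using P'(1) that by auto
  have disj: "P i \<inter> P j = {}" if "i < k + l" "j < k + l" "i \<noteq> j" for i j
    using disjoint_family_onD[OF P'(2)] that by simp
  have rig: "rigid \<lparr>verts = ?V, edges = P i\<rparr>" if "i < k" for i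
  proof (rule rigid_of_full_rank[OF fin(1) _ n2])
    show "P i \<subseteq> edge_set ?V" using P(1)[of i] that fin(2) by auto
    show "rk (erow p) (P i) = 2 * card ?V - 3"
      using P(2)[of i] that G(2) by (simp add: r_def rho_def rR_def)
  qed
  have "\<exists>T\<subseteq>P (k + j). is_tree \<lparr>verts = ?V, edges = T\<rparr>" if "j < l" for j
  proof (rule spanning_tree_of_full_rank[OF fin(1) _ f])
    show "P (k + j) \<subseteq> edge_set ?V" using P(1)[of "k + j"] that fin(2) by auto
    show "Suc (rk (erow (real_placement f)) (P (k + j))) = card ?V"
      using P(2)[of "k + j"] that G(2) n2 by (simp add: r_def rho_def rG_def)
  qed
  then obtain T where T: "\<And>j. j < l \<Longrightarrow> T j \<subseteq> P (k + j)" "\<And>j. j < l \<Longrightarrow> is_tree \<lparr>verts = ?V, edges = T j\<rparr>"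
    by metis
  have "let l = nat \<lfloor>(real \<delta> - 4 * real k) / 2\<rfloor> in
         (\<forall>i<k. spanning_subgraph (\<lparr>verts = ?V, edges = P i\<rparr>) G \<and> rigid (\<lparr>verts = ?V, edges = P i\<rparr>)) \<and>
         (\<forall>j<l. spanning_subgraph (\<lparr>verts = ?V, edges = T j\<rparr>) G \<and> is_tree (\<lparr>verts = ?V, edges = T j\<rparr>)) \<and>
         disjoint_family_on (\<lambda>i. edges (\<lparr>verts = ?V, edges = P i\<rparr>)) {..<k} \<and>
         disjoint_family_on (\<lambda>j. edges (\<lparr>verts = ?V, edges = T j\<rparr>)) {..<l} \<and>
         (\<forall>i<k. \<forall>j<l. edges (\<lparr>verts = ?V, edges = P i\<rparr>) \<inter> edges (\<lparr>verts = ?V, edges = T j\<rparr>) = {})"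
    unfolding l_def[symmetric] Let_def
  proof (intro conjI allI impI)
    fix i assume i: "i < k"
    show "spanning_subgraph \<lparr>verts = ?V, edges = P i\<rparr> G" using P(1)[of i] i by (simp add: spanning_subgraph_def)
    show "rigid \<lparr>verts = ?V, edges = P i\<rparr>" by (rule rig[OF i])
    fix j assume j: "j < l"
    have "P i \<inter> P (k + j) = {}" using i j by (intro disj) auto
    then show "edges \<lparr>verts = ?V, edges = P i\<rparr> \<inter> edges \<lparr>verts = ?V, edges = T j\<rparr> = {}"
      using T(1)[OF j] by auto
  next
    fix j assume j: "j < l"
    show "spanning_subgraph \<lparr>verts = ?V, edges = T j\<rparr> G"
      using P(1)[of "k + j"] T(1)[OF j] j by (simp add: spanning_subgraph_def)
    show "is_tree \<lparr>verts = ?V, edges = T j\<rparr>" by (rule T(2)[OF j])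
  next
    show "disjoint_family_on (\<lambda>i. edges \<lparr>verts = ?V, edges = P i\<rparr>) {..<k}"
      using disj by (auto simp: disjoint_family_on_def)
    show "disjoint_family_on (\<lambda>j. edges \<lparr>verts = ?V, edges = T j\<rparr>) {..<l}"
      unfolding disjoint_family_on_def
    proof (intro ballI impI)
      fix i j assume ij: "i \<in> {..<l}" "j \<in> {..<l}" "i \<noteq> j"
      have "P (k + i) \<inter> P (k + j) = {}" using ij by (intro disj) auto
      then show "edges \<lparr>verts = ?V, edges = T i\<rparr> \<inter> edges \<lparr>verts = ?V, edges = T j\<rparr> = {}"
        using T(1)[of i] T(1)[of j] ij by auto
    qed
  qed
  then show ?thesis
    by - (rule disjI2, rule exI[where x = "\<lambda>i. \<lparr>verts = ?V, edges = P i\<rparr>"],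
      rule exI[where x = "\<lambda>j. \<lparr>verts = ?V, edges = T j\<rparr>"])
qed blast

end
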